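(* Consider the eigenvalue problem $$u''-q(x)u+\lambda u=0\ \ (0<x<\pi),\qquad B_i(u)=a_{i1}u'(0)+a_{i2}u'(\pi)+a_{i3}u(0)+a_{i4}u(\pi)=0\ \ (i=1,2),$$ where $q\in L_2(0,\pi)$ is complex-valued, $B_1,B_2$ are linearly independent forms with complex coefficients, and the boundary conditions are regular but not strongly regular, i.e. the minors $A_{ij}$ of the coefficient matrix satisfy $A_{12}=0$, $A_{14}+A_{23}\ne 0$, and either $A_{14}+A_{23}=-(A_{13}+A_{24})$ or $A_{14}+A_{23}=A_{13}+A_{24}$. Let $\alpha=A_{14}/(A_{14}+A_{23})$. If $\alpha\neq 1/2$, then for any $\varepsilon>0$ there exists a function $\tilde q\in L_2(0,\pi)$ such that $\|q-\tilde q\|_{L_2(0,\pi)}<\varepsilon$ and the eigenvalue problem with the same boundary conditions and with $q$ replaced by $\tilde q$ has an asymptotically multiple spectrum.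
   Context: $A=(a_{ij})$ is the $2\times4$ matrix of coefficients of the boundary conditions, and $A_{ij}$ ($1\le i<j\le 4$) is the determinant of the $2\times 2$ matrix formed by the $i$th and $j$th columns of $A$. Let $c(x,\mu),s(x,\mu)$ (with $\lambda=\mu^2$) be the solutions of $u''-q(x)u+\mu^2u=0$ with $c(0,\mu)=s'(0,\mu)=1$, $c'(0,\mu)=s(0,\mu)=0$. The eigenvalues are the numbers $\lambda=\mu^2$ with $\Delta(\mu)=0$, where $$\Delta(\mu)=(-1)^{\theta+1}+\alpha c(\pi,\mu)+(1-\alpha)s'(\pi,\mu)+\gamma s(\pi,\mu),$$ $\gamma=-A_{34}/(A_{14}+A_{23})$, and $\theta=0$ if $A_{14}+A_{23}=-(A_{13}+A_{24})$, $\theta=1$ if $A_{14}+A_{23}=A_{13}+A_{24}$. The multiplicity of an eigenvalue is the algebraic one, i.e. its multiplicity as a zero of the characteristic determinant regarded as an (entire) function of $\lambda=\mu^2$; an eigenvalue is simple if its multiplicity is 1 and multiple otherwise. The spectrum is called asymptotically multiple if the set of simple eigenvalues is finite. *)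

theory Defs
  imports "HOL-Complex_Analysis.Complex_Analysis"
begin

definition L2_fun :: "(real \<Rightarrow> complex) \<Rightarrow> bool" where
  "L2_fun q \<longleftrightarrow> q \<in> borel_measurable (lebesgue_on {0<..<pi}) \<and>
     integrable (lebesgue_on {0<..<pi}) (\<lambda>x. (cmod (q x))\<^sup>2)"

definition L2_norm :: "(real \<Rightarrow> complex) \<Rightarrow> real" where
  "L2_norm q = sqrt (LINT x|lebesgue_on {0<..<pi}. (cmod (q x))\<^sup>2)"

text \<open>
  Solutions of \<open>u'' - q u + lam u = 0\<close> on \<open>[0, \<pi>]\<close> in the Caratheodory sense, with \<open>u'\<close> carried along
  as the second component. That \<open>u'\<close> is absolutely continuous and satisfies the equation almost
  everywhere is expressed by \<open>u'\<close> being an indefinite Lebesgue integral of \<open>(q - lam) u\<close>.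
\<close>

definition sl_solution :: "(real \<Rightarrow> complex) \<Rightarrow> complex \<Rightarrow> (real \<Rightarrow> complex) \<Rightarrow> (real \<Rightarrow> complex) \<Rightarrow> bool" where
  "sl_solution q lam u u' \<longleftrightarrow>
     (\<forall>x\<in>{0..pi}. (u has_vector_derivative u' x) (at x within {0..pi})) \<and>
     (\<lambda>t. (q t - lam) * u t) absolutely_integrable_on {0..pi} \<and>
     (\<forall>x\<in>{0..pi}. u' x = u' 0 + integral {0..x} (\<lambda>t. (q t - lam) * u t))"

text \<open>
  The pair \<open>(u, u')\<close> solving the Cauchy problem \<open>u(0) = a\<close>, \<open>u'(0) = b\<close>. For square integrable \<open>q\<close> it
  exists and its values on \<open>[0, \<pi>]\<close> are unique; values outside \<open>[0, \<pi>]\<close> are irrelevant.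
\<close>

definition cauchy_solution ::
    "(real \<Rightarrow> complex) \<Rightarrow> complex \<Rightarrow> complex \<Rightarrow> complex \<Rightarrow> (real \<Rightarrow> complex) \<times> (real \<Rightarrow> complex)" where
  "cauchy_solution q lam a b =
     (SOME (u, u'). sl_solution q lam u u' \<and> u 0 = a \<and> u' 0 = b)"

text \<open>
  The fundamental solutions depend on \<open>\<mu>\<close> only through \<open>lam = \<mu>\<^sup>2\<close>, so they are indexed by \<open>lam\<close>.
\<close>

definition sl_c :: "(real \<Rightarrow> complex) \<Rightarrow> complex \<Rightarrow> real \<Rightarrow> complex" where
  "sl_c q lam = fst (cauchy_solution q lam 1 0)"

definition sl_s :: "(real \<Rightarrow> complex) \<Rightarrow> complex \<Rightarrow> real \<Rightarrow> complex" where
  "sl_s q lam = fst (cauchy_solution q lam 0 1)"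

definition sl_s' :: "(real \<Rightarrow> complex) \<Rightarrow> complex \<Rightarrow> real \<Rightarrow> complex" where
  "sl_s' q lam = snd (cauchy_solution q lam 0 1)"

text \<open>
  The boundary conditions are given by a \<open>2 \<times> 4\<close> matrix. In the index type \<open>4\<close> the numeral \<open>4\<close>
  coincides with \<open>0\<close>, so that \<open>1, 2, 3, 4\<close> are exactly its four distinct elements.
\<close>

definition bform :: "complex^4^2 \<Rightarrow> 2 \<Rightarrow> (real \<Rightarrow> complex) \<Rightarrow> (real \<Rightarrow> complex) \<Rightarrow> complex" where
  "bform A i u u' = A $ i $ 1 * u' 0 + A $ i $ 2 * u' pi + A $ i $ 3 * u 0 + A $ i $ 4 * u pi"

definition bforms_independent :: "complex^4^2 \<Rightarrow> bool" where
  "bforms_independent A \<longleftrightarrow> (\<forall>a b. a *s row 1 A + b *s row 2 A = 0 \<longrightarrow> a = 0 \<and> b = 0)"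

definition minor2 :: "complex^4^2 \<Rightarrow> 4 \<Rightarrow> 4 \<Rightarrow> complex" where
  "minor2 A i j = det (\<chi> r k. A $ r $ (if k = 1 then i else j) :: complex^2^2)"

lemma minor2_eq: "minor2 A i j = A $ 1 $ i * A $ 2 $ j - A $ 1 $ j * A $ 2 $ i"
  by (simp add: minor2_def det_2)

definition regular_not_strongly_regular :: "complex^4^2 \<Rightarrow> bool" where
  "regular_not_strongly_regular A \<longleftrightarrow>
     minor2 A 1 2 = 0 \<and> minor2 A 1 4 + minor2 A 2 3 \<noteq> 0 \<and>
     (minor2 A 1 4 + minor2 A 2 3 = - (minor2 A 1 3 + minor2 A 2 4) \<or>
      minor2 A 1 4 + minor2 A 2 3 = minor2 A 1 3 + minor2 A 2 4)"

definition bc_alpha :: "complex^4^2 \<Rightarrow> complex" where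
  "bc_alpha A = minor2 A 1 4 / (minor2 A 1 4 + minor2 A 2 3)"

definition bc_gamma :: "complex^4^2 \<Rightarrow> complex" where
  "bc_gamma A = - minor2 A 3 4 / (minor2 A 1 4 + minor2 A 2 3)"

text \<open>
  For boundary conditions that are regular but not strongly regular exactly one of the two cases
  occurs, because \<open>A\<^sub>1\<^sub>4 + A\<^sub>2\<^sub>3 \<noteq> 0\<close>.
\<close>

definition bc_theta :: "complex^4^2 \<Rightarrow> nat" where
  "bc_theta A = (if minor2 A 1 4 + minor2 A 2 3 = - (minor2 A 1 3 + minor2 A 2 4) then 0 else 1)"

text \<open>
  The characteristic determinant as a function of \<open>lam\<close>. For boundary conditions that are regular but
  not strongly regular, this is \<open>- (B\<^sub>1(c) B\<^sub>2(s) - B\<^sub>1(s) B\<^sub>2(c)) / (A\<^sub>1\<^sub>4 + A\<^sub>2\<^sub>3)\<close> multiplied out, with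
  \<open>A\<^sub>1\<^sub>2 = 0\<close> and the Wronskian of \<open>c\<close> and \<open>s\<close> equal to \<open>1\<close>.
\<close>

definition char_det :: "complex^4^2 \<Rightarrow> (real \<Rightarrow> complex) \<Rightarrow> complex \<Rightarrow> complex" where
  "char_det A q lam = (-1) ^ (bc_theta A + 1) + bc_alpha A * sl_c q lam pi
     + (1 - bc_alpha A) * sl_s' q lam pi + bc_gamma A * sl_s q lam pi"

definition is_eigenvalue :: "complex^4^2 \<Rightarrow> (real \<Rightarrow> complex) \<Rightarrow> complex \<Rightarrow> bool" where
  "is_eigenvalue A q lam \<longleftrightarrow>
     (\<exists>u u'. sl_solution q lam u u' \<and> (\<exists>x\<in>{0..pi}. u x \<noteq> 0) \<and> (\<forall>i. bform A i u u' = 0))"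

text \<open>
  Multiplicity is the order of a zero of the characteristic determinant as a function of \<open>lam\<close> (not
  of \<open>\<mu>\<close>); \<^const>\<open>zorder\<close> is meaningful since \<^term>\<open>char_det A q\<close> is entire and not identically zero.
\<close>

definition alg_mult :: "complex^4^2 \<Rightarrow> (real \<Rightarrow> complex) \<Rightarrow> complex \<Rightarrow> int" where
  "alg_mult A q lam = zorder (char_det A q) lam"

definition simple_eigenvalue :: "complex^4^2 \<Rightarrow> (real \<Rightarrow> complex) \<Rightarrow> complex \<Rightarrow> bool" where
  "simple_eigenvalue A q lam \<longleftrightarrow> is_eigenvalue A q lam \<and> alg_mult A q lam = 1"

definition asymptotically_multiple :: "complex^4^2 \<Rightarrow> (real \<Rightarrow> complex) \<Rightarrow> bool" where
  "asymptotically_multiple A q \<longleftrightarrow> finite {lam. simple_eigenvalue A q lam}"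

end

theory Submission
  imports Defs
begin

text \<open>
  Only the orders of the zeros of the entire function \<open>\<Delta>\<close> matter. Write \<open>\<mu> = k + z\<close>, where \<open>k\<close> has the
  parity of \<open>\<theta>\<close>. Then \<open>(-1)\<^sup>k \<mu> \<Delta>(\<mu>)\<close> equals \<open>\<mu> (cos \<pi>z - 1)\<close> minus \<open>\<alpha> - 1/2\<close> times the integral of
  \<open>q(t) sin 2kt\<close>, up to a remainder that is holomorphic in \<open>z\<close>, of size \<open>O(|z| + 1/k)\<close>, and Lipschitz
  in \<open>q\<close>. As \<open>\<alpha> \<noteq> 1/2\<close>, the sine coefficient of the potential at \<open>2k\<close> can be used to merge the pair of
  zeros near \<open>k\<close>. Requiring this for all large \<open>k\<close> at once is a fixed point equation for the sequence
  of pairs (position of the double zero, sine coefficient), and it is a contraction if only large \<open>k\<close>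
  are involved. Its solution has coefficients \<open>O(k powr (-5/8))\<close> and differs from \<open>q\<close> only in a tail of the
  sine series, hence little in \<open>L\<^sub>2\<close>. Comparing \<open>\<Delta>\<close> with \<open>\<plusminus>1 + cos \<pi>\<mu>\<close> shows that there are no other large zeros.
\<close>

section \<open>The Cauchy problem\<close>

text \<open>The number 1/2 arises at \<mu> = k: there the parts of \<mu> c(\<pi>,\<mu>) and \<mu>
  s'(\<pi>,\<mu>) that are linear in q are -1/2 and +1/2 times (-1)^k times the sine coefficient,
  and the weights \<alpha> and 1 - \<alpha> leave -(\<alpha> - 1/2). All that the potential and
  \<gamma> contribute besides is O(1/k) at the integer, but merely bounded on the unit disc around
  it. Two kinds of estimates are therefore carried along, one on the disc and a sharper one at its
  centre; a Cauchy estimate passes from the centre to the double zero, whose distance from k is at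
  most \<open>k powr (-7/8)\<close>. The obstacle is that every double-zero condition involves all
  sine coefficients. The supremum norm on sequences copes with this coupling: the scaling factors
  \<open>k powr (-5/8)\<close> have a small square sum, so changing the unknowns by at most D moves
  the potential by at most D in L1, uniformly in k. That no further zero lies near k is not a
  counting argument: a function close to cos \<pi>z - 1 with a double zero near 0 has no other zero
  there, by a Taylor estimate.\<close>

lemma absolutely_integrable_mult_continuous:
  fixes p u :: "real \<Rightarrow> complex"
  assumes p: "p absolutely_integrable_on {a..b}" and u: "continuous_on {a..b} u"
  shows "(\<lambda>t. p t * u t) absolutely_integrable_on {a..b}"
proof -
  have "(\<lambda>t. u t * p t) absolutely_integrable_on {a..b}"
  proof (rule absolutely_integrable_bounded_measurable_product[where h = "(*)" and f = u and g = p])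
    show "u \<in> borel_measurable (lebesgue_on {a..b})"
      by (rule continuous_imp_measurable_on_sets_lebesgue[OF u]) (simp add: lmeasurable_cbox)
    show "bounded (u ` {a..b})"
      using u compact_continuous_image compact_imp_bounded by blast
    show "bilinear ((*) :: complex \<Rightarrow> complex \<Rightarrow> complex)"
      using bilinear_conv_bounded_bilinear bounded_bilinear_mult by blast
  qed (use p in auto)
  then show ?thesis by (simp add: mult.commute)
qed

abbreviation L1_fun :: "(real \<Rightarrow> 'a::euclidean_space) \<Rightarrow> bool" where
  "L1_fun f \<equiv> f absolutely_integrable_on {0..pi}"

lemma absolutely_integrable_on_initial:
  fixes p :: "real \<Rightarrow> 'a::euclidean_space"
  assumes "L1_fun p" "x \<in> {0..pi}"
  shows "p absolutely_integrable_on {0..x}"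
  using absolutely_integrable_on_subinterval[OF assms(1), of 0 x] assms(2) by auto

lemma integrable_on_initial:
  fixes p :: "real \<Rightarrow> 'a::euclidean_space"
  assumes "L1_fun p" "x \<in> {0..pi}"
  shows "p integrable_on {0..x}"
  using absolutely_integrable_on_initial[OF assms] set_lebesgue_integral_eq_integral(1) by blast

definition L1_norm :: "(real \<Rightarrow> complex) \<Rightarrow> real" where
  "L1_norm p = integral {0..pi} (\<lambda>t. norm (p t))"

lemma L1_norm_nonneg: "L1_norm p \<ge> 0"
  unfolding L1_norm_def by (cases "(\<lambda>t. norm (p t)) integrable_on {0..pi}") (auto intro: integral_nonneg simp: not_integrable_integral)

lemma norm_integral_mult_le:
  fixes p u :: "real \<Rightarrow> complex"
  assumes p: "L1_fun p" and x: "x \<in> {0..pi}"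
    and pu: "(\<lambda>s. p s * u s) integrable_on {0..x}"
    and u: "\<And>s. s \<in> {0..x} \<Longrightarrow> norm (u s) \<le> m"
  shows "norm (integral {0..x} (\<lambda>s. p s * u s)) \<le> L1_norm p * m"
proof -
  have np: "(\<lambda>t. norm (p t)) integrable_on {0..pi}"
    using p unfolding absolutely_integrable_on_def by simp
  have np': "(\<lambda>t. norm (p t)) integrable_on {0..x}"
    using absolutely_integrable_on_initial[OF p x] unfolding absolutely_integrable_on_def by simp
  have m0: "m \<ge> 0" using u[of 0] x norm_ge_zero[of "u 0"] by (smt (verit) atLeastAtMost_iff)
  have "norm (integral {0..x} (\<lambda>s. p s * u s)) \<le> integral {0..x} (\<lambda>s. norm (p s) * m)"
    using pu np' u by (intro integral_norm_bound_integral)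
      (auto simp: norm_mult intro!: mult_left_mono integrable_on_mult_left)
  also have "\<dots> = integral {0..x} (\<lambda>s. norm (p s)) * m" by simp
  also have "\<dots> \<le> L1_norm p * m"
    unfolding L1_norm_def using m0 np np' x
    by (intro mult_right_mono integral_subset_le) auto
  finally show ?thesis .
qed

text \<open>With p = q - lam, the Cauchy problem u'' = p u, u(0) = a, u'(0) = b becomes u = a + b x
  + \<open>volterra p u\<close>. The iterated integral, in place of the kernel x - s, makes the
  inner integral the derivative at every point.\<close>

definition volterra :: "(real \<Rightarrow> complex) \<Rightarrow> (real \<Rightarrow> complex) \<Rightarrow> real \<Rightarrow> complex" where
  "volterra p u x = integral {0..x} (\<lambda>t. integral {0..t} (\<lambda>s. p s * u s))"

lemma continuous_on_indefinite:
  fixes p u :: "real \<Rightarrow> complex"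
  assumes p: "L1_fun p" and u: "continuous_on {0..pi} u"
  shows "continuous_on {0..pi} (\<lambda>t. integral {0..t} (\<lambda>s. p s * u s))"
  by (intro indefinite_integral_continuous_1 integrable_on_initial absolutely_integrable_mult_continuous assms)
    auto

lemma volterra_has_derivative:
  assumes "L1_fun p" "continuous_on {0..pi} u" "x \<in> {0..pi}"
  shows "(volterra p u has_vector_derivative integral {0..x} (\<lambda>s. p s * u s)) (at x within {0..pi})"
  unfolding volterra_def
  using integral_has_vector_derivative[OF continuous_on_indefinite[OF assms(1,2)] assms(3)] .

lemma continuous_on_volterra:
  assumes "L1_fun p" "continuous_on {0..pi} u"
  shows "continuous_on {0..pi} (volterra p u)"
  using volterra_has_derivative[OF assms] continuous_on_eq_continuous_within
    has_vector_derivative_continuous by blast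

lemma integrable_mult_initial:
  fixes p u :: "real \<Rightarrow> complex"
  assumes "L1_fun p" "continuous_on {0..pi} u" "x \<in> {0..pi}"
  shows "(\<lambda>s. p s * u s) integrable_on {0..x}"
  by (intro integrable_on_initial absolutely_integrable_mult_continuous assms)

lemma integrable_continuous_initial:
  fixes g :: "real \<Rightarrow> complex"
  assumes "continuous_on {0..pi} g" "x \<in> {0..pi}"
  shows "g integrable_on {0..x}"
  using assms by (intro integrable_continuous_real continuous_on_subset[OF assms(1)]) auto

text \<open>The inner integral is at most P m exp (2 P t), and integrating the exponential divides
  by 2 P. In the norm weighted by exp (2 P x) the operator is thus a contraction on the whole
  interval, however large p is.\<close>

lemma volterra_weighted:
  assumes p: "L1_fun p" and P: "L1_norm p \<le> P" "P > 0"
    and u: "continuous_on {0..pi} u"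
    and m: "\<And>x. x \<in> {0..pi} \<Longrightarrow> norm (u x) \<le> m * exp (2 * P * x)"
    and x: "x \<in> {0..pi}"
  shows "norm (volterra p u x) \<le> m / 2 * exp (2 * P * x)"
proof -
  have "norm (u 0) \<le> m" using m[of 0] by simp
  then have m0: "m \<ge> 0" using norm_ge_zero order_trans by blast
  have W: "norm (integral {0..t} (\<lambda>s. p s * u s)) \<le> P * m * exp (2 * P * t)" if t: "t \<in> {0..x}" for t
  proof -
    have "norm (integral {0..t} (\<lambda>s. p s * u s)) \<le> L1_norm p * (m * exp (2 * P * t))"
    proof (rule norm_integral_mult_le[OF p _ integrable_mult_initial[OF p u]])
      fix s assume s: "s \<in> {0..t}"
      have "norm (u s) \<le> m * exp (2 * P * s)" using m s t x by auto
      also have "\<dots> \<le> m * exp (2 * P * t)" using s P m0 by (intro mult_left_mono) auto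
      finally show "norm (u s) \<le> m * exp (2 * P * t)" .
    qed (use t x in auto)
    also have "\<dots> \<le> P * (m * exp (2 * P * t))" using P m0 by (intro mult_right_mono) auto
    finally show ?thesis by simp
  qed
  have hi: "((\<lambda>t. P * m * exp (2 * P * t)) has_integral (m / 2 * exp (2 * P * x) - m / 2 * exp (2 * P * 0))) {0..x}"
    using x P(2) by (intro fundamental_theorem_of_calculus)
      (auto intro!: derivative_eq_intros simp flip: has_real_derivative_iff_has_vector_derivative)
  have "norm (volterra p u x) \<le> integral {0..x} (\<lambda>t. P * m * exp (2 * P * t))"
    unfolding volterra_def
    by (intro integral_norm_bound_integral W has_integral_integrable[OF hi]
        integrable_continuous_initial[OF continuous_on_indefinite[OF p u] x])
  also have "\<dots> = m / 2 * exp (2 * P * x) - m / 2" using integral_unique[OF hi] by simp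
  finally show ?thesis using m0 by linarith
qed

lemma exponential_weight_sup:
  fixes u :: "real \<Rightarrow> complex"
  assumes "continuous_on {0..pi} u"
  obtains z m where "z \<in> {0..pi}" "norm (u z) = m * exp (y * z)" "m \<ge> 0"
    "\<And>t. t \<in> {0..pi} \<Longrightarrow> norm (u t) \<le> m * exp (y * t)"
proof -
  have "continuous_on {0..pi} (\<lambda>t. norm (u t) * exp (- (y * t)))"
    by (intro continuous_intros assms)
  then obtain z where z: "z \<in> {0..pi}"
    and max: "\<And>t. t \<in> {0..pi} \<Longrightarrow> norm (u t) * exp (- (y * t)) \<le> norm (u z) * exp (- (y * z))"
    using continuous_attains_sup[of "{0..pi}" "\<lambda>t. norm (u t) * exp (- (y * t))"] by fastforce
  show ?thesis
    by (rule that[OF z, of "norm (u z) * exp (- (y * z))"])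
      (use max in \<open>auto simp: exp_minus field_simps\<close>)
qed

text \<open>A substitute for Gronwall's inequality: \<open>step\<close>, applied with the best
  constant m at the point where it is attained, gives m \<le> a + m/2.\<close>

lemma exponential_bootstrap:
  fixes u :: "real \<Rightarrow> complex"
  assumes u: "continuous_on {0..pi} u"
    and step: "\<And>x m. \<lbrakk>x \<in> {0..pi}; m \<ge> 0; \<And>t. t \<in> {0..pi} \<Longrightarrow> norm (u t) \<le> m * exp (y * t)\<rbrakk>
      \<Longrightarrow> norm (u x) \<le> (a + m / 2) * exp (y * x)"
    and x: "x \<in> {0..pi}"
  shows "norm (u x) \<le> 2 * a * exp (y * x)"
proof -
  obtain z m where zm: "z \<in> {0..pi}" "norm (u z) = m * exp (y * z)" "m \<ge> 0"
    "\<And>t. t \<in> {0..pi} \<Longrightarrow> norm (u t) \<le> m * exp (y * t)"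
    using exponential_weight_sup[OF u] by blast
  have "m * exp (y * z) \<le> (a + m / 2) * exp (y * z)"
    using step[OF zm(1,3,4)] zm(2) by simp
  then have "m \<le> 2 * a" by simp
  then show ?thesis using zm(4)[OF x] by (meson exp_ge_zero mult_right_mono order_trans)
qed

text \<open>An a priori bound by the residual. It serves twice in the differentiation in lam: for
  the difference quotients and for their distance to the limit.\<close>

lemma volterra_bound:
  assumes p: "L1_fun p" and P: "L1_norm p \<le> P" "P > 0"
    and u: "continuous_on {0..pi} u"
    and F: "\<And>x. x \<in> {0..pi} \<Longrightarrow> norm (u x - volterra p u x) \<le> F"
    and x: "x \<in> {0..pi}"
  shows "norm (u x) \<le> 2 * F * exp (2 * P * pi)"
proof -
  have F0: "F \<ge> 0" using F[OF x] norm_ge_zero order_trans by blast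
  have "norm (u x) \<le> 2 * F * exp (2 * P * x)"
  proof (rule exponential_bootstrap[OF u _ x])
    fix y m assume y: "y \<in> {0..pi}" and m: "\<And>t. t \<in> {0..pi} \<Longrightarrow> norm (u t) \<le> m * exp (2 * P * t)"
    have "F * 1 \<le> F * exp (2 * P * y)" using F0 P y by (intro mult_left_mono) auto
    then show "norm (u y) \<le> (F + m / 2) * exp (2 * P * y)"
      using norm_triangle_ineq[of "u y - volterra p u y" "volterra p u y"] F[OF y] volterra_weighted[OF p P u m y]
      by (simp add: distrib_right)
  qed
  also have "\<dots> \<le> 2 * F * exp (2 * P * pi)" using F0 P x by (intro mult_left_mono) auto
  finally show ?thesis .
qed

lemma volterra_diff:
  assumes p: "L1_fun p" and u: "continuous_on {0..pi} u"
    and v: "continuous_on {0..pi} v" and x: "x \<in> {0..pi}"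
  shows "volterra p (\<lambda>t. u t - v t) x = volterra p u x - volterra p v x"
proof -
  have "volterra p (\<lambda>t. u t - v t) x
      = integral {0..x} (\<lambda>t. integral {0..t} (\<lambda>s. p s * u s) - integral {0..t} (\<lambda>s. p s * v s))"
    unfolding volterra_def using x
    by (intro integral_cong)
      (auto simp: right_diff_distrib intro!: integral_diff integrable_mult_initial[OF p u] integrable_mult_initial[OF p v])
  also have "\<dots> = volterra p u x - volterra p v x"
    unfolding volterra_def
    by (intro integral_diff integrable_continuous_initial x continuous_on_indefinite p u v)
  finally show ?thesis .
qed

lemma volterra_exists:
  assumes p: "L1_fun p" and f: "continuous_on {0..pi} f"
  shows "\<exists>u. continuous_on {0..pi} u \<and> (\<forall>x\<in>{0..pi}. u x = f x + volterra p u x)"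
proof -
  define P where "P = L1_norm p + 1"
  have P: "L1_norm p \<le> P" "P > 0" using L1_norm_nonneg[of p] by (auto simp: P_def)
  \<comment> \<open>The contraction acts on v = exp (-2 P x) u, so that the weighted norm of u
    becomes the supremum norm of v.\<close>
  define G where "G v x = exp (- (2 * P * x)) *\<^sub>R (f x + volterra p (\<lambda>t. exp (2 * P * t) *\<^sub>R v t) x)"
    for v :: "real \<Rightarrow> complex" and x
  have cv: "continuous_on {0..pi} (\<lambda>t. exp (2 * P * t) *\<^sub>R apply_bcontfun v t)" for v :: "real \<Rightarrow>\<^sub>C complex"
    by (intro continuous_intros) auto
  have cG: "continuous_on (cbox 0 pi) (G (apply_bcontfun v))" for v
    unfolding G_def using continuous_on_volterra[OF p cv] f by (auto intro!: continuous_intros)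
  \<comment> \<open>\<open>clamp\<close> extends functions from the interval to the whole line,
    where the bounded continuous functions form a complete space; \<open>G\<close> looks at its
    argument on the interval only.\<close>
  have "\<exists>g :: real \<Rightarrow>\<^sub>C complex. \<forall>x. apply_bcontfun g x = G (apply_bcontfun v) (clamp 0 pi x)" for v
    using continuous_on_cbox_bcontfunE[OF cG[of v]] by metis
  then obtain T :: "(real \<Rightarrow>\<^sub>C complex) \<Rightarrow> (real \<Rightarrow>\<^sub>C complex)"
    where T: "\<And>v x. apply_bcontfun (T v) x = G (apply_bcontfun v) (clamp 0 pi x)" by metis
  have cl: "clamp 0 pi (x::real) \<in> {0..pi}" for x
    using clamp_in_interval[of 0 pi x] by auto
  have "dist (T v) (T w) \<le> 1/2 * dist v w" for v w
  proof (rule dist_bound)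
    fix x
    define y where "y = clamp 0 pi x"
    have y: "y \<in> {0..pi}" using cl y_def by simp
    have "norm (volterra p (\<lambda>t. exp (2 * P * t) *\<^sub>R v t - exp (2 * P * t) *\<^sub>R w t) y) \<le> dist v w / 2 * exp (2 * P * y)"
    proof (rule volterra_weighted[OF p P])
      fix t
      have "norm (apply_bcontfun v t - apply_bcontfun w t) \<le> dist v w"
        using dist_bounded[of v t w] by (simp add: dist_norm)
      then show "norm (exp (2 * P * t) *\<^sub>R apply_bcontfun v t - exp (2 * P * t) *\<^sub>R apply_bcontfun w t) \<le> dist v w * exp (2 * P * t)"
        by (simp flip: scaleR_diff_right)
    qed (use y cv in \<open>auto intro!: continuous_intros\<close>)
    then have *: "norm (volterra p (\<lambda>t. exp (2 * P * t) *\<^sub>R v t) y - volterra p (\<lambda>t. exp (2 * P * t) *\<^sub>R w t) y)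
        \<le> dist v w / 2 * exp (2 * P * y)"
      using volterra_diff[OF p cv cv y] by simp
    have "dist (apply_bcontfun (T v) x) (apply_bcontfun (T w) x)
       = exp (- (2 * P * y)) * norm (volterra p (\<lambda>t. exp (2 * P * t) *\<^sub>R v t) y - volterra p (\<lambda>t. exp (2 * P * t) *\<^sub>R w t) y)"
      unfolding T y_def[symmetric] G_def dist_norm by (simp flip: scaleR_diff_right)
    also have "\<dots> \<le> exp (- (2 * P * y)) * (dist v w / 2 * exp (2 * P * y))"
      using * by (intro mult_left_mono) auto
    also have "\<dots> = 1/2 * dist v w" by (simp add: exp_minus field_simps)
    finally show "dist (apply_bcontfun (T v) x) (apply_bcontfun (T w) x) \<le> 1/2 * dist v w" .
  qed
  then obtain v where v: "T v = v"
    using banach_fix_type[of "1/2" T] by auto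
  define u where "u t = exp (2 * P * t) *\<^sub>R v t" for t
  have "u x = f x + volterra p u x" if "x \<in> {0..pi}" for x
  proof -
    have "apply_bcontfun v x = G (apply_bcontfun v) x" using T[of v x] v that by simp
    then show ?thesis unfolding u_def G_def by (simp add: exp_minus)
  qed
  moreover have "continuous_on {0..pi} u" unfolding u_def by (rule cv)
  ultimately show ?thesis by blast
qed


lemma absolutely_integrable_diff_const:
  fixes q :: "real \<Rightarrow> complex"
  assumes "L1_fun q"
  shows "L1_fun (\<lambda>t. q t - lam)"
  by (intro set_integral_diff(1) assms absolutely_integrable_continuous_real continuous_intros)

lemma sl_solution_volterra:
  assumes q: "L1_fun q" and sol: "sl_solution q lam u u'"
  shows "continuous_on {0..pi} u"
    and "\<And>x. x \<in> {0..pi} \<Longrightarrow> u x = (u 0 + u' 0 * of_real x) + volterra (\<lambda>t. q t - lam) u x"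
    and "\<And>x. x \<in> {0..pi} \<Longrightarrow> u' x = u' 0 + integral {0..x} (\<lambda>t. (q t - lam) * u t)"
    and "continuous_on {0..pi} u'"
proof -
  have d: "\<And>x. x\<in>{0..pi} \<Longrightarrow> (u has_vector_derivative u' x) (at x within {0..pi})"
    and eq: "\<And>x. x\<in>{0..pi} \<Longrightarrow> u' x = u' 0 + integral {0..x} (\<lambda>t. (q t - lam) * u t)"
    using sol unfolding sl_solution_def by blast+
  show cu: "continuous_on {0..pi} u"
    using d continuous_on_eq_continuous_within has_vector_derivative_continuous by blast
  note q' = absolutely_integrable_diff_const[OF q, of lam]
  have cW: "continuous_on {0..pi} (\<lambda>t. integral {0..t} (\<lambda>s. (q s - lam) * u s))"
    by (rule continuous_on_indefinite[OF q' cu])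
  show "continuous_on {0..pi} u'"
    by (rule continuous_on_eq[where f = "\<lambda>x. u' 0 + integral {0..x} (\<lambda>t. (q t - lam) * u t)"])
      (intro continuous_intros cW, rule eq[symmetric])
  show "u' x = u' 0 + integral {0..x} (\<lambda>t. (q t - lam) * u t)" if "x \<in> {0..pi}" for x
    by (rule eq[OF that])
  show "u x = (u 0 + u' 0 * of_real x) + volterra (\<lambda>t. q t - lam) u x" if x: "x \<in> {0..pi}" for x
  proof -
    have "(u' has_integral (u x - u 0)) {0..x}"
      using x by (intro fundamental_theorem_of_calculus has_vector_derivative_within_subset[OF d]) auto
    then have "u x - u 0 = integral {0..x} u'" by (simp add: integral_unique)
    also have "\<dots> = integral {0..x} (\<lambda>t. u' 0 + integral {0..t} (\<lambda>s. (q s - lam) * u s))"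
      using x by (intro integral_cong eq) auto
    also have "\<dots> = integral {0..x} (\<lambda>t. u' 0) + volterra (\<lambda>t. q t - lam) u x"
      unfolding volterra_def
      by (intro Henstock_Kurzweil_Integration.integral_add integrable_continuous_initial x cW continuous_intros)
    finally show ?thesis using x by (simp add: algebra_simps scaleR_conv_of_real)
  qed
qed

lemma sl_solution_exists:
  assumes q: "L1_fun q"
  shows "\<exists>u u'. sl_solution q lam u u' \<and> u 0 = a \<and> u' 0 = b"
proof -
  note q' = absolutely_integrable_diff_const[OF q, of lam]
  have cf: "continuous_on {0..pi} (\<lambda>x. a + b * of_real x)" by (intro continuous_intros)
  obtain u0 where cu0: "continuous_on {0..pi} u0"
    and u0: "\<And>x. x\<in>{0..pi} \<Longrightarrow> u0 x = (a + b * of_real x) + volterra (\<lambda>t. q t - lam) u0 x"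
    using volterra_exists[OF q' cf] by blast
  \<comment> \<open>The right side is taken instead of \<open>u0\<close>, with which it agrees on
    the interval; its derivative can be read off.\<close>
  define u where "u x = (a + b * of_real x) + volterra (\<lambda>t. q t - lam) u0 x" for x
  define u' where "u' x = b + integral {0..x} (\<lambda>t. (q t - lam) * u t)" for x
  have uu0: "u x = u0 x" if "x \<in> {0..pi}" for x using u0[OF that] u_def by simp
  have cu: "continuous_on {0..pi} u" by (rule continuous_on_eq[OF cu0]) (simp add: uu0)
  have i0: "integral {0..x} (\<lambda>t. (q t - lam) * u0 t) = integral {0..x} (\<lambda>t. (q t - lam) * u t)" if "x \<in> {0..pi}" for x
    using that by (intro integral_cong) (auto simp: uu0)
  have "sl_solution q lam u u'"
    unfolding sl_solution_def
  proof (intro conjI ballI)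
    fix x assume x: "x \<in> {0..pi}"
    have "((\<lambda>x. a + b * complex_of_real x) has_vector_derivative (0 + b * 1)) (at x within {0..pi})"
      by (intro has_vector_derivative_add has_vector_derivative_const has_vector_derivative_mult_right)
        (auto simp: has_vector_derivative_def scaleR_conv_of_real intro!: derivative_eq_intros)
    then have "((\<lambda>x. a + b * complex_of_real x) has_vector_derivative b) (at x within {0..pi})" by simp
    from has_vector_derivative_add[OF this volterra_has_derivative[OF q' cu0 x]]
    show "(u has_vector_derivative u' x) (at x within {0..pi})"
      unfolding u_def[abs_def] u'_def using i0[OF x] by (simp add: u_def)
  qed (auto simp: u'_def intro!: absolutely_integrable_mult_continuous q' cu)
  moreover have "u 0 = a" "u' 0 = b" by (auto simp: u_def u'_def volterra_def)
  ultimately show ?thesis by blast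
qed

lemma cauchy_solution_spec:
  assumes q: "L1_fun q"
  shows "sl_solution q lam (fst (cauchy_solution q lam a b)) (snd (cauchy_solution q lam a b))"
    and "fst (cauchy_solution q lam a b) 0 = a" and "snd (cauchy_solution q lam a b) 0 = b"
proof -
  have "\<exists>p. case p of (u, u') \<Rightarrow> sl_solution q lam u u' \<and> u 0 = a \<and> u' 0 = b"
    using sl_solution_exists[OF q, of lam a b] by auto
  from someI_ex[OF this]
  have "case cauchy_solution q lam a b of (u, u') \<Rightarrow> sl_solution q lam u u' \<and> u 0 = a \<and> u' 0 = b"
    unfolding cauchy_solution_def .
  then show "sl_solution q lam (fst (cauchy_solution q lam a b)) (snd (cauchy_solution q lam a b))"
    "fst (cauchy_solution q lam a b) 0 = a" "snd (cauchy_solution q lam a b) 0 = b"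
    by (auto simp: case_prod_beta)
qed

section \<open>Holomorphic dependence on the spectral parameter\<close>

lemma L1_norm_triangle:
  assumes "L1_fun p" "L1_fun r"
  shows "L1_norm (\<lambda>t. p t + r t) \<le> L1_norm p + L1_norm r"
proof -
  have i: "(\<lambda>t. norm (p t)) integrable_on {0..pi}" "(\<lambda>t. norm (r t)) integrable_on {0..pi}"
    "(\<lambda>t. norm (p t + r t)) integrable_on {0..pi}"
    using assms set_integral_add(1)[OF assms] unfolding absolutely_integrable_on_def by auto
  show ?thesis unfolding L1_norm_def using i
    by (subst Henstock_Kurzweil_Integration.integral_add[symmetric]) (auto intro!: integral_le integrable_add norm_triangle_ineq)
qed

lemma absolutely_integrable_const [simp]:
  "L1_fun (\<lambda>t. c::complex)"
  by (intro absolutely_integrable_continuous_real continuous_intros)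

lemma L1_norm_const: "L1_norm (\<lambda>t. c) = norm c * pi"
  by (simp add: L1_norm_def)

lemma volterra_cmult: "volterra p (\<lambda>t. c * u t) x = c * volterra p u x"
  unfolding volterra_def by (simp add: mult.left_commute[of _ c])

lemma indefinite_shift:
  fixes q u :: "real \<Rightarrow> complex"
  assumes q: "L1_fun q" and u: "continuous_on {0..pi} u" and x: "x \<in> {0..pi}"
  shows "integral {0..x} (\<lambda>t. (q t - lam) * u t)
    = integral {0..x} (\<lambda>t. (q t - lam0) * u t) - (lam - lam0) * integral {0..x} u"
proof -
  have "integral {0..x} (\<lambda>t. (q t - lam) * u t)
      = integral {0..x} (\<lambda>t. (q t - lam0) * u t - (lam - lam0) * u t)"
    by (rule integral_cong) algebra
  also have "\<dots> = integral {0..x} (\<lambda>t. (q t - lam0) * u t) - integral {0..x} (\<lambda>t. (lam - lam0) * u t)"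
    by (intro integral_diff integrable_mult_initial absolutely_integrable_diff_const q u x
        integrable_continuous_initial continuous_intros)
  finally show ?thesis by simp
qed

lemma volterra_shift:
  assumes q: "L1_fun q" and u: "continuous_on {0..pi} u" and x: "x \<in> {0..pi}"
  shows "volterra (\<lambda>t. q t - lam) u x
    = volterra (\<lambda>t. q t - lam0) u x - (lam - lam0) * volterra (\<lambda>t. 1) u x"
proof -
  have "volterra (\<lambda>t. q t - lam) u x
      = integral {0..x} (\<lambda>t. integral {0..t} (\<lambda>s. (q s - lam0) * u s) - (lam - lam0) * integral {0..t} (\<lambda>s. 1 * u s))"
    unfolding volterra_def using x
    by (intro integral_cong) (simp add: indefinite_shift[OF q u, of _ lam lam0])
  also have "\<dots> = volterra (\<lambda>t. q t - lam0) u x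
      - integral {0..x} (\<lambda>t. (lam - lam0) * integral {0..t} (\<lambda>s. 1 * u s))"
    unfolding volterra_def
    by (intro integral_diff integrable_continuous_initial x continuous_intros continuous_on_indefinite
        absolutely_integrable_diff_const q u absolutely_integrable_const)
  finally show ?thesis by (simp add: volterra_def)
qed

lemma volterra_sup_bound:
  assumes p: "L1_fun p" and u: "continuous_on {0..pi} u"
    and m: "\<And>x. x \<in> {0..pi} \<Longrightarrow> norm (u x) \<le> m" and x: "x \<in> {0..pi}"
  shows "norm (volterra p u x) \<le> pi * (L1_norm p * m)"
proof -
  have m0: "0 \<le> m" using m[OF x] norm_ge_zero order_trans by blast
  have "norm (volterra p u x) \<le> integral {0..x} (\<lambda>t. L1_norm p * m)"
    unfolding volterra_def using x m
    by (intro integral_norm_bound_integral norm_integral_mult_le[OF p] integrable_mult_initial[OF p u]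
        integrable_continuous_initial[OF continuous_on_indefinite[OF p u] x]) auto
  also have "\<dots> = x * (L1_norm p * m)" using x by simp
  also have "\<dots> \<le> pi * (L1_norm p * m)"
    using x m0 L1_norm_nonneg[of p] by (intro mult_right_mono) auto
  finally show ?thesis .
qed

lemma bounded_on_interval:
  fixes f :: "real \<Rightarrow> complex"
  assumes "continuous_on {0..pi} f"
  obtains B where "B > 0" "\<And>x. x \<in> {0..pi} \<Longrightarrow> norm (f x) \<le> B"
  using compact_imp_bounded[OF compact_continuous_image[OF assms]] bounded_pos[of "f ` {0..pi}"] by auto

lemma has_field_derivative_linear_boundI:
  fixes f :: "complex \<Rightarrow> complex"
  assumes "\<And>z. \<lbrakk>z \<noteq> z0; norm (z - z0) \<le> 1\<rbrakk> \<Longrightarrow> norm ((f z - f z0) / (z - z0) - D) \<le> C * norm (z - z0)"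
  shows "(f has_field_derivative D) (at z0)"
  unfolding has_field_derivative_iff
proof (subst LIM_zero_iff[symmetric], rule Lim_null_comparison)
  have "eventually (\<lambda>z. z \<in> ball z0 1 - {z0}) (at z0)"
    by (rule eventually_at_in_open) auto
  then show "\<forall>\<^sub>F z in at z0. norm ((f z - f z0) / (z - z0) - D) \<le> C * norm (z - z0)"
    by eventually_elim (use assms in \<open>auto simp: dist_norm norm_minus_commute\<close>)
  show "((\<lambda>z. C * norm (z - z0)) \<longlongrightarrow> 0) (at z0)"
    by (auto intro!: tendsto_eq_intros)
qed

text \<open>The difference quotient w solves the Volterra equation for q - lam with free term -f0,
  where f0 is the double integral of the solution at \<open>lam0\<close>. Its limit v has to solve
  the equation for q - lam0 with the same free term, and w - v solves the homogeneous one up to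
  -(lam - lam0) times the double integral of w. As w is bounded, the distance to v is linear in |lam
  - lam0|.\<close>

lemma cauchy_solution_has_derivative:
  assumes q: "L1_fun q"
  shows "\<exists>v. continuous_on {0..pi} v \<and> (\<forall>x\<in>{0..pi}.
      ((\<lambda>lam. fst (cauchy_solution q lam a b) x) has_field_derivative v x) (at lam0) \<and>
      ((\<lambda>lam. snd (cauchy_solution q lam a b) x) has_field_derivative
        (integral {0..x} (\<lambda>t. (q t - lam0) * v t) - integral {0..x} (fst (cauchy_solution q lam0 a b)))) (at lam0))"
proof -
  define U U' where "U lam = fst (cauchy_solution q lam a b)" and "U' lam = snd (cauchy_solution q lam a b)" for lam
  have sol: "sl_solution q lam (U lam) (U' lam)" "U lam 0 = a" "U' lam 0 = b" for lam
    using cauchy_solution_spec[OF q] by (auto simp: U_def U'_def)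
  note V = sl_solution_volterra[OF q sol(1), unfolded sol(2,3)]
  note q' = absolutely_integrable_diff_const[OF q]
  define f0 where "f0 = volterra (\<lambda>t. 1) (U lam0)"
  have cf0: "continuous_on {0..pi} f0" unfolding f0_def by (intro continuous_on_volterra V) simp
  obtain B1 where B1: "B1 > 0" "\<And>x. x \<in> {0..pi} \<Longrightarrow> norm (f0 x) \<le> B1"
    using bounded_on_interval[OF cf0] by blast
  obtain v where cv: "continuous_on {0..pi} v"
    and v: "\<And>x. x\<in>{0..pi} \<Longrightarrow> v x = - f0 x + volterra (\<lambda>t. q t - lam0) v x"
    using volterra_exists[OF q' continuous_on_minus[OF cf0], of lam0] by blast
  define L where "L = L1_norm (\<lambda>t. q t - lam0)"
  \<comment> \<open>One bound for the L1 norms of q - lam for all lam at distance at most 1 from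
    \<open>lam0\<close>, so that \<open>K\<close> and \<open>C\<close> are independent of
    lam.\<close>
  define P where "P = L + pi"
  have L0: "L \<ge> 0" unfolding L_def by (rule L1_norm_nonneg)
  have P0: "P > 0" using L0 pi_gt_zero unfolding P_def by linarith
  have PL: "L1_norm (\<lambda>t. q t - lam) \<le> P" if "norm (lam - lam0) \<le> 1" for lam
  proof -
    have "L1_norm (\<lambda>t. (q t - lam0) + (lam0 - lam)) \<le> L + L1_norm (\<lambda>t. lam0 - lam)"
      unfolding L_def by (intro L1_norm_triangle q') simp
    also have "\<dots> \<le> L + 1 * pi"
      unfolding L1_norm_const using that by (intro add_left_mono mult_right_mono) (auto simp: norm_minus_commute)
    finally show ?thesis by (simp add: P_def)
  qed
  define K where "K = 2 * B1 * exp (2 * P * pi)"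
  define w where "w lam x = (U lam x - U lam0 x) / (lam - lam0)" for lam x
  have cw: "continuous_on {0..pi} (w lam)" for lam
    unfolding w_def divide_inverse by (intro continuous_intros V)
  have w_eq: "w lam x = volterra (\<lambda>t. q t - lam) (w lam) x - f0 x"
    if "lam \<noteq> lam0" and x: "x \<in> {0..pi}" for lam x
  proof -
    have "U lam x - U lam0 x = volterra (\<lambda>t. q t - lam) (U lam) x - volterra (\<lambda>t. q t - lam0) (U lam0) x"
      using V(2)[OF x, of lam] V(2)[OF x, of lam0] by simp
    also have "\<dots> = volterra (\<lambda>t. q t - lam) (\<lambda>t. U lam t - U lam0 t) x - (lam - lam0) * f0 x"
      using volterra_diff[OF q' V(1) V(1) x, of lam lam lam0] volterra_shift[OF q V(1) x, of lam lam0 lam0]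
      by (simp add: f0_def)
    also have "(\<lambda>t. U lam t - U lam0 t) = (\<lambda>t. (lam - lam0) * w lam t)"
      using that by (auto simp: w_def)
    finally have "(lam - lam0) * w lam x = (lam - lam0) * (volterra (\<lambda>t. q t - lam) (w lam) x - f0 x)"
      unfolding volterra_cmult by (simp add: right_diff_distrib)
    then show ?thesis using that by simp
  qed
  have w_bd: "norm (w lam x) \<le> K" if l: "lam \<noteq> lam0" "norm (lam - lam0) \<le> 1" and x: "x \<in> {0..pi}" for lam x
    unfolding K_def
  proof (rule volterra_bound[OF q' PL[OF l(2)] P0 cw _ x])
    fix y assume y: "y \<in> {0..pi}"
    show "norm (w lam y - volterra (\<lambda>t. q t - lam) (w lam) y) \<le> B1"
      using w_eq[OF l(1) y] B1(2)[OF y] by simp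
  qed
  have K0: "K \<ge> 0" using B1 by (auto simp: K_def)
  define C where "C = 2 * (pi * (pi * K)) * exp (2 * P * pi)"
  have C0: "C \<ge> 0" using K0 by (auto simp: C_def)
  have d_bd: "norm (w lam x - v x) \<le> C * norm (lam - lam0)"
    if l: "lam \<noteq> lam0" "norm (lam - lam0) \<le> 1" and x: "x \<in> {0..pi}" for lam x
  proof -
    have "norm (w lam x - v x) \<le> 2 * (norm (lam - lam0) * (pi * (pi * K))) * exp (2 * P * pi)"
    proof (rule volterra_bound[OF q'[of lam0] _ P0 _ _ x])
      show "L1_norm (\<lambda>t. q t - lam0) \<le> P" using PL[of lam0] by simp
      show "continuous_on {0..pi} (\<lambda>t. w lam t - v t)" by (intro continuous_intros cw cv)
      fix y assume y: "y \<in> {0..pi}"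
      have "w lam y - v y - volterra (\<lambda>t. q t - lam0) (\<lambda>t. w lam t - v t) y
          = - ((lam - lam0) * volterra (\<lambda>t. 1) (w lam) y)"
        using w_eq[OF l(1) y] v[OF y] volterra_diff[OF q' cw cv y, of lam0 lam] volterra_shift[OF q cw y, of lam lam lam0]
        by simp
      moreover have "norm (volterra (\<lambda>t. 1) (w lam) y) \<le> pi * (L1_norm (\<lambda>t. 1) * K)"
        using w_bd[OF l] by (intro volterra_sup_bound cw y) auto
      ultimately show "norm (w lam y - v y - volterra (\<lambda>t. q t - lam0) (\<lambda>t. w lam t - v t) y)
          \<le> norm (lam - lam0) * (pi * (pi * K))"
        unfolding L1_norm_const by (simp add: norm_mult mult_left_mono)
    qed
    then show ?thesis by (simp add: C_def mult_ac)
  qed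
  have "((\<lambda>lam. U lam x) has_field_derivative v x) (at lam0)" if x: "x \<in> {0..pi}" for x
    by (rule has_field_derivative_linear_boundI[of lam0 "\<lambda>lam. U lam x" "v x" C])
      (use d_bd[OF _ _ x] in \<open>simp add: w_def\<close>)
  moreover have "((\<lambda>lam. U' lam x) has_field_derivative
        (integral {0..x} (\<lambda>t. (q t - lam0) * v t) - integral {0..x} (U lam0))) (at lam0)" if x: "x \<in> {0..pi}" for x
  proof (rule has_field_derivative_linear_boundI)
    fix lam assume l: "lam \<noteq> lam0" "norm (lam - lam0) \<le> 1"
    have "U' lam x - U' lam0 x = integral {0..x} (\<lambda>t. (q t - lam0) * U lam t) - integral {0..x} (\<lambda>t. (q t - lam0) * U lam0 t)
         - (lam - lam0) * integral {0..x} (U lam)"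
      using V(3)[OF x, of lam] V(3)[OF x, of lam0] indefinite_shift[OF q V(1) x, of lam lam lam0] by simp
    also have "\<dots> = integral {0..x} (\<lambda>t. (q t - lam0) * U lam t - (q t - lam0) * U lam0 t)
         - (lam - lam0) * integral {0..x} (U lam)"
      by (subst integral_diff) (auto intro!: integrable_mult_initial q' V x)
    also have "(\<lambda>t. (q t - lam0) * U lam t - (q t - lam0) * U lam0 t) = (\<lambda>t. (lam - lam0) * ((q t - lam0) * w lam t))"
    proof
      fix t
      have "U lam t - U lam0 t = (lam - lam0) * w lam t" using l by (simp add: w_def)
      then show "(q t - lam0) * U lam t - (q t - lam0) * U lam0 t = (lam - lam0) * ((q t - lam0) * w lam t)"
        by (simp flip: right_diff_distrib)
    qed
    finally have "U' lam x - U' lam0 x = (lam - lam0) * (integral {0..x} (\<lambda>t. (q t - lam0) * w lam t) - integral {0..x} (U lam))"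
      unfolding integral_mult_right by (simp only: right_diff_distrib)
    then have "(U' lam x - U' lam0 x) / (lam - lam0) = integral {0..x} (\<lambda>t. (q t - lam0) * w lam t) - integral {0..x} (U lam)"
      using l by simp
    note quot = this
    \<comment> \<open>Passing to the limit costs w - v, which is linear in lam - lam0, and the
      change of \<open>U\<close> itself, which is (lam - lam0) w.\<close>
    have eq: "(U' lam x - U' lam0 x) / (lam - lam0) -
        (integral {0..x} (\<lambda>t. (q t - lam0) * v t) - integral {0..x} (U lam0))
      = integral {0..x} (\<lambda>t. (q t - lam0) * (w lam t - v t)) - integral {0..x} (\<lambda>t. (lam - lam0) * w lam t)"
    proof -
      have 1: "integral {0..x} (\<lambda>t. (q t - lam0) * (w lam t - v t))
        = integral {0..x} (\<lambda>t. (q t - lam0) * w lam t) - integral {0..x} (\<lambda>t. (q t - lam0) * v t)"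
        unfolding right_diff_distrib by (intro integral_diff integrable_mult_initial q' cw cv x)
      have "(\<lambda>t. (lam - lam0) * w lam t) = (\<lambda>t. U lam t - U lam0 t)" using l by (auto simp: w_def)
      then have 2: "integral {0..x} (\<lambda>t. (lam - lam0) * w lam t) = integral {0..x} (U lam) - integral {0..x} (U lam0)"
        by (simp add: integral_diff integrable_continuous_initial[OF V(1) x])
      show ?thesis unfolding 1 2 quot by simp
    qed
    have n1: "norm (integral {0..x} (\<lambda>t. (q t - lam0) * (w lam t - v t))) \<le> L * (C * norm (lam - lam0))"
      unfolding L_def using x d_bd[OF l]
      by (intro norm_integral_mult_le q' x integrable_mult_initial continuous_intros cw cv) auto
    have "norm (integral {0..x} (\<lambda>t. (1::complex) * w lam t)) \<le> L1_norm (\<lambda>t. 1) * K"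
      using x w_bd[OF l] by (intro norm_integral_mult_le integrable_mult_initial cw) auto
    then have n2: "norm (integral {0..x} (\<lambda>t. (lam - lam0) * w lam t)) \<le> norm (lam - lam0) * (pi * K)"
      unfolding L1_norm_const by (simp add: norm_mult mult_left_mono)
    show "norm ((U' lam x - U' lam0 x) / (lam - lam0) -
        (integral {0..x} (\<lambda>t. (q t - lam0) * v t) - integral {0..x} (U lam0))) \<le> (L * C + pi * K) * norm (lam - lam0)"
      unfolding eq using norm_triangle_ineq4[of "integral {0..x} (\<lambda>t. (q t - lam0) * (w lam t - v t))" "integral {0..x} (\<lambda>t. (lam - lam0) * w lam t)"] n1 n2
      by (simp add: algebra_simps)
  qed
  ultimately show ?thesis using cv unfolding U_def U'_def by blast
qed

lemma cauchy_solution_holomorphic: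
  assumes "L1_fun q" "x \<in> {0..pi}"
  shows "(\<lambda>lam. fst (cauchy_solution q lam a b) x) holomorphic_on UNIV"
    and "(\<lambda>lam. snd (cauchy_solution q lam a b) x) holomorphic_on UNIV"
  using cauchy_solution_has_derivative[OF assms(1)] assms(2)
  unfolding holomorphic_on_def field_differentiable_def by meson+

lemma char_det_holomorphic:
  assumes "L1_fun q"
  shows "char_det A q holomorphic_on UNIV"
  unfolding char_det_def[abs_def] sl_c_def sl_s_def sl_s'_def
  by (intro holomorphic_intros cauchy_solution_holomorphic assms) auto

section \<open>Variation of constants\<close>

lemma absolutely_integrable_norm_initial:
  fixes h :: "real \<Rightarrow> complex"
  assumes "L1_fun h"
  shows "(\<lambda>t. norm (h t)) integrable_on {0..pi}"
  using assms unfolding absolutely_integrable_on_def by simp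

text \<open>The right side is an increment of the primitive of |h| because the continuity of that
  primitive makes the bound o(1) in the integration by parts; the absolute value covers both orders
  of y and z.\<close>

lemma integral_increment_le:
  fixes g h :: "real \<Rightarrow> complex"
  assumes g: "L1_fun g" and h: "L1_fun h"
    and yz: "y \<in> {0..pi}" "z \<in> {0..pi}"
    and le: "\<And>t. t \<in> closed_segment y z \<Longrightarrow> norm (g t) \<le> c * norm (h t)"
  shows "norm (integral {0..z} g - integral {0..y} g)
    \<le> c * \<bar>integral {0..z} (\<lambda>t. norm (h t)) - integral {0..y} (\<lambda>t. norm (h t))\<bar>"
proof -
  have *: "norm (integral {0..b} g - integral {0..a} g)
      \<le> c * (integral {0..b} (\<lambda>t. norm (h t)) - integral {0..a} (\<lambda>t. norm (h t)))"
    if ab: "0 \<le> a" "a \<le> b" "b \<le> pi" and le: "\<And>t. t \<in> {a..b} \<Longrightarrow> norm (g t) \<le> c * norm (h t)" for a b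
  proof -
    have hn: "L1_fun (\<lambda>t. norm (h t))"
      using h by (rule absolutely_integrable_norm[unfolded comp_def])
    have ig: "g integrable_on {0..b}" and ih: "(\<lambda>t. norm (h t)) integrable_on {0..b}"
      using ab by (auto intro!: integrable_on_initial g hn)
    have 1: "integral {0..a} g + integral {a..b} g = integral {0..b} g"
      by (rule Henstock_Kurzweil_Integration.integral_combine) (use ab ig in auto)
    have 2: "integral {0..a} (\<lambda>t. norm (h t)) + integral {a..b} (\<lambda>t. norm (h t)) = integral {0..b} (\<lambda>t. norm (h t))"
      by (rule Henstock_Kurzweil_Integration.integral_combine) (use ab ih in auto)
    have "norm (integral {a..b} g) \<le> integral {a..b} (\<lambda>t. c * norm (h t))"
      using ab le by (intro integral_norm_bound_integral integrable_on_mult_right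
          integrable_on_subinterval[OF ig] integrable_on_subinterval[OF ih]) auto
    then show ?thesis using 1 2 by (simp add: algebra_simps flip: 1 2)
  qed
  show ?thesis
  proof (cases "y \<le> z")
    case True
    have "norm (integral {0..z} g - integral {0..y} g)
      \<le> c * (integral {0..z} (\<lambda>t. norm (h t)) - integral {0..y} (\<lambda>t. norm (h t)))"
      by (rule *) (use True yz le in \<open>auto simp: closed_segment_eq_real_ivl\<close>)
    moreover have "integral {0..y} (\<lambda>t. norm (h t)) \<le> integral {0..z} (\<lambda>t. norm (h t))"
      using True yz absolutely_integrable_norm[OF h] by (intro integral_subset_le integrable_on_initial) (auto simp: comp_def)
    ultimately show ?thesis by simp
  next
    case False
    have "norm (integral {0..y} g - integral {0..z} g)
      \<le> c * (integral {0..y} (\<lambda>t. norm (h t)) - integral {0..z} (\<lambda>t. norm (h t)))"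
      by (rule *) (use False yz le in \<open>auto simp: closed_segment_eq_real_ivl\<close>)
    moreover have "integral {0..z} (\<lambda>t. norm (h t)) \<le> integral {0..y} (\<lambda>t. norm (h t))"
      using False yz absolutely_integrable_norm[OF h] by (intro integral_subset_le integrable_on_initial) (auto simp: comp_def)
    ultimately show ?thesis by (simp add: norm_minus_commute)
  qed
qed

lemma has_vector_derivative_zeroI:
  fixes G :: "real \<Rightarrow> complex"
  assumes "\<And>z. z \<in> S \<Longrightarrow> norm (G z - G y) \<le> \<bar>z - y\<bar> * R z" "(R \<longlongrightarrow> 0) (at y within S)"
  shows "(G has_vector_derivative 0) (at y within S)"
  unfolding has_vector_derivative_def
proof (rule has_derivativeI_sandwich[of 1])
  fix z assume "z \<in> S" "z \<noteq> y"
  then show "norm (G z - G y - (z - y) *\<^sub>R 0) / norm (z - y) \<le> R z"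
    using assms(1)[of z] by (simp add: divide_le_eq mult.commute)
qed (use assms(2) in auto)

text \<open>
  \<open>W\<close> is differentiable only almost everywhere, so the library version does not apply. Instead the
  difference of the two sides is differentiable everywhere in \<open>x\<close>, with derivative zero.
\<close>

lemma integral_by_parts_indefinite:
  fixes h \<phi> \<phi>' :: "real \<Rightarrow> complex"
  assumes h: "L1_fun h"
    and d: "\<And>t. t \<in> {0..pi} \<Longrightarrow> (\<phi> has_vector_derivative \<phi>' t) (at t within {0..pi})"
    and c: "continuous_on {0..pi} \<phi>'"
    and x: "x \<in> {0..pi}"
  defines "W \<equiv> (\<lambda>t. integral {0..t} h)"
  shows "integral {0..x} (\<lambda>t. h t * \<phi> t) = \<phi> x * W x - integral {0..x} (\<lambda>t. \<phi>' t * W t)"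
proof -
  have c\<phi>: "continuous_on {0..pi} \<phi>"
    using d continuous_on_eq_continuous_within has_vector_derivative_continuous by blast
  have cW: "continuous_on {0..pi} W"
    unfolding W_def by (intro indefinite_integral_continuous_1 integrable_on_initial h) auto
  define H where "H t = integral {0..t} (\<lambda>t. norm (h t))" for t
  have cH: "continuous_on {0..pi} H"
    unfolding H_def by (intro indefinite_integral_continuous_1 absolutely_integrable_norm_initial h)
  obtain L where L: "L > 0" "\<And>t. t \<in> {0..pi} \<Longrightarrow> norm (\<phi>' t) \<le> L"
    using bounded_on_interval[OF c] by blast
  have lip: "norm (\<phi> s - \<phi> t) \<le> L * \<bar>s - t\<bar>" if "s \<in> {0..pi}" "t \<in> {0..pi}" for s t
  proof -
    have "norm (\<phi> s - \<phi> t) \<le> L * norm (s - t)"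
    proof (rule differentiable_bound[where S = "{0..pi}" and f' = "\<lambda>x h. h *\<^sub>R \<phi>' x"])
      fix x assume x: "x \<in> {0..pi}"
      show "(\<phi> has_derivative (\<lambda>h. h *\<^sub>R \<phi>' x)) (at x within {0..pi})"
        using d[OF x] by (simp add: has_vector_derivative_def)
      show "onorm (\<lambda>h. h *\<^sub>R \<phi>' x) \<le> L"
        using L(2)[OF x] by (intro onorm_le) (simp add: mult.commute[of L] mult_left_mono)
    qed (use that in auto)
    then show ?thesis by simp
  qed
  define F where "F z = (integral {0..z} (\<lambda>t. h t * \<phi> t) - \<phi> z * W z) + integral {0..z} (\<lambda>t. \<phi>' t * W t)" for z
  have dF: "(F has_vector_derivative 0) (at y within {0..pi})" if y: "y \<in> {0..pi}" for y
  proof -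
    define D where "D z = integral {0..z} (\<lambda>t. h t * \<phi> t) - \<phi> z * W z" for z
    \<comment> \<open>Neither term of \<open>D\<close> need be differentiable at y. With \<phi>
      replaced by \<phi> - \<phi> y, the integral has increments of at most L |z - y| times an
      increment of the continuous function \<open>H\<close>, hence derivative 0 at y.\<close>
    define E where "E z = integral {0..z} (\<lambda>t. h t * (\<phi> t - \<phi> y))" for z
    have ai: "L1_fun (\<lambda>t. h t * (\<phi> t - \<phi> y))"
      by (intro absolutely_integrable_mult_continuous h continuous_intros c\<phi>)
    have D_eq: "D z = E z - (\<phi> z - \<phi> y) * W z" if z: "z \<in> {0..pi}" for z
    proof -
      have "E z = integral {0..z} (\<lambda>t. h t * \<phi> t - h t * \<phi> y)"
        unfolding E_def by (simp add: right_diff_distrib)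
      also have "\<dots> = integral {0..z} (\<lambda>t. h t * \<phi> t) - integral {0..z} (\<lambda>t. h t * \<phi> y)"
        by (intro integral_diff integrable_mult_initial h c\<phi> z continuous_intros)
      finally show ?thesis by (simp add: D_def W_def algebra_simps)
    qed
    have 1: "(E has_vector_derivative 0) (at y within {0..pi})"
    proof (rule has_vector_derivative_zeroI[where R = "\<lambda>z. L * \<bar>H z - H y\<bar>"])
      fix z assume z: "z \<in> {0..pi}"
      have "norm (E z - E y) \<le> (L * \<bar>z - y\<bar>) * \<bar>H z - H y\<bar>"
        unfolding E_def H_def
      proof (rule integral_increment_le[OF ai h y z])
        fix t assume t: "t \<in> closed_segment y z"
        then have t': "t \<in> {0..pi}" "\<bar>t - y\<bar> \<le> \<bar>z - y\<bar>"
          using y z by (auto simp: closed_segment_eq_real_ivl split: if_splits)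
        have "norm (\<phi> t - \<phi> y) \<le> L * \<bar>z - y\<bar>"
          using lip[OF t'(1) y] t'(2) L(1) by (meson mult_left_mono less_imp_le order_trans)
        then show "norm (h t * (\<phi> t - \<phi> y)) \<le> L * \<bar>z - y\<bar> * norm (h t)"
          by (simp add: norm_mult mult.commute mult_left_mono)
      qed
      then show "norm (E z - E y) \<le> \<bar>z - y\<bar> * (L * \<bar>H z - H y\<bar>)" by (simp add: mult_ac)
    next
      have "(H \<longlongrightarrow> H y) (at y within {0..pi})"
        using cH y by (auto simp: continuous_on)
      then show "((\<lambda>z. L * \<bar>H z - H y\<bar>) \<longlongrightarrow> 0) (at y within {0..pi})"
        by (auto intro!: tendsto_eq_intros)
    qed
    \<comment> \<open>\<open>W\<close> is only continuous; the product is differentiable at y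
      because its first factor vanishes there.\<close>
    have 2: "((\<lambda>z. (\<phi> z - \<phi> y) * W z) has_vector_derivative \<phi>' y * W y) (at y within {0..pi})"
    proof -
      have "((\<lambda>z. (\<phi> z - \<phi> y) * (W z - W y)) has_vector_derivative 0) (at y within {0..pi})"
      proof (rule has_vector_derivative_zeroI[where R = "\<lambda>z. L * norm (W z - W y)"])
        fix z assume z: "z \<in> {0..pi}"
        show "norm ((\<phi> z - \<phi> y) * (W z - W y) - (\<phi> y - \<phi> y) * (W y - W y)) \<le> \<bar>z - y\<bar> * (L * norm (W z - W y))"
          using mult_right_mono[OF lip[OF z y], of "norm (W z - W y)"] by (simp add: norm_mult mult_ac)
      next
        have "(W \<longlongrightarrow> W y) (at y within {0..pi})"
          using cW y by (auto simp: continuous_on)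
        then show "((\<lambda>z. L * norm (W z - W y)) \<longlongrightarrow> 0) (at y within {0..pi})"
          by (auto intro!: tendsto_eq_intros)
      qed
      moreover have "((\<lambda>z. (\<phi> z - \<phi> y) * W y) has_vector_derivative (\<phi>' y - 0) * W y) (at y within {0..pi})"
        by (intro has_vector_derivative_mult_left has_vector_derivative_diff has_vector_derivative_const d y)
      ultimately have "((\<lambda>z. (\<phi> z - \<phi> y) * (W z - W y) + (\<phi> z - \<phi> y) * W y) has_vector_derivative 0 + (\<phi>' y - 0) * W y)
          (at y within {0..pi})" by (rule has_vector_derivative_add)
      then show ?thesis by (simp add: algebra_simps)
    qed
    have 3: "((\<lambda>z. integral {0..z} (\<lambda>t. \<phi>' t * W t)) has_vector_derivative \<phi>' y * W y) (at y within {0..pi})"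
      by (intro integral_has_vector_derivative continuous_intros c cW y)
    have "((\<lambda>z. E z - (\<phi> z - \<phi> y) * W z + integral {0..z} (\<lambda>t. \<phi>' t * W t)) has_vector_derivative 0 - \<phi>' y * W y + \<phi>' y * W y)
        (at y within {0..pi})"
      by (intro has_vector_derivative_add has_vector_derivative_diff 1 2 3)
    then show ?thesis
      by (rule has_vector_derivative_transform[OF y, rotated, THEN has_vector_derivative_eq_rhs])
        (auto simp: F_def D_def[symmetric] D_eq)
  qed
  obtain k where "\<And>z. z \<in> {0..pi} \<Longrightarrow> F z = k"
    using has_vector_derivative_zero_constant[of "{0..pi}" F] dF by auto
  then have "F x = F 0" using x by simp
  then show ?thesis by (simp add: F_def W_def algebra_simps)
qed

text \<open>Lagrange's identity between u and a solution \<phi> of the equation without potential,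
  whose derivative is \<psi>.\<close>

lemma sl_solution_lagrange:
  assumes q: "L1_fun q" and sol: "sl_solution q lam u u'"
    and d: "\<And>t. (\<phi> has_vector_derivative \<psi> t) (at t within {0..pi})"
    and d': "\<And>t. (\<psi> has_vector_derivative (- lam * \<phi> t)) (at t within {0..pi})"
    and x: "x \<in> {0..pi}"
  shows "\<phi> x * u' x - \<psi> x * u x
    = \<phi> 0 * u' 0 - \<psi> 0 * u 0 + integral {0..x} (\<lambda>t. q t * (\<phi> t * u t))"
proof -
  note V = sl_solution_volterra[OF q sol]
  have c\<psi>: "continuous_on {0..pi} \<psi>"
    using d' continuous_on_eq_continuous_within has_vector_derivative_continuous by blast
  \<comment> \<open>As q is only integrable, u' is split into \<open>v\<close>, which is
    differentiable everywhere, and \<open>W\<close>, which is treated by integration by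
    parts.\<close>
  define W where "W t = integral {0..t} (\<lambda>s. q s * u s)" for t
  have cW: "continuous_on {0..pi} W" unfolding W_def by (intro continuous_on_indefinite q V)
  define v where "v t = u' 0 - lam * integral {0..t} u" for t
  have u'_eq: "u' t = v t + W t" if "t \<in> {0..pi}" for t
    using V(3)[OF that] indefinite_shift[OF q V(1) that, of lam 0] by (simp add: v_def W_def)
  have dv: "(v has_vector_derivative (- lam * u t)) (at t within {0..pi})" if t: "t \<in> {0..pi}" for t
  proof -
    have "(v has_vector_derivative (0 - lam * u t)) (at t within {0..pi})"
      unfolding v_def[abs_def]
      by (intro has_vector_derivative_diff has_vector_derivative_const has_vector_derivative_mult_right
          integral_has_vector_derivative V t)
    then show ?thesis by simp
  qed
  have du: "(u has_vector_derivative u' t) (at t within {0..pi})" if "t \<in> {0..pi}" for t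
    using sol that unfolding sl_solution_def by blast
  have "((\<lambda>t. \<phi> t * v t - \<psi> t * u t) has_vector_derivative (- (\<psi> t * W t))) (at t within {0..pi})"
    if t: "t \<in> {0..pi}" for t
  proof -
    have "((\<lambda>t. \<phi> t * v t - \<psi> t * u t) has_vector_derivative
       ((\<phi> t * (- lam * u t) + \<psi> t * v t) - (\<psi> t * u' t + (- lam * \<phi> t) * u t))) (at t within {0..pi})"
      by (intro has_vector_derivative_diff has_vector_derivative_mult d d' dv du t)
    then show ?thesis using u'_eq[OF t] by (simp add: algebra_simps)
  qed
  then have "((\<lambda>t. - (\<psi> t * W t)) has_integral ((\<phi> x * v x - \<psi> x * u x) - (\<phi> 0 * v 0 - \<psi> 0 * u 0))) {0..x}"
    using x by (intro fundamental_theorem_of_calculus)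
      (auto intro!: has_vector_derivative_within_subset[of _ _ _ "{0..pi}" "{0..x}"])
  then have 1: "- integral {0..x} (\<lambda>t. \<psi> t * W t) = (\<phi> x * v x - \<psi> x * u x) - (\<phi> 0 * v 0 - \<psi> 0 * u 0)"
    by (simp add: integral_unique flip: integral_neg)
  have "integral {0..x} (\<lambda>t. (q t * u t) * \<phi> t) = \<phi> x * W x - integral {0..x} (\<lambda>t. \<psi> t * W t)"
    unfolding W_def
    by (intro integral_by_parts_indefinite absolutely_integrable_mult_continuous q V d c\<psi> x)
  then have 2: "integral {0..x} (\<lambda>t. q t * (\<phi> t * u t)) = \<phi> x * W x - integral {0..x} (\<lambda>t. \<psi> t * W t)"
    by (simp add: mult_ac)
  have 3: "v 0 = u' 0" by (simp add: v_def)
  show ?thesis unfolding 2 u'_eq[OF x] using 1 unfolding 3 by algebra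
qed

lemma sin_reflected_derivative:
  "((\<lambda>t. sin (\<mu> * of_real (x - t))) has_vector_derivative (- \<mu> * cos (\<mu> * of_real (x - t)))) (at t within S)"
  "((\<lambda>t. cos (\<mu> * of_real (x - t))) has_vector_derivative (\<mu> * sin (\<mu> * of_real (x - t)))) (at t within S)"
  for \<mu> :: complex
proof -
  have "((\<lambda>t. \<mu> * (complex_of_real x - complex_of_real t)) has_vector_derivative \<mu> * (0 - 1)) (at t within S)"
    by (intro has_vector_derivative_mult_right has_vector_derivative_diff has_vector_derivative_const)
      (auto simp: has_vector_derivative_def scaleR_conv_of_real intro!: derivative_eq_intros)
  note * = field_vector_diff_chain_within[OF this]
  show "((\<lambda>t. sin (\<mu> * of_real (x - t))) has_vector_derivative (- \<mu> * cos (\<mu> * of_real (x - t)))) (at t within S)"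
    using *[OF DERIV_sin[THEN has_field_derivative_at_within]] by (simp add: o_def)
  show "((\<lambda>t. cos (\<mu> * of_real (x - t))) has_vector_derivative (\<mu> * sin (\<mu> * of_real (x - t)))) (at t within S)"
    using *[OF DERIV_cos[THEN has_field_derivative_at_within]] by (simp add: o_def)
qed

text \<open>Lagrange's identity with \<phi> t = sin \<mu>(x - t), whose boundary term at t = x is
  \<mu> u(x), and with cos \<mu>(x - t), where it is u'(x). Keeping the factor \<mu> avoids an
  exception at \<mu> = 0.\<close>

lemma sl_solution_variation_of_constants:
  assumes q: "L1_fun q" and sol: "sl_solution q (\<mu>\<^sup>2) u u'" and x: "x \<in> {0..pi}"
  shows "\<mu> * u x = \<mu> * cos (\<mu> * x) * u 0 + sin (\<mu> * x) * u' 0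
      + integral {0..x} (\<lambda>t. q t * (sin (\<mu> * of_real (x - t)) * u t))" (is ?A)
    and "u' x = cos (\<mu> * x) * u' 0 - \<mu> * sin (\<mu> * x) * u 0
      + integral {0..x} (\<lambda>t. q t * (cos (\<mu> * of_real (x - t)) * u t))" (is ?B)
proof -
  have 1: "((\<lambda>t. - \<mu> * cos (\<mu> * of_real (x - t))) has_vector_derivative
      (- \<mu>\<^sup>2 * sin (\<mu> * of_real (x - t)))) (at t within {0..pi})" for t
    using has_vector_derivative_mult_right[OF sin_reflected_derivative(2), of "- \<mu>" \<mu> x t "{0..pi}"]
    by (simp add: power2_eq_square mult_ac)
  have 2: "((\<lambda>t. \<mu> * sin (\<mu> * of_real (x - t))) has_vector_derivative
      (- \<mu>\<^sup>2 * cos (\<mu> * of_real (x - t)))) (at t within {0..pi})" for t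
    using has_vector_derivative_mult_right[OF sin_reflected_derivative(1), of \<mu> \<mu> x t "{0..pi}"]
    by (simp add: power2_eq_square mult_ac)
  show ?A using sl_solution_lagrange[OF q sol sin_reflected_derivative(1) 1 x] by (simp add: algebra_simps)
  show ?B using sl_solution_lagrange[OF q sol sin_reflected_derivative(2) 2 x] by (simp add: algebra_simps)
qed

section \<open>Solutions for large \<mu>, measured in the weight exp (|Im \<mu>| x)\<close>

lemma norm_sin_cos_le_exp:
  fixes z :: complex
  shows "norm (sin z) \<le> exp \<bar>Im z\<bar>" and "norm (cos z) \<le> exp \<bar>Im z\<bar>"
proof -
  have e: "norm (exp (\<i> * z)) \<le> exp \<bar>Im z\<bar>" "norm (exp (- (\<i> * z))) \<le> exp \<bar>Im z\<bar>"
    by (auto simp: norm_exp_eq_Re)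
  have "norm (exp (\<i> * z) - exp (- (\<i> * z))) \<le> exp \<bar>Im z\<bar> + exp \<bar>Im z\<bar>"
    by (rule order_trans[OF norm_triangle_ineq4 add_mono[OF e]])
  then show "norm (sin z) \<le> exp \<bar>Im z\<bar>"
    unfolding sin_exp_eq by (simp add: norm_divide norm_mult)
  have "norm (exp (\<i> * z) + exp (- (\<i> * z))) \<le> exp \<bar>Im z\<bar> + exp \<bar>Im z\<bar>"
    by (rule order_trans[OF norm_triangle_ineq add_mono[OF e]])
  then show "norm (cos z) \<le> exp \<bar>Im z\<bar>"
    unfolding cos_exp_eq by (simp add: norm_divide norm_mult)
qed


text \<open>The weights exp (y (x - t)) of the kernel and exp (y t) of u multiply to exp (y x),
  which does not depend on t.\<close>

lemma norm_integral_exponential_le: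
  fixes p k u :: "real \<Rightarrow> complex"
  assumes p: "L1_fun p" and x: "x \<in> {0..pi}"
    and c: "continuous_on {0..pi} k" "continuous_on {0..pi} u"
    and k: "\<And>t. t \<in> {0..x} \<Longrightarrow> norm (k t) \<le> exp (y * (x - t))"
    and u: "\<And>t. t \<in> {0..x} \<Longrightarrow> norm (u t) \<le> m * exp (y * t)"
  shows "norm (integral {0..x} (\<lambda>t. p t * (k t * u t))) \<le> L1_norm p * (m * exp (y * x))"
proof (rule norm_integral_mult_le[OF p x])
  show "(\<lambda>s. p s * (k s * u s)) integrable_on {0..x}"
    by (intro integrable_mult_initial p x continuous_intros c)
  fix t assume t: "t \<in> {0..x}"
  have "norm (k t * u t) \<le> exp (y * (x - t)) * (m * exp (y * t))"
    unfolding norm_mult using k[OF t] u[OF t] by (intro mult_mono) auto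
  also have "\<dots> = m * exp (y * x)" by (simp add: algebra_simps flip: exp_add)
  finally show "norm (k t * u t) \<le> m * exp (y * x)" .
qed

text \<open>The common form of the equations for c(x,\<mu>), with \<open>u0\<close> = cos \<mu>x,
  and for \<mu> s(x,\<mu>), with \<open>u0\<close> = sin \<mu>x.\<close>

definition sine_volterra :: "(real \<Rightarrow> complex) \<Rightarrow> complex \<Rightarrow> (real \<Rightarrow> complex) \<Rightarrow> (real \<Rightarrow> complex) \<Rightarrow> bool" where
  "sine_volterra q \<mu> u0 u \<longleftrightarrow> continuous_on {0..pi} u \<and> (\<forall>x\<in>{0..pi}.
     \<mu> * u x = \<mu> * u0 x + integral {0..x} (\<lambda>t. q t * (sin (\<mu> * of_real (x - t)) * u t)))"

lemma sine_kernel: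
  assumes "t \<le> x"
  shows "norm (sin (\<mu> * of_real (x - t))) \<le> exp (\<bar>Im \<mu>\<bar> * (x - t))"
    and "norm (cos (\<mu> * of_real (x - t))) \<le> exp (\<bar>Im \<mu>\<bar> * (x - t))"
  using norm_sin_cos_le_exp[of "\<mu> * of_real (x - t)"] assms by (auto simp: abs_mult)

text \<open>Solved for u, the integral term carries 1/\<mu>, so |\<mu>| \<ge> 2 M makes it a
  contraction by 1/2 in the weighted norm. The bootstrap gives the first bound; inserting it into
  the equation once more gains the factor 1/|\<mu>| of the second.\<close>

lemma sine_volterra_bounds:
  assumes sv: "sine_volterra q \<mu> u0 u"
    and q: "L1_fun q" and M: "L1_norm q \<le> M" "M > 0"
    and \<mu>: "norm \<mu> \<ge> 2 * M"
    and u0: "\<And>x. x \<in> {0..pi} \<Longrightarrow> norm (u0 x) \<le> exp (\<bar>Im \<mu>\<bar> * x)"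
    and x: "x \<in> {0..pi}"
  shows "norm (u x) \<le> 2 * exp (\<bar>Im \<mu>\<bar> * x)"
    and "norm (u x - u0 x) \<le> 2 * M / norm \<mu> * exp (\<bar>Im \<mu>\<bar> * x)"
proof -
  define y where "y = \<bar>Im \<mu>\<bar>"
  have cu: "continuous_on {0..pi} u" and eq: "\<And>x. x \<in> {0..pi} \<Longrightarrow> \<mu> * u x = \<mu> * u0 x
      + integral {0..x} (\<lambda>t. q t * (sin (\<mu> * of_real (x - t)) * u t))"
    using sv unfolding sine_volterra_def by blast+
  have \<mu>0: "norm \<mu> > 0" using \<mu> M by linarith
  have diff: "norm (u x - u0 x) \<le> M * m / norm \<mu> * exp (y * x)"
    if x: "x \<in> {0..pi}" and m: "m \<ge> 0" "\<And>t. t \<in> {0..pi} \<Longrightarrow> norm (u t) \<le> m * exp (y * t)" for x m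
  proof -
    have "norm (\<mu> * (u x - u0 x)) = norm (integral {0..x} (\<lambda>t. q t * (sin (\<mu> * of_real (x - t)) * u t)))"
      using eq[OF x] by (simp add: right_diff_distrib)
    also have "\<dots> \<le> L1_norm q * (m * exp (y * x))"
      unfolding y_def using x m
      by (intro norm_integral_exponential_le q x cu continuous_intros sine_kernel) (auto simp: y_def)
    also have "\<dots> \<le> M * (m * exp (y * x))" using M m by (intro mult_right_mono) auto
    finally have "norm \<mu> * norm (u x - u0 x) \<le> M * (m * exp (y * x))" by (simp only: norm_mult)
    then show ?thesis using \<mu>0 by (simp add: field_simps)
  qed
  have bd: "norm (u x) \<le> 2 * 1 * exp (y * x)" if x: "x \<in> {0..pi}" for x
  proof (rule exponential_bootstrap[OF cu _ x])
    fix x m assume x: "x \<in> {0..pi}" and m: "m \<ge> 0" "\<And>t. t \<in> {0..pi} \<Longrightarrow> norm (u t) \<le> m * exp (y * t)"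
    have "M * m / norm \<mu> \<le> m / 2"
      using \<mu> \<mu>0 m mult_right_mono[OF \<mu> m(1)] by (simp add: field_simps)
    then have "norm (u x - u0 x) \<le> m / 2 * exp (y * x)"
      using diff[OF x m] by (meson exp_ge_zero mult_right_mono order_trans)
    then have "norm (u x) \<le> exp (y * x) + m / 2 * exp (y * x)"
      using u0[OF x] norm_triangle_ineq[of "u0 x" "u x - u0 x"] by (simp add: y_def)
    then show "norm (u x) \<le> (1 + m / 2) * exp (y * x)" by (simp add: algebra_simps)
  qed
  show "norm (u x) \<le> 2 * exp (\<bar>Im \<mu>\<bar> * x)" using bd[OF x] by (simp add: y_def)
  show "norm (u x - u0 x) \<le> 2 * M / norm \<mu> * exp (\<bar>Im \<mu>\<bar> * x)"
    using diff[OF x, of 2] bd by (simp add: y_def mult_ac)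
qed

text \<open>The difference of the two equations has a source, q1 - q2 against \<open>u1\<close>, and
  a term with q2 against u1 - u2, which the bootstrap absorbs.\<close>

lemma sine_volterra_lipschitz:
  assumes sv1: "sine_volterra q1 \<mu> u0 u1" and sv2: "sine_volterra q2 \<mu> u0 u2"
    and q1: "L1_fun q1" and M1: "L1_norm q1 \<le> M" "M > 0"
    and q2: "L1_fun q2" and M2: "L1_norm q2 \<le> M"
    and \<mu>: "norm \<mu> \<ge> 2 * M"
    and u0: "\<And>x. x \<in> {0..pi} \<Longrightarrow> norm (u0 x) \<le> exp (\<bar>Im \<mu>\<bar> * x)"
    and x: "x \<in> {0..pi}"
  shows "norm (u1 x - u2 x) \<le> 4 * L1_norm (\<lambda>t. q1 t - q2 t) / norm \<mu> * exp (\<bar>Im \<mu>\<bar> * x)"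
proof -
  define y where "y = \<bar>Im \<mu>\<bar>"
  define D where "D = L1_norm (\<lambda>t. q1 t - q2 t)"
  have cu: "continuous_on {0..pi} u1" "continuous_on {0..pi} u2"
    using sv1 sv2 unfolding sine_volterra_def by blast+
  have \<mu>0: "norm \<mu> > 0" using \<mu> M1 by linarith
  have qd: "L1_fun (\<lambda>t. q1 t - q2 t)" by (intro set_integral_diff(1) q1 q2)
  have "norm (u1 x - u2 x) \<le> 2 * (2 * D / norm \<mu>) * exp (y * x)"
  proof (rule exponential_bootstrap[OF _ _ x])
    show "continuous_on {0..pi} (\<lambda>x. u1 x - u2 x)" by (intro continuous_intros cu)
    fix x m assume x: "x \<in> {0..pi}" and m: "m \<ge> 0" "\<And>t. t \<in> {0..pi} \<Longrightarrow> norm (u1 t - u2 t) \<le> m * exp (y * t)"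
    let ?k = "\<lambda>t. sin (\<mu> * of_real (x - t))"
    have ck: "continuous_on {0..pi} ?k" by (intro continuous_intros)
    note I = integrable_mult_initial[OF _ continuous_on_mult[OF ck] x]
    have "\<mu> * (u1 x - u2 x) = integral {0..x} (\<lambda>t. q1 t * (?k t * u1 t)) - integral {0..x} (\<lambda>t. q2 t * (?k t * u2 t))"
      using sv1 sv2 x unfolding sine_volterra_def by (simp add: right_diff_distrib)
    also have "\<dots> = integral {0..x} (\<lambda>t. q1 t * (?k t * u1 t) - q2 t * (?k t * u2 t))"
      by (rule integral_diff[symmetric]) (intro I q1 q2 cu)+
    also have "\<dots> = integral {0..x} (\<lambda>t. (q1 t - q2 t) * (?k t * u1 t) + q2 t * (?k t * (u1 t - u2 t)))"
      by (intro integral_cong) (simp add: algebra_simps)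
    also have "\<dots> = integral {0..x} (\<lambda>t. (q1 t - q2 t) * (?k t * u1 t)) + integral {0..x} (\<lambda>t. q2 t * (?k t * (u1 t - u2 t)))"
      by (rule Henstock_Kurzweil_Integration.integral_add) (intro I qd q2 cu continuous_on_diff)+
    finally have e: "\<mu> * (u1 x - u2 x) = \<dots>" .
    have "norm (integral {0..x} (\<lambda>t. (q1 t - q2 t) * (?k t * u1 t))) \<le> D * (2 * exp (y * x))"
      unfolding D_def y_def using x sine_volterra_bounds(1)[OF sv1 q1 M1 \<mu> u0]
      by (intro norm_integral_exponential_le qd x cu ck sine_kernel) auto
    moreover have "norm (integral {0..x} (\<lambda>t. q2 t * (?k t * (u1 t - u2 t)))) \<le> L1_norm q2 * (m * exp (y * x))"
      using x m(2) unfolding y_def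
      by (intro norm_integral_exponential_le q2 x continuous_on_diff cu ck sine_kernel) auto
    moreover have "L1_norm q2 * (m * exp (y * x)) \<le> M * (m * exp (y * x))"
      using M2 m by (intro mult_right_mono) auto
    ultimately have "norm (\<mu> * (u1 x - u2 x)) \<le> D * (2 * exp (y * x)) + M * (m * exp (y * x))"
      unfolding e by (meson add_mono norm_triangle_le order_trans)
    then have "norm \<mu> * norm (u1 x - u2 x) \<le> D * (2 * exp (y * x)) + M * (m * exp (y * x))" by (simp only: norm_mult)
    then have "norm (u1 x - u2 x) \<le> (2 * D / norm \<mu> + M * m / norm \<mu>) * exp (y * x)"
      using \<mu>0 by (simp add: field_simps)
    also have "\<dots> \<le> (2 * D / norm \<mu> + m / 2) * exp (y * x)"
      using mult_right_mono[OF \<mu> m(1)] \<mu>0 by (intro mult_right_mono add_left_mono) (auto simp: field_simps)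
    finally show "norm (u1 x - u2 x) \<le> (2 * D / norm \<mu> + m / 2) * exp (y * x)" .
  qed
  then show ?thesis by (simp add: D_def y_def)
qed

section \<open>Asymptotics of the characteristic determinant\<close>

text \<open>The term that the potential adds to the free value at x = \<pi>: k is sin \<mu>(\<pi> -
  t) for \<mu> u(\<pi>) and cos \<mu>(\<pi> - t) for u'(\<pi>).\<close>

definition end_functional :: "(real \<Rightarrow> complex) \<Rightarrow> (real \<Rightarrow> complex) \<Rightarrow> (real \<Rightarrow> complex) \<Rightarrow> complex" where
  "end_functional q k u = integral {0..pi} (\<lambda>t. q t * (k t * u t))"

lemma end_functional_diff:
  assumes q: "L1_fun q1" "L1_fun q2"
    and c: "continuous_on {0..pi} k" "continuous_on {0..pi} u1" "continuous_on {0..pi} u2"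
  shows "end_functional q1 k u1 - end_functional q2 k u2
    = end_functional (\<lambda>t. q1 t - q2 t) k u1 + end_functional q2 k (\<lambda>t. u1 t - u2 t)"
proof -
  have p: "pi \<in> {0..pi}" by simp
  have qd: "L1_fun (\<lambda>t. q1 t - q2 t)" by (intro set_integral_diff(1) q)
  note I = integrable_mult_initial[OF _ continuous_on_mult[OF c(1)] p]
  have "end_functional q1 k u1 - end_functional q2 k u2
      = integral {0..pi} (\<lambda>t. q1 t * (k t * u1 t) - q2 t * (k t * u2 t))"
    unfolding end_functional_def by (rule integral_diff[symmetric]) (intro I q c)+
  also have "\<dots> = integral {0..pi} (\<lambda>t. (q1 t - q2 t) * (k t * u1 t) + q2 t * (k t * (u1 t - u2 t)))"
    by (intro integral_cong) (simp add: algebra_simps)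
  also have "\<dots> = end_functional (\<lambda>t. q1 t - q2 t) k u1 + end_functional q2 k (\<lambda>t. u1 t - u2 t)"
    unfolding end_functional_def
    by (rule Henstock_Kurzweil_Integration.integral_add) (intro I qd q c continuous_on_diff)+
  finally show ?thesis .
qed

context
  fixes \<mu> :: complex and M :: real and k u0 :: "real \<Rightarrow> complex"
  assumes M: "M > 0" and \<mu>: "norm \<mu> \<ge> 2 * M"
    and ck: "continuous_on {0..pi} k" and k: "\<And>t. t \<in> {0..pi} \<Longrightarrow> norm (k t) \<le> exp (\<bar>Im \<mu>\<bar> * (pi - t))"
    and c0: "continuous_on {0..pi} u0" and u0: "\<And>x. x \<in> {0..pi} \<Longrightarrow> norm (u0 x) \<le> exp (\<bar>Im \<mu>\<bar> * x)"
begin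

lemma end_functional_bound:
  assumes q: "L1_fun q" and c: "continuous_on {0..pi} u"
    and m: "\<And>t. t \<in> {0..pi} \<Longrightarrow> norm (u t) \<le> m * exp (\<bar>Im \<mu>\<bar> * t)"
  shows "norm (end_functional q k u) \<le> L1_norm q * m * exp (\<bar>Im \<mu>\<bar> * pi)"
  unfolding end_functional_def
  using norm_integral_exponential_le[OF q _ ck c k m] by (simp add: mult_ac)

text \<open>In the second bound the values at the free solution, which are linear in q, are
  subtracted. What is left contains u1 - u0 or u1 - u2, and each of these is O(1/|\<mu>|).\<close>

lemma end_functional_solution_lipschitz:
  assumes sv1: "sine_volterra q1 \<mu> u0 u1" and sv2: "sine_volterra q2 \<mu> u0 u2"
    and q1: "L1_fun q1" and M1: "L1_norm q1 \<le> M"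
    and q2: "L1_fun q2" and M2: "L1_norm q2 \<le> M"
  shows "norm (end_functional q1 k u1 - end_functional q2 k u2)
      \<le> 4 * L1_norm (\<lambda>t. q1 t - q2 t) * exp (\<bar>Im \<mu>\<bar> * pi)"
    and "norm ((end_functional q1 k u1 - end_functional q1 k u0) - (end_functional q2 k u2 - end_functional q2 k u0))
      \<le> 6 * M / norm \<mu> * L1_norm (\<lambda>t. q1 t - q2 t) * exp (\<bar>Im \<mu>\<bar> * pi)"
proof -
  define E where "E = exp (\<bar>Im \<mu>\<bar> * pi)"
  define D where "D = L1_norm (\<lambda>t. q1 t - q2 t)"
  have D0: "D \<ge> 0" unfolding D_def by (rule L1_norm_nonneg)
  have E0: "E > 0" by (simp add: E_def)
  have \<mu>0: "norm \<mu> > 0" using \<mu> M by linarith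
  have c: "continuous_on {0..pi} u1" "continuous_on {0..pi} u2"
    using sv1 sv2 unfolding sine_volterra_def by blast+
  have qd: "L1_fun (\<lambda>t. q1 t - q2 t)" by (intro set_integral_diff(1) q1 q2)
  note B1 = sine_volterra_bounds[OF sv1 q1 M1 M \<mu> u0]
  have "norm (end_functional q2 k (\<lambda>t. u1 t - u2 t)) \<le> L1_norm q2 * (4 * D / norm \<mu>) * E"
    unfolding E_def D_def
    by (intro end_functional_bound q2 continuous_on_diff c sine_volterra_lipschitz[OF sv1 sv2 q1 M1 M q2 M2 \<mu> u0])
  also have "\<dots> \<le> M * (4 * D / norm \<mu>) * E"
    using M2 E0 D0 by (intro mult_right_mono) auto
  finally have 2: "norm (end_functional q2 k (\<lambda>t. u1 t - u2 t)) \<le> M * (4 * D / norm \<mu>) * E" .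
  have "M * (4 * D / norm \<mu>) * E \<le> 2 * D * E"
    using mult_right_mono[OF \<mu> D0] \<mu>0 E0 by (intro mult_right_mono) (auto simp: field_simps)
  then have two: "norm (end_functional q2 k (\<lambda>t. u1 t - u2 t)) \<le> 2 * D * E" using 2 by linarith
  have 1: "norm (end_functional (\<lambda>t. q1 t - q2 t) k u1) \<le> D * 2 * E"
    unfolding E_def D_def by (intro end_functional_bound qd c B1)
  have "norm (end_functional q1 k u1 - end_functional q2 k u2) \<le> 4 * D * E"
    unfolding end_functional_diff[OF q1 q2 ck c]
    using norm_triangle_ineq[of "end_functional (\<lambda>t. q1 t - q2 t) k u1" "end_functional q2 k (\<lambda>t. u1 t - u2 t)"] 1 two
    by linarith
  then show "norm (end_functional q1 k u1 - end_functional q2 k u2)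
      \<le> 4 * L1_norm (\<lambda>t. q1 t - q2 t) * exp (\<bar>Im \<mu>\<bar> * pi)" by (simp add: D_def E_def)
  have "(end_functional q1 k u1 - end_functional q1 k u0) - (end_functional q2 k u2 - end_functional q2 k u0)
      = (end_functional q1 k u1 - end_functional q2 k u2) - (end_functional q1 k u0 - end_functional q2 k u0)" by simp
  also have "\<dots> = end_functional (\<lambda>t. q1 t - q2 t) k u1 - end_functional (\<lambda>t. q1 t - q2 t) k u0
      + end_functional q2 k (\<lambda>t. u1 t - u2 t)"
    unfolding end_functional_diff[OF q1 q2 ck c] end_functional_diff[OF q1 q2 ck c0 c0] by (simp add: end_functional_def)
  also have "\<dots> = end_functional (\<lambda>t. q1 t - q2 t) k (\<lambda>t. u1 t - u0 t) + end_functional q2 k (\<lambda>t. u1 t - u2 t)"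
    using end_functional_diff[OF qd qd ck c(1) c0] by (simp add: end_functional_def)
  finally have e: "(end_functional q1 k u1 - end_functional q1 k u0) - (end_functional q2 k u2 - end_functional q2 k u0) = \<dots>" .
  have 3: "norm (end_functional (\<lambda>t. q1 t - q2 t) k (\<lambda>t. u1 t - u0 t)) \<le> D * (2 * M / norm \<mu>) * E"
    unfolding E_def D_def by (intro end_functional_bound qd continuous_on_diff c c0 B1)
  have "norm ((end_functional q1 k u1 - end_functional q1 k u0) - (end_functional q2 k u2 - end_functional q2 k u0))
    \<le> D * (2 * M / norm \<mu>) * E + M * (4 * D / norm \<mu>) * E"
    unfolding e using 2 3 by (meson add_mono norm_triangle_le order_trans)
  also have "\<dots> = 6 * M / norm \<mu> * D * E" using \<mu>0 by (simp add: field_simps)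
  finally show "norm ((end_functional q1 k u1 - end_functional q1 k u0) - (end_functional q2 k u2 - end_functional q2 k u0))
      \<le> 6 * M / norm \<mu> * L1_norm (\<lambda>t. q1 t - q2 t) * exp (\<bar>Im \<mu>\<bar> * pi)" by (simp add: D_def E_def)
qed

end

section \<open>Expansion of the characteristic determinant for complex \<mu>\<close>

definition sol_c :: "(real \<Rightarrow> complex) \<Rightarrow> complex \<Rightarrow> real \<Rightarrow> complex" where
  "sol_c q \<mu> = sl_c q (\<mu>\<^sup>2)"

text \<open>The factor \<open>\<mu>\<close> makes \<open>sol_s\<close> a perturbation of \<open>sin \<mu>x\<close> instead of \<open>sin \<mu>x / \<mu>\<close>.\<close>

definition sol_s :: "(real \<Rightarrow> complex) \<Rightarrow> complex \<Rightarrow> real \<Rightarrow> complex" where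
  "sol_s q \<mu> x = \<mu> * sl_s q (\<mu>\<^sup>2) x"

definition sin_end :: "complex \<Rightarrow> real \<Rightarrow> complex" where "sin_end \<mu> t = sin (\<mu> * of_real (pi - t))"
definition cos_end :: "complex \<Rightarrow> real \<Rightarrow> complex" where "cos_end \<mu> t = cos (\<mu> * of_real (pi - t))"

lemma integral_mult_scale:
  "integral S (\<lambda>t. q t * (k t * (c * u t))) = c * integral S (\<lambda>t. q t * (k t * u t))" for c :: complex
proof -
  have "(\<lambda>t. q t * (k t * (c * u t))) = (\<lambda>t. c * (q t * (k t * u t)))" by (simp add: fun_eq_iff)
  then show ?thesis by simp
qed

lemma sine_volterra_sol:
  assumes q: "L1_fun q"
  shows "sine_volterra q \<mu> (\<lambda>x. cos (\<mu> * of_real x)) (sol_c q \<mu>)"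
    and "sine_volterra q \<mu> (\<lambda>x. sin (\<mu> * of_real x)) (sol_s q \<mu>)"
proof -
  note C = cauchy_solution_spec[OF q, of "\<mu>\<^sup>2" 1 0]
  note S = cauchy_solution_spec[OF q, of "\<mu>\<^sup>2" 0 1]
  show "sine_volterra q \<mu> (\<lambda>x. cos (\<mu> * of_real x)) (sol_c q \<mu>)"
    unfolding sine_volterra_def sol_c_def sl_c_def
    using sl_solution_volterra(1)[OF q C(1)] sl_solution_variation_of_constants(1)[OF q C(1)] C(2,3) by simp
  show "sine_volterra q \<mu> (\<lambda>x. sin (\<mu> * of_real x)) (sol_s q \<mu>)"
    unfolding sine_volterra_def
  proof (intro conjI ballI)
    show "continuous_on {0..pi} (sol_s q \<mu>)"
      unfolding sol_s_def[abs_def] sl_s_def by (intro continuous_intros sl_solution_volterra(1)[OF q S(1)])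
    fix x assume x: "x \<in> {0..pi}"
    have "\<mu> * sl_s q (\<mu>\<^sup>2) x = sin (\<mu> * x) + integral {0..x} (\<lambda>t. q t * (sin (\<mu> * of_real (x - t)) * sl_s q (\<mu>\<^sup>2) t))"
      using sl_solution_variation_of_constants(1)[OF q S(1) x] S(2,3) by (simp add: sl_s_def)
    then have "\<mu> * sol_s q \<mu> x = \<mu> * sin (\<mu> * x) + \<mu> * integral {0..x} (\<lambda>t. q t * (sin (\<mu> * of_real (x - t)) * sl_s q (\<mu>\<^sup>2) t))"
      unfolding sol_s_def by (simp add: algebra_simps)
    then show "\<mu> * sol_s q \<mu> x = \<mu> * sin (\<mu> * of_real x) + integral {0..x} (\<lambda>t. q t * (sin (\<mu> * of_real (x - t)) * sol_s q \<mu> t))"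
      unfolding sol_s_def integral_mult_scale .
  qed
qed

text \<open>The weights \<alpha> and 1 - \<alpha> add up to 1, so the two free terms combine to cos
  \<mu>\<pi>. The factor \<mu> clears the denominators; only the integral next to
  \<open>bc_gamma A\<close> keeps one.\<close>

lemma char_det_expansion:
  assumes q: "L1_fun q" and \<mu>: "\<mu> \<noteq> 0"
  shows "\<mu> * (char_det A q (\<mu>\<^sup>2) - (-1) ^ (bc_theta A + 1) - cos (\<mu> * pi))
    = bc_alpha A * end_functional q (sin_end \<mu>) (sol_c q \<mu>)
      + (1 - bc_alpha A) * end_functional q (cos_end \<mu>) (sol_s q \<mu>)
      + bc_gamma A * (sin (\<mu> * pi) + end_functional q (sin_end \<mu>) (sol_s q \<mu>) / \<mu>)"
proof -
  note S = cauchy_solution_spec[OF q, of "\<mu>\<^sup>2" 0 1]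
  have c: "\<mu> * sl_c q (\<mu>\<^sup>2) pi = \<mu> * cos (\<mu> * pi) + end_functional q (sin_end \<mu>) (sol_c q \<mu>)"
    using sine_volterra_sol(1)[OF q, of \<mu>] by (simp add: sine_volterra_def sol_c_def end_functional_def sin_end_def)
  have s: "\<mu> * sl_s q (\<mu>\<^sup>2) pi = sin (\<mu> * pi) + end_functional q (sin_end \<mu>) (sol_s q \<mu>) / \<mu>"
  proof -
    have "\<mu> * sol_s q \<mu> pi = \<mu> * sin (\<mu> * pi) + end_functional q (sin_end \<mu>) (sol_s q \<mu>)"
      using sine_volterra_sol(2)[OF q, of \<mu>] by (simp add: sine_volterra_def end_functional_def sin_end_def)
    then have "sol_s q \<mu> pi = sin (\<mu> * pi) + end_functional q (sin_end \<mu>) (sol_s q \<mu>) / \<mu>"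
      using \<mu> by (simp add: field_simps)
    then show ?thesis by (simp add: sol_s_def)
  qed
  have "sl_s' q (\<mu>\<^sup>2) pi = cos (\<mu> * pi) + integral {0..pi} (\<lambda>t. q t * (cos_end \<mu> t * sl_s q (\<mu>\<^sup>2) t))"
    using sl_solution_variation_of_constants(2)[OF q S(1), of pi] S(2,3) by (simp add: sl_s_def sl_s'_def cos_end_def)
  then have "\<mu> * sl_s' q (\<mu>\<^sup>2) pi = \<mu> * cos (\<mu> * pi) + \<mu> * integral {0..pi} (\<lambda>t. q t * (cos_end \<mu> t * sl_s q (\<mu>\<^sup>2) t))"
    by (simp add: distrib_left)
  then have s': "\<mu> * sl_s' q (\<mu>\<^sup>2) pi = \<mu> * cos (\<mu> * pi) + end_functional q (cos_end \<mu>) (sol_s q \<mu>)"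
    unfolding end_functional_def sol_s_def integral_mult_scale .
  have "\<mu> * (char_det A q (\<mu>\<^sup>2) - (-1) ^ (bc_theta A + 1) - cos (\<mu> * pi))
    = bc_alpha A * (\<mu> * sl_c q (\<mu>\<^sup>2) pi) + (1 - bc_alpha A) * (\<mu> * sl_s' q (\<mu>\<^sup>2) pi)
      + bc_gamma A * (\<mu> * sl_s q (\<mu>\<^sup>2) pi) - \<mu> * cos (\<mu> * pi)"
    unfolding char_det_def by (simp add: algebra_simps)
  also have "\<dots> = bc_alpha A * end_functional q (sin_end \<mu>) (sol_c q \<mu>)
      + (1 - bc_alpha A) * end_functional q (cos_end \<mu>) (sol_s q \<mu>)
      + bc_gamma A * (sin (\<mu> * pi) + end_functional q (sin_end \<mu>) (sol_s q \<mu>) / \<mu>)"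
    unfolding c s s' by (simp add: algebra_simps)
  finally show ?thesis .
qed

lemma end_kernels:
  shows "continuous_on {0..pi} (sin_end \<mu>)" "continuous_on {0..pi} (cos_end \<mu>)"
    and "t \<in> {0..pi} \<Longrightarrow> norm (sin_end \<mu> t) \<le> exp (\<bar>Im \<mu>\<bar> * (pi - t))"
    and "t \<in> {0..pi} \<Longrightarrow> norm (cos_end \<mu> t) \<le> exp (\<bar>Im \<mu>\<bar> * (pi - t))"
    and "continuous_on {0..pi} (\<lambda>x. cos (\<mu> * of_real x))" "continuous_on {0..pi} (\<lambda>x. sin (\<mu> * of_real x))"
    and "t \<in> {0..pi} \<Longrightarrow> norm (cos (\<mu> * of_real t)) \<le> exp (\<bar>Im \<mu>\<bar> * t)"
    and "t \<in> {0..pi} \<Longrightarrow> norm (sin (\<mu> * of_real t)) \<le> exp (\<bar>Im \<mu>\<bar> * t)"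
  using norm_sin_cos_le_exp[of "\<mu> * of_real t"]
  by (auto simp: sin_end_def[abs_def] cos_end_def[abs_def] abs_mult simp del: of_real_diff intro!: continuous_intros sine_kernel)

definition bc_const :: "complex^4^2 \<Rightarrow> real" where
  "bc_const A = norm (bc_alpha A) + norm (1 - bc_alpha A) + norm (bc_gamma A)"

lemma bc_combination_le:
  assumes "norm x \<le> m" "norm y \<le> m" "norm z \<le> m"
  shows "norm (bc_alpha A * x + (1 - bc_alpha A) * y + bc_gamma A * z) \<le> bc_const A * m"
proof -
  have "norm (bc_alpha A * x + (1 - bc_alpha A) * y + bc_gamma A * z)
    \<le> norm (bc_alpha A * x) + norm ((1 - bc_alpha A) * y) + norm (bc_gamma A * z)"
    by (meson add_mono norm_triangle_le order_refl order_trans)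
  also have "\<dots> \<le> norm (bc_alpha A) * m + norm (1 - bc_alpha A) * m + norm (bc_gamma A) * m"
    unfolding norm_mult using assms by (intro add_mono mult_left_mono) auto
  finally show ?thesis by (simp add: bc_const_def algebra_simps)
qed

lemma bc_const_nonneg: "bc_const A \<ge> 0" by (simp add: bc_const_def)

lemma char_det_lipschitz:
  assumes q: "L1_fun q1" "L1_fun q2"
    and M: "L1_norm q1 \<le> M" "L1_norm q2 \<le> M" "M > 0" and \<mu>: "norm \<mu> \<ge> 2 * M" "norm \<mu> \<ge> 1"
  shows "norm (\<mu> * (char_det A q1 (\<mu>\<^sup>2) - char_det A q2 (\<mu>\<^sup>2)))
    \<le> bc_const A * 4 * L1_norm (\<lambda>t. q1 t - q2 t) * exp (\<bar>Im \<mu>\<bar> * pi)"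
proof -
  let ?E = "4 * L1_norm (\<lambda>t. q1 t - q2 t) * exp (\<bar>Im \<mu>\<bar> * pi)"
  have \<mu>0: "\<mu> \<noteq> 0" using \<mu> by auto
  have 1: "norm (end_functional q1 (sin_end \<mu>) (sol_c q1 \<mu>) - end_functional q2 (sin_end \<mu>) (sol_c q2 \<mu>)) \<le> ?E"
    by (rule end_functional_solution_lipschitz(1)[OF M(3) \<mu>(1) end_kernels(1,3,5,7)
          sine_volterra_sol(1)[OF q(1)] sine_volterra_sol(1)[OF q(2)] q(1) M(1) q(2) M(2)])
  have 2: "norm (end_functional q1 (cos_end \<mu>) (sol_s q1 \<mu>) - end_functional q2 (cos_end \<mu>) (sol_s q2 \<mu>)) \<le> ?E"
    by (rule end_functional_solution_lipschitz(1)[OF M(3) \<mu>(1) end_kernels(2,4,6,8)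
          sine_volterra_sol(2)[OF q(1)] sine_volterra_sol(2)[OF q(2)] q(1) M(1) q(2) M(2)])
  have 3: "norm (end_functional q1 (sin_end \<mu>) (sol_s q1 \<mu>) - end_functional q2 (sin_end \<mu>) (sol_s q2 \<mu>)) \<le> ?E"
    by (rule end_functional_solution_lipschitz(1)[OF M(3) \<mu>(1) end_kernels(1,3,6,8)
          sine_volterra_sol(2)[OF q(1)] sine_volterra_sol(2)[OF q(2)] q(1) M(1) q(2) M(2)])
  have "norm ((end_functional q1 (sin_end \<mu>) (sol_s q1 \<mu>) - end_functional q2 (sin_end \<mu>) (sol_s q2 \<mu>)) / \<mu>)
      \<le> norm (end_functional q1 (sin_end \<mu>) (sol_s q1 \<mu>) - end_functional q2 (sin_end \<mu>) (sol_s q2 \<mu>))"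
    using \<mu>(2) by (simp add: norm_divide divide_le_eq mult_le_cancel_left1)
  then have 3: "norm ((end_functional q1 (sin_end \<mu>) (sol_s q1 \<mu>) - end_functional q2 (sin_end \<mu>) (sol_s q2 \<mu>)) / \<mu>) \<le> ?E"
    using 3 by linarith
  have "\<mu> * (char_det A q1 (\<mu>\<^sup>2) - char_det A q2 (\<mu>\<^sup>2))
    = \<mu> * (char_det A q1 (\<mu>\<^sup>2) - (-1) ^ (bc_theta A + 1) - cos (\<mu> * pi)) - \<mu> * (char_det A q2 (\<mu>\<^sup>2) - (-1) ^ (bc_theta A + 1) - cos (\<mu> * pi))"
    by (simp add: algebra_simps)
  also have "\<dots> = bc_alpha A * (end_functional q1 (sin_end \<mu>) (sol_c q1 \<mu>) - end_functional q2 (sin_end \<mu>) (sol_c q2 \<mu>))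
     + (1 - bc_alpha A) * (end_functional q1 (cos_end \<mu>) (sol_s q1 \<mu>) - end_functional q2 (cos_end \<mu>) (sol_s q2 \<mu>))
     + bc_gamma A * ((end_functional q1 (sin_end \<mu>) (sol_s q1 \<mu>) - end_functional q2 (sin_end \<mu>) (sol_s q2 \<mu>)) / \<mu>)"
    unfolding char_det_expansion[OF q(1) \<mu>0] char_det_expansion[OF q(2) \<mu>0] by (simp add: algebra_simps diff_divide_distrib)
  finally show ?thesis using bc_combination_le[OF 1 2 3, of A] by (simp add: mult_ac)
qed

lemma end_functional_zero [simp]: "end_functional (\<lambda>t. 0) k u = 0"
  by (simp add: end_functional_def)

text \<open>For q = 0 the quantity inside the norm is exactly \<gamma> sin \<mu>\<pi>;
  \<open>char_det_lipschitz\<close> against the zero potential supplies the rest.\<close>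

lemma char_det_asymptotics:
  assumes q: "L1_fun q" and M: "L1_norm q \<le> M" "M > 0"
    and \<mu>: "norm \<mu> \<ge> 2 * M" "norm \<mu> \<ge> 1"
  shows "norm (\<mu> * (char_det A q (\<mu>\<^sup>2) - (-1) ^ (bc_theta A + 1) - cos (\<mu> * pi)))
    \<le> bc_const A * (4 * M + 1) * exp (\<bar>Im \<mu>\<bar> * pi)"
proof -
  let ?E = "exp (\<bar>Im \<mu>\<bar> * pi)" and ?m = "(-1) ^ (bc_theta A + 1) + cos (\<mu> * pi)"
  have "\<mu> \<noteq> 0" using \<mu> by auto
  then have 0: "\<mu> * (char_det A (\<lambda>t. 0) (\<mu>\<^sup>2) - ?m) = bc_gamma A * sin (\<mu> * pi)"
    using char_det_expansion[of "\<lambda>t. 0" \<mu> A] unfolding diff_diff_eq by simp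
  have "norm (bc_gamma A * sin (\<mu> * pi)) \<le> bc_const A * ?E"
    unfolding norm_mult using end_kernels(8)[of pi \<mu>] by (intro mult_mono) (auto simp: bc_const_def)
  moreover have "norm (\<mu> * (char_det A q (\<mu>\<^sup>2) - char_det A (\<lambda>t. 0) (\<mu>\<^sup>2))) \<le> bc_const A * 4 * L1_norm q * ?E"
    using char_det_lipschitz[OF q absolutely_integrable_const M(1) _ M(2) \<mu>, of 0 A] M by (simp add: L1_norm_const)
  moreover have "bc_const A * 4 * L1_norm q * ?E \<le> bc_const A * 4 * M * ?E"
    using M bc_const_nonneg by (intro mult_right_mono mult_left_mono) auto
  ultimately have "norm (\<mu> * (char_det A q (\<mu>\<^sup>2) - char_det A (\<lambda>t. 0) (\<mu>\<^sup>2)) + bc_gamma A * sin (\<mu> * pi))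
      \<le> bc_const A * 4 * M * ?E + bc_const A * ?E"
    by (intro norm_triangle_le) linarith
  then show ?thesis unfolding 0[symmetric] by (simp add: algebra_simps)
qed

section \<open>The characteristic determinant at the integers\<close>

definition sine_coeff :: "nat \<Rightarrow> (real \<Rightarrow> complex) \<Rightarrow> complex" where
  "sine_coeff k q = integral {0..pi} (\<lambda>t. q t * sin (2 * of_nat k * of_real t))"

lemma sin_cos_nat_pi:
  "sin (of_nat k * of_real pi :: complex) = 0" "cos (of_nat k * of_real pi :: complex) = (-1) ^ k"
proof -
  have e: "of_nat k * of_real pi = complex_of_real (real k * pi)" by simp
  show "sin (of_nat k * of_real pi :: complex) = 0" "cos (of_nat k * of_real pi :: complex) = (-1) ^ k"
    unfolding e sin_of_real cos_of_real by (simp_all add: sin_npi cos_npi)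
qed

text \<open>As sin k(\<pi> - t) = -(-1)^k sin kt and cos k(\<pi> - t) = (-1)^k cos kt, both
  integrands are multiples of q(t) sin 2kt, with opposite signs.\<close>

lemma end_functional_nat:
  "end_functional q (sin_end (of_nat k)) (\<lambda>x. cos (of_nat k * of_real x)) = - ((-1) ^ k * sine_coeff k q / 2)"
  "end_functional q (cos_end (of_nat k)) (\<lambda>x. sin (of_nat k * of_real x)) = (-1) ^ k * sine_coeff k q / 2"
proof -
  have d: "sin (2 * of_nat k * of_real t :: complex) = 2 * sin (of_nat k * of_real t) * cos (of_nat k * of_real t)" for t
    using sin_double[of "of_nat k * of_real t :: complex"] by (simp add: mult.assoc)
  have s: "sin_end (of_nat k) t = - ((-1) ^ k * sin (of_nat k * of_real t))" for t
    unfolding sin_end_def of_real_diff right_diff_distrib sin_diff sin_cos_nat_pi by simp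
  have c: "cos_end (of_nat k) t = (-1) ^ k * cos (of_nat k * of_real t)" for t
    unfolding cos_end_def of_real_diff right_diff_distrib cos_diff sin_cos_nat_pi by simp
  have "(\<lambda>t. q t * (sin_end (of_nat k) t * cos (of_nat k * of_real t)))
      = (\<lambda>t. (- ((-1) ^ k / 2)) * (q t * sin (2 * of_nat k * of_real t)))"
    unfolding s d by (simp add: fun_eq_iff)
  then show "end_functional q (sin_end (of_nat k)) (\<lambda>x. cos (of_nat k * of_real x)) = - ((-1) ^ k * sine_coeff k q / 2)"
    unfolding end_functional_def sine_coeff_def by (simp only: integral_mult_right) simp
  have "(\<lambda>t. q t * (cos_end (of_nat k) t * sin (of_nat k * of_real t)))
      = (\<lambda>t. ((-1) ^ k / 2) * (q t * sin (2 * of_nat k * of_real t)))"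
    unfolding c d by (simp add: fun_eq_iff)
  then show "end_functional q (cos_end (of_nat k)) (\<lambda>x. sin (of_nat k * of_real x)) = (-1) ^ k * sine_coeff k q / 2"
    unfolding end_functional_def sine_coeff_def by (simp only: integral_mult_right) simp
qed

definition nat_remainder :: "complex^4^2 \<Rightarrow> nat \<Rightarrow> (real \<Rightarrow> complex) \<Rightarrow> complex" where
  "nat_remainder A k q = (-1) ^ k * (of_nat k * (char_det A q ((of_nat k)\<^sup>2) - (-1) ^ (bc_theta A + 1) - (-1) ^ k))
     + (bc_alpha A - 1/2) * sine_coeff k q"

text \<open>The subtracted multiple of the sine coefficient is exactly the contribution of the two
  free integrals, so only differences with the sharper bound of
  \<open>end_functional_solution_lipschitz\<close> remain; sin k\<pi> = 0 removes the leading
  \<gamma> term. This is the source of the gain 1/k below.\<close>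

lemma nat_remainder_eq:
  assumes q: "L1_fun q" and k: "k > 0"
  shows "nat_remainder A k q = (-1) ^ k * (
      bc_alpha A * (end_functional q (sin_end (of_nat k)) (sol_c q (of_nat k))
        - end_functional q (sin_end (of_nat k)) (\<lambda>x. cos (of_nat k * of_real x)))
      + (1 - bc_alpha A) * (end_functional q (cos_end (of_nat k)) (sol_s q (of_nat k))
        - end_functional q (cos_end (of_nat k)) (\<lambda>x. sin (of_nat k * of_real x)))
      + bc_gamma A * (end_functional q (sin_end (of_nat k)) (sol_s q (of_nat k)) / of_nat k))"
proof -
  have k0: "of_nat k \<noteq> (0::complex)" using k by simp
  have sq: "(-1) ^ k * ((-1) ^ k * z) = z" for z :: complex
    by (simp flip: mult.assoc power_mult_distrib)
  have m: "(-1) ^ k * (of_nat k * (char_det A q ((of_nat k)\<^sup>2) - (-1) ^ (bc_theta A + 1) - (-1) ^ k))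
     = (-1) ^ k * (bc_alpha A * end_functional q (sin_end (of_nat k)) (sol_c q (of_nat k))
      + (1 - bc_alpha A) * end_functional q (cos_end (of_nat k)) (sol_s q (of_nat k))
      + bc_gamma A * (end_functional q (sin_end (of_nat k)) (sol_s q (of_nat k)) / of_nat k))"
    using char_det_expansion[OF q k0, of A] unfolding sin_cos_nat_pi by simp
  define h where "h = (-1) ^ k * sine_coeff k q / 2"
  have "(bc_alpha A - 1/2) * sine_coeff k q = (-1) ^ k * ((-1) ^ k * ((bc_alpha A - 1/2) * sine_coeff k q))"
    by (rule sq[symmetric])
  also have "\<dots> = (-1) ^ k * (bc_alpha A * h - (1 - bc_alpha A) * h)"
    unfolding h_def by (rule arg_cong[where f = "\<lambda>z. (-1) ^ k * z"]) (simp add: field_simps)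
  finally have e: "(bc_alpha A - 1/2) * sine_coeff k q = \<dots>" .
  show ?thesis unfolding nat_remainder_def m e end_functional_nat h_def[symmetric] by (simp add: algebra_simps)
qed

lemma norm_minus_one_power_mult [simp]: "norm ((-1) ^ k * z) = norm z" for z :: complex
  by (simp add: norm_mult norm_power)

lemma nat_remainder_lipschitz:
  assumes q: "L1_fun q1" "L1_fun q2"
    and M: "L1_norm q1 \<le> M" "L1_norm q2 \<le> M" "M > 0"
    and k: "real k \<ge> 2 * M" "k > 0"
  shows "norm (nat_remainder A k q1 - nat_remainder A k q2)
    \<le> bc_const A * (6 * M + 4) * L1_norm (\<lambda>t. q1 t - q2 t) / real k"
proof -
  define D where "D = L1_norm (\<lambda>t. q1 t - q2 t)"
  have D0: "D \<ge> 0" unfolding D_def by (rule L1_norm_nonneg)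
  have n: "norm (of_nat k :: complex) \<ge> 2 * M" using k by simp
  have kp: "real k > 0" using k by simp
  have a: "x \<le> 6 * M / real k * D \<Longrightarrow> x \<le> (6 * M + 4) * D / real k" for x
    using M kp D0 by (simp add: add_divide_distrib distrib_right add_increasing2)
  have b: "x \<le> 4 * D / real k \<Longrightarrow> x \<le> (6 * M + 4) * D / real k" for x
    using M kp D0 by (simp add: add_divide_distrib distrib_right add_increasing)
  define I1 J1 where "I1 q = end_functional q (sin_end (of_nat k)) (sol_c q (of_nat k))"
    and "J1 q = end_functional q (sin_end (of_nat k)) (\<lambda>x. cos (of_nat k * of_real x))" for q
  define I2 J2 where "I2 q = end_functional q (cos_end (of_nat k)) (sol_s q (of_nat k))"
    and "J2 q = end_functional q (cos_end (of_nat k)) (\<lambda>x. sin (of_nat k * of_real x))" for q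
  define I3 where "I3 q = end_functional q (sin_end (of_nat k)) (sol_s q (of_nat k))" for q
  have 1: "norm ((I1 q1 - J1 q1) - (I1 q2 - J1 q2)) \<le> 6 * M / real k * D"
    unfolding I1_def J1_def D_def
    using end_functional_solution_lipschitz(2)[OF M(3) n end_kernels(1,3,5,7)
          sine_volterra_sol(1)[OF q(1)] sine_volterra_sol(1)[OF q(2)] q(1) M(1) q(2) M(2)] by simp
  have 2: "norm ((I2 q1 - J2 q1) - (I2 q2 - J2 q2)) \<le> 6 * M / real k * D"
    unfolding I2_def J2_def D_def
    using end_functional_solution_lipschitz(2)[OF M(3) n end_kernels(2,4,6,8)
          sine_volterra_sol(2)[OF q(1)] sine_volterra_sol(2)[OF q(2)] q(1) M(1) q(2) M(2)] by simp
  have "norm (I3 q1 - I3 q2) \<le> 4 * D"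
    unfolding I3_def D_def
    using end_functional_solution_lipschitz(1)[OF M(3) n end_kernels(1,3,6,8)
          sine_volterra_sol(2)[OF q(1)] sine_volterra_sol(2)[OF q(2)] q(1) M(1) q(2) M(2)] by simp
  then have 3: "norm ((I3 q1 - I3 q2) / of_nat k) \<le> 4 * D / real k"
    using kp by (simp add: norm_divide divide_right_mono)
  have "nat_remainder A k q1 - nat_remainder A k q2 = (-1) ^ k * (
      bc_alpha A * ((I1 q1 - J1 q1) - (I1 q2 - J1 q2))
      + (1 - bc_alpha A) * ((I2 q1 - J2 q1) - (I2 q2 - J2 q2))
      + bc_gamma A * ((I3 q1 - I3 q2) / of_nat k))"
    unfolding nat_remainder_eq[OF q(1) k(2)] nat_remainder_eq[OF q(2) k(2)] I1_def J1_def I2_def J2_def I3_def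
    by (simp add: algebra_simps diff_divide_distrib)
  then show ?thesis
    using bc_combination_le[OF a[OF 1] a[OF 2] b[OF 3], of A] by (simp add: D_def mult_ac)
qed

lemma nat_remainder_bound:
  assumes q: "L1_fun q" and M: "L1_norm q \<le> M" "M > 0"
    and k: "real k \<ge> 2 * M" "k > 0"
  shows "norm (nat_remainder A k q) \<le> bc_const A * (6 * M + 4) * M / real k"
proof -
  have "nat_remainder A k (\<lambda>t. 0) = 0" by (simp add: nat_remainder_eq[OF _ k(2)])
  then have "norm (nat_remainder A k q) \<le> bc_const A * (6 * M + 4) * L1_norm q / real k"
    using nat_remainder_lipschitz[OF q absolutely_integrable_const M(1) _ M(2) k, of 0 A] M by (simp add: L1_norm_const)
  also have "\<dots> \<le> bc_const A * (6 * M + 4) * M / real k"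
    using M bc_const_nonneg by (intro divide_right_mono mult_left_mono) auto
  finally show ?thesis .
qed

section \<open>Sine series of square integrable functions\<close>

abbreviation leb_pi :: "real measure" where "leb_pi \<equiv> lebesgue_on {0<..<pi}"

definition norm2_sq :: "(real \<Rightarrow> complex) \<Rightarrow> real" where
  "norm2_sq f = (LINT x|leb_pi. (cmod (f x))\<^sup>2)"

text \<open>The bridge between Lebesgue measure on the open interval, in which the L2 norm is
  defined, and integration over the closed one, in which the differential equation is
  stated.\<close>

lemma integrable_leb_pi_iff:
  fixes f :: "real \<Rightarrow> 'a::euclidean_space"
  shows "integrable leb_pi f \<longleftrightarrow> L1_fun f"
  unfolding absolutely_integrable_on_Icc_iff_Ioo unfolding set_integrable_def by (subst integrable_restrict_space) auto

lemma integral_leb_pi: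
  fixes f :: "real \<Rightarrow> 'a::euclidean_space"
  assumes "L1_fun f"
  shows "(LINT x|leb_pi. f x) = integral {0..pi} f"
  using lebesgue_integral_eq_integral[of "{0<..<pi}" f] assms integral_open_interval_real[of 0 pi f]
  by (simp add: integrable_leb_pi_iff)

interpretation leb_pi: finite_measure leb_pi
  by (rule finite_measure_lebesgue_on) simp

lemma norm_add_sq_le:
  "(norm (x + y :: 'a :: real_normed_vector))\<^sup>2 \<le> 2 * (norm x)\<^sup>2 + 2 * (norm y)\<^sup>2"
proof -
  have "(norm (x + y))\<^sup>2 \<le> (norm x + norm y)\<^sup>2"
    by (intro power_mono norm_triangle_ineq) auto
  also have "\<dots> \<le> 2 * (norm x)\<^sup>2 + 2 * (norm y)\<^sup>2"
    using sum_squares_bound[of "norm x" "norm y"] by (simp add: power2_sum)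
  finally show ?thesis .
qed

lemma L2_fun_add:
  assumes "L2_fun f" "L2_fun g"
  shows "L2_fun (\<lambda>x. f x + g x)"
proof -
  have [measurable]: "f \<in> borel_measurable leb_pi" "g \<in> borel_measurable leb_pi"
    using assms by (auto simp: L2_fun_def)
  have "integrable leb_pi (\<lambda>x. (cmod (f x + g x))\<^sup>2)"
  proof (rule Bochner_Integration.integrable_bound)
    show "integrable leb_pi (\<lambda>x. 2 * (cmod (f x))\<^sup>2 + 2 * (cmod (g x))\<^sup>2)"
      using assms by (auto simp: L2_fun_def)
    show "AE x in leb_pi. norm ((cmod (f x + g x))\<^sup>2) \<le> norm (2 * (cmod (f x))\<^sup>2 + 2 * (cmod (g x))\<^sup>2)"
      using norm_add_sq_le[of "f _" "g _"] by auto
  qed measurable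
  then show ?thesis by (auto simp: L2_fun_def)
qed

lemma L2_fun_cmult: "L2_fun f \<Longrightarrow> L2_fun (\<lambda>x. c * f x)"
  unfolding L2_fun_def by (auto simp: norm_mult power_mult_distrib)

lemma L2_fun_diff: "L2_fun f \<Longrightarrow> L2_fun g \<Longrightarrow> L2_fun (\<lambda>x. f x - g x)"
  using L2_fun_add[of f "\<lambda>x. - 1 * g x"] L2_fun_cmult[of g "- 1"] by simp

lemma L2_fun_continuous:
  assumes "continuous_on {0..pi} f"
  shows "L2_fun f"
proof -
  have "L1_fun f" "L1_fun (\<lambda>x. (cmod (f x))\<^sup>2)"
    by (intro absolutely_integrable_continuous_real continuous_intros assms)+
  then show ?thesis by (auto simp: L2_fun_def simp flip: integrable_leb_pi_iff)
qed

lemma L2_fun_sum: "(\<And>n. n \<in> S \<Longrightarrow> L2_fun (f n)) \<Longrightarrow> L2_fun (\<lambda>x. \<Sum>n\<in>S. f n x)"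
proof (induction S rule: infinite_finite_induct)
  case (insert x F)
  then show ?case by (auto intro!: L2_fun_add)
qed (auto intro!: L2_fun_continuous)

lemma L2_fun_mult_integrable:
  assumes "L2_fun f" "L2_fun g"
  shows "integrable leb_pi (\<lambda>x. f x * g x)"
proof -
  have [measurable]: "f \<in> borel_measurable leb_pi" "g \<in> borel_measurable leb_pi"
    using assms by (auto simp: L2_fun_def)
  show ?thesis
  proof (rule Bochner_Integration.integrable_bound)
    show "integrable leb_pi (\<lambda>x. (cmod (f x))\<^sup>2 + (cmod (g x))\<^sup>2)"
      using assms by (auto simp: L2_fun_def)
    have "cmod (f x) * cmod (g x) \<le> (cmod (f x))\<^sup>2 + (cmod (g x))\<^sup>2" for x
      using sum_squares_bound[of "cmod (f x)" "cmod (g x)"] mult_nonneg_nonneg[OF norm_ge_zero[of "f x"] norm_ge_zero[of "g x"]]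
      by linarith
    then show "AE x in leb_pi. norm (f x * g x) \<le> norm ((cmod (f x))\<^sup>2 + (cmod (g x))\<^sup>2)"
      by (auto simp: norm_mult)
  qed measurable
qed

lemma L2_fun_imp_absolutely_integrable:
  assumes "L2_fun f"
  shows "L1_fun f"
  using L2_fun_mult_integrable[OF assms L2_fun_continuous[of "\<lambda>_. 1"]] by (simp add: integrable_leb_pi_iff)

lemma norm2_sq_nonneg: "norm2_sq f \<ge> 0"
  unfolding norm2_sq_def by simp

lemma L2_norm_eq: "L2_norm f = sqrt (norm2_sq f)"
  by (simp add: L2_norm_def norm2_sq_def)

lemma L1_norm_le_norm2:
  assumes f: "L2_fun f"
  shows "L1_norm f \<le> sqrt (pi * norm2_sq f)"
proof -
  have ai: "L1_fun f" by (rule L2_fun_imp_absolutely_integrable[OF f])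
  then have ni: "integrable leb_pi (\<lambda>x. cmod (f x))"
    by (simp add: integrable_leb_pi_iff absolutely_integrable_norm[unfolded comp_def])
  then have L1: "L1_norm f = (LINT x|leb_pi. cmod (f x))"
    unfolding L1_norm_def by (intro integral_leb_pi[symmetric]) (simp add: integrable_leb_pi_iff)
  have sq: "integrable leb_pi (\<lambda>x. (cmod (f x))\<^sup>2)" using f by (simp add: L2_fun_def)
  \<comment> \<open>The mean value of |f|, which minimizes the integral of (|f| - c)^2; that this
    integral is nonnegative is then the Cauchy-Schwarz inequality.\<close>
  define c where "c = L1_norm f / pi"
  have "0 \<le> (LINT x|leb_pi. (cmod (f x) - c)\<^sup>2)" by simp
  also have "\<dots> = (LINT x|leb_pi. (cmod (f x))\<^sup>2 - 2 * c * cmod (f x) + c\<^sup>2)"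
    by (simp add: power2_diff algebra_simps)
  also have "\<dots> = norm2_sq f - 2 * c * L1_norm f + c\<^sup>2 * pi"
    using ni sq by (simp add: norm2_sq_def L1 measure_restrict_space)
  finally have "2 * c * L1_norm f - c\<^sup>2 * pi \<le> norm2_sq f" by simp
  then have "(L1_norm f)\<^sup>2 \<le> pi * norm2_sq f"
    unfolding c_def by (simp add: power2_eq_square field_simps)
  then show ?thesis by (rule real_le_rsqrt)
qed

lemma norm2_sq_add_le:
  assumes "L2_fun f" "L2_fun g"
  shows "norm2_sq (\<lambda>x. f x + g x) \<le> 2 * norm2_sq f + 2 * norm2_sq g"
proof -
  have "norm2_sq (\<lambda>x. f x + g x) \<le> (LINT x|leb_pi. 2 * (cmod (f x))\<^sup>2 + 2 * (cmod (g x))\<^sup>2)"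
    unfolding norm2_sq_def
  proof (rule integral_mono)
    show "(cmod (f x + g x))\<^sup>2 \<le> 2 * (cmod (f x))\<^sup>2 + 2 * (cmod (g x))\<^sup>2" for x
      by (rule norm_add_sq_le)
  qed (use assms L2_fun_add[OF assms] in \<open>auto simp: L2_fun_def\<close>)
  also have "\<dots> = 2 * norm2_sq f + 2 * norm2_sq g"
    using assms by (simp add: L2_fun_def norm2_sq_def)
  finally show ?thesis .
qed

lemma norm2_sq_minus: "norm2_sq (\<lambda>x. g x - f x) = norm2_sq (\<lambda>x. f x - g x)"
  by (simp add: norm2_sq_def norm_minus_commute)

section \<open>Orthogonality of the sines, Bessel's inequality and the Riesz-Fischer theorem\<close>

lemma integral_cos_even:
  fixes m :: int
  assumes "m \<noteq> 0"
  shows "integral {0..pi} (\<lambda>t. cos (2 * of_int m * t)) = (0::real)"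
proof -
  have "((\<lambda>t. cos (2 * of_int m * t)) has_integral (sin (2 * of_int m * pi) / (2 * of_int m) - sin (2 * of_int m * 0) / (2 * of_int m))) {0..pi}"
    using assms by (intro fundamental_theorem_of_calculus)
      (auto intro!: derivative_eq_intros simp flip: has_real_derivative_iff_has_vector_derivative)
  moreover have "sin (2 * of_int m * pi) = 0"
    using sin_npi_int[of "2 * m"] by (simp add: mult_ac)
  ultimately show ?thesis by (simp add: integral_unique)
qed

lemma integral_sin_sin:
  fixes k l :: nat
  assumes "k > 0" "l > 0"
  shows "integral {0..pi} (\<lambda>t. sin (2 * real k * t) * sin (2 * real l * t)) = (if k = l then pi / 2 else 0)"
proof -
  have e: "sin (2 * real k * t) * sin (2 * real l * t)
      = cos (2 * of_int (int k - int l) * t) / 2 - cos (2 * of_int (int k + int l) * t) / 2" for t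
    unfolding sin_times_sin by (simp add: algebra_simps diff_divide_distrib)
  have i: "(\<lambda>t. cos (2 * of_int m * t) / 2) integrable_on {0..pi}" for m :: int
    by (intro integrable_continuous_real continuous_intros) auto
  have "integral {0..pi} (\<lambda>t. sin (2 * real k * t) * sin (2 * real l * t))
      = integral {0..pi} (\<lambda>t. cos (2 * of_int (int k - int l) * t) / 2) - integral {0..pi} (\<lambda>t. cos (2 * of_int (int k + int l) * t) / 2)"
    unfolding e by (rule integral_diff[OF i i])
  also have "integral {0..pi} (\<lambda>t. cos (2 * of_int (int k + int l) * t) / 2) = 0"
    using integral_cos_even[of "int k + int l"] assms by simp
  also have "integral {0..pi} (\<lambda>t. cos (2 * of_int (int k - int l) * t) / 2) = (if k = l then pi / 2 else 0)"
    using integral_cos_even[of "int k - int l"] by simp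
  finally show ?thesis by simp
qed

definition sine_sum :: "(nat \<Rightarrow> nat) \<Rightarrow> (nat \<Rightarrow> complex) \<Rightarrow> nat set \<Rightarrow> real \<Rightarrow> complex" where
  "sine_sum k a S t = (\<Sum>n\<in>S. a n * of_real (sin (2 * real (k n) * t)))"

lemma sine_coeff_leb:
  assumes "L2_fun f"
  shows "sine_coeff k f = (LINT t|leb_pi. f t * of_real (sin (2 * real k * t)))"
    and "integrable leb_pi (\<lambda>t. f t * of_real (sin (2 * real k * t)))"
proof -
  have i: "integrable leb_pi (\<lambda>t. f t * of_real (sin (2 * real k * t)))"
    by (intro L2_fun_mult_integrable assms L2_fun_continuous continuous_intros)
  show "sine_coeff k f = (LINT t|leb_pi. f t * of_real (sin (2 * real k * t)))"
    unfolding sine_coeff_def using integral_leb_pi[of "\<lambda>t. f t * of_real (sin (2 * real k * t))"] i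
    by (simp add: integrable_leb_pi_iff flip: sin_of_real)
  show "integrable leb_pi (\<lambda>t. f t * of_real (sin (2 * real k * t)))" by (rule i)
qed

lemma L2_fun_sine_sum: "L2_fun (sine_sum k a S)"
  unfolding sine_sum_def[abs_def] by (intro L2_fun_sum L2_fun_cmult L2_fun_continuous continuous_intros)

lemma sine_coeff_add:
  assumes "L2_fun f" "L2_fun g"
  shows "sine_coeff k (\<lambda>t. f t + g t) = sine_coeff k f + sine_coeff k g"
  unfolding sine_coeff_leb(1)[OF assms(1)] sine_coeff_leb(1)[OF assms(2)] sine_coeff_leb(1)[OF L2_fun_add[OF assms]]
  using sine_coeff_leb(2)[OF assms(1)] sine_coeff_leb(2)[OF assms(2)] by (simp add: distrib_right)

lemma sine_coeff_diff:
  assumes "L2_fun f" "L2_fun g"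
  shows "sine_coeff k (\<lambda>t. f t - g t) = sine_coeff k f - sine_coeff k g"
  unfolding sine_coeff_leb(1)[OF assms(1)] sine_coeff_leb(1)[OF assms(2)] sine_coeff_leb(1)[OF L2_fun_diff[OF assms]]
  using sine_coeff_leb(2)[OF assms(1)] sine_coeff_leb(2)[OF assms(2)] by (simp add: left_diff_distrib)

lemma sine_coeff_le_L1:
  assumes "L1_fun f"
  shows "norm (sine_coeff k f) \<le> L1_norm f"
proof -
  have "norm (sine_coeff k f) \<le> L1_norm f * 1"
    unfolding sine_coeff_def
  proof (rule norm_integral_mult_le[OF assms])
    show "(\<lambda>s. f s * sin (2 * of_nat k * complex_of_real s)) integrable_on {0..pi}"
      by (intro integrable_mult_initial assms continuous_intros) auto
    show "norm (sin (2 * of_nat k * complex_of_real s)) \<le> 1" for s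
    proof -
      have "sin (2 * of_nat k * complex_of_real s) = of_real (sin (2 * real k * s))" by (simp flip: sin_of_real)
      then show ?thesis by (simp only: norm_of_real abs_sin_le_one)
    qed
  qed auto
  then show ?thesis by simp
qed

context
  fixes k :: "nat \<Rightarrow> nat"
  assumes inj: "inj k" and pos: "\<And>n. k n > 0"
begin

lemma integral_sin_sin':
  "(LINT t|leb_pi. sin (2 * real (k n) * t) * sin (2 * real (k m) * t)) = (if n = m then pi / 2 else 0)"
proof -
  have "L1_fun (\<lambda>t. sin (2 * real (k n) * t) * sin (2 * real (k m) * t))"
    by (intro absolutely_integrable_continuous_real continuous_intros)
  from integral_leb_pi[OF this] show ?thesis
    using integral_sin_sin[OF pos pos, of n m] inj by (simp add: inj_eq)
qed

lemma sin_sin_integrable: "integrable leb_pi (\<lambda>t. sin (2 * real (k n) * t) * sin (2 * real (k m) * t))"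
  unfolding integrable_leb_pi_iff by (intro absolutely_integrable_continuous_real continuous_intros)

lemma sine_coeff_sine_sum:
  assumes "finite S"
  shows "sine_coeff (k m) (sine_sum k a S) = (if m \<in> S then of_real (pi / 2) * a m else 0)"
proof -
  have "sine_coeff (k m) (sine_sum k a S)
     = (LINT t|leb_pi. (\<Sum>n\<in>S. a n * of_real (sin (2 * real (k n) * t) * sin (2 * real (k m) * t))))"
    unfolding sine_coeff_leb(1)[OF L2_fun_sine_sum] sine_sum_def
    by (intro Bochner_Integration.integral_cong) (simp_all add: sum_distrib_right mult.assoc)
  also have "\<dots> = (\<Sum>n\<in>S. (LINT t|leb_pi. a n * of_real (sin (2 * real (k n) * t) * sin (2 * real (k m) * t))))"
    by (intro Bochner_Integration.integral_sum integrable_mult_right integrable_of_real sin_sin_integrable)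
  also have "\<dots> = (\<Sum>n\<in>S. a n * of_real (if n = m then pi / 2 else 0))"
    by (simp only: integral_mult_right_zero integral_complex_of_real integral_sin_sin')
  also have "\<dots> = (\<Sum>n\<in>S. if n = m then of_real (pi / 2) * a m else 0)"
    by (intro sum.cong) auto
  finally show ?thesis using assms by simp
qed

text \<open>With f = 0 this is Parseval's identity for finite sums, and with the Fourier
  coefficients of f it becomes Bessel's inequality.\<close>

lemma norm2_sq_sine_expand:
  assumes f: "L2_fun f" and S: "finite S"
  shows "norm2_sq (\<lambda>t. f t - sine_sum k a S t)
    = norm2_sq f - 2 * (\<Sum>n\<in>S. Re (cnj (a n) * sine_coeff (k n) f)) + pi / 2 * (\<Sum>n\<in>S. (cmod (a n))\<^sup>2)"
proof -
  define g where "g = sine_sum k a S"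
  have g: "L2_fun g" unfolding g_def by (rule L2_fun_sine_sum)
  have cg: "cnj (g t) = (\<Sum>n\<in>S. cnj (a n) * of_real (sin (2 * real (k n) * t)))" for t
    by (simp add: g_def sine_sum_def)
  have inner: "integrable leb_pi (\<lambda>t. cnj (g t) * h t)"
    "(LINT t|leb_pi. cnj (g t) * h t) = (\<Sum>n\<in>S. cnj (a n) * sine_coeff (k n) h)" if h: "L2_fun h" for h
  proof -
    have e: "cnj (g t) * h t = (\<Sum>n\<in>S. cnj (a n) * (h t * of_real (sin (2 * real (k n) * t))))" for t
      unfolding cg sum_distrib_right by (intro sum.cong) auto
    show "integrable leb_pi (\<lambda>t. cnj (g t) * h t)" unfolding e
      by (intro Bochner_Integration.integrable_sum integrable_mult_right sine_coeff_leb h)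
    show "(LINT t|leb_pi. cnj (g t) * h t) = (\<Sum>n\<in>S. cnj (a n) * sine_coeff (k n) h)" unfolding e
      by (subst Bochner_Integration.integral_sum)
        (auto intro!: integrable_mult_right sine_coeff_leb(2) h sum.cong simp: sine_coeff_leb(1)[OF h])
  qed
  have gg: "cnj (g t) * g t = of_real ((cmod (g t))\<^sup>2)" for t
    unfolding complex_norm_square by (rule mult.commute)
  have "(LINT t|leb_pi. of_real ((cmod (g t))\<^sup>2)) = (\<Sum>n\<in>S. cnj (a n) * sine_coeff (k n) g)"
    using inner(2)[OF g] unfolding gg .
  then have "complex_of_real (norm2_sq g) = (\<Sum>n\<in>S. cnj (a n) * sine_coeff (k n) g)"
    by (simp only: integral_complex_of_real norm2_sq_def)
  also have "\<dots> = (\<Sum>n\<in>S. of_real (pi / 2 * (cmod (a n))\<^sup>2))"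
  proof (rule sum.cong[OF refl])
    fix n assume "n \<in> S"
    then have "cnj (a n) * sine_coeff (k n) g = of_real (pi / 2) * (a n * cnj (a n))"
      by (simp add: g_def sine_coeff_sine_sum[OF S])
    then show "cnj (a n) * sine_coeff (k n) g = of_real (pi / 2 * (cmod (a n))\<^sup>2)"
      by (simp only: of_real_mult complex_norm_square)
  qed
  also have "\<dots> = complex_of_real (pi / 2 * (\<Sum>n\<in>S. (cmod (a n))\<^sup>2))"
    by (simp add: sum_distrib_left)
  finally have ng: "norm2_sq g = pi / 2 * (\<Sum>n\<in>S. (cmod (a n))\<^sup>2)" by (simp only: of_real_eq_iff)
  have p: "(cmod (f t - g t))\<^sup>2 = (cmod (f t))\<^sup>2 - 2 * Re (cnj (g t) * f t) + (cmod (g t))\<^sup>2" for t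
    by (simp add: cmod_power2 power2_diff algebra_simps)
  have "norm2_sq (\<lambda>t. f t - g t) = norm2_sq f - 2 * (LINT t|leb_pi. Re (cnj (g t) * f t)) + norm2_sq g"
  proof -
    define h where "h t = Re (cnj (g t) * f t)" for t
    have "integrable leb_pi h" unfolding h_def by (rule integrable_Re[OF inner(1)[OF f]])
    then show ?thesis unfolding norm2_sq_def p h_def[symmetric] using f g by (simp add: L2_fun_def)
  qed
  also have "(LINT t|leb_pi. Re (cnj (g t) * f t)) = Re (LINT t|leb_pi. cnj (g t) * f t)"
    by (rule integral_Re[OF inner(1)[OF f]])
  finally show ?thesis unfolding ng inner(2)[OF f] by (simp add: g_def)
qed

lemma norm2_sq_sine_sum:
  "finite S \<Longrightarrow> norm2_sq (sine_sum k a S) = pi / 2 * (\<Sum>n\<in>S. (cmod (a n))\<^sup>2)"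
  using norm2_sq_sine_expand[of "\<lambda>_. 0" S a] L2_fun_continuous[of "\<lambda>_. 0"]
  by (simp add: norm2_sq_def sine_coeff_def)

lemma bessel:
  assumes f: "L2_fun f"
  shows "summable (\<lambda>n. (cmod (sine_coeff (k n) f))\<^sup>2)"
proof (rule summableI_nonneg_bounded)
  fix N
  \<comment> \<open>The best approximation: each sine has squared norm \<pi>/2.\<close>
  define a where "a n = of_real (2 / pi) * sine_coeff (k n) f" for n
  have "Re (cnj (a n) * sine_coeff (k n) f) = 2 / pi * (cmod (sine_coeff (k n) f))\<^sup>2" for n
  proof -
    have "cnj (a n) * sine_coeff (k n) f = of_real (2 / pi) * of_real ((cmod (sine_coeff (k n) f))\<^sup>2)"
      unfolding complex_norm_square by (simp add: a_def mult_ac)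
    then show ?thesis by (metis Re_complex_of_real of_real_mult)
  qed
  moreover have "(cmod (a n))\<^sup>2 = (2 / pi)\<^sup>2 * (cmod (sine_coeff (k n) f))\<^sup>2" for n
    by (simp add: a_def norm_mult power_mult_distrib power_divide norm_divide)
  ultimately have "0 \<le> norm2_sq f - 2 * (\<Sum>n<N. 2 / pi * (cmod (sine_coeff (k n) f))\<^sup>2)
       + pi / 2 * (\<Sum>n<N. (2 / pi)\<^sup>2 * (cmod (sine_coeff (k n) f))\<^sup>2)"
    using norm2_sq_sine_expand[OF f finite_lessThan[of N], of a] norm2_sq_nonneg[of "\<lambda>t. f t - sine_sum k a {..<N} t"]
    by simp
  then have "(\<Sum>n<N. (cmod (sine_coeff (k n) f))\<^sup>2) * (2 / pi) \<le> norm2_sq f"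
    unfolding sum_distrib_left[symmetric]
  proof -
    let ?X = "\<Sum>n<N. (cmod (sine_coeff (k n) f))\<^sup>2"
    assume *: "0 \<le> norm2_sq f - 2 * (2 / pi * ?X) + pi / 2 * ((2 / pi)\<^sup>2 * ?X)"
    have "pi / 2 * ((2 / pi)\<^sup>2 * ?X) = ?X * (2 / pi)" by (simp add: power2_eq_square)
    then show ?thesis using * by (simp add: mult.commute)
  qed
  then show "(\<Sum>n<N. (cmod (sine_coeff (k n) f))\<^sup>2) \<le> norm2_sq f * pi / 2"
    by (simp add: field_simps)
qed auto

end

text \<open>Each time the first summand is split off with \<open>norm_add_sq_le\<close>, the weight
  of everything after it doubles.\<close>

lemma norm_sum_sq_le_weighted:
  fixes f :: "nat \<Rightarrow> complex"
  shows "(cmod (\<Sum>i<n. f i))\<^sup>2 \<le> (\<Sum>i<n. 2 ^ Suc i * (cmod (f i))\<^sup>2)"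
proof (induction n arbitrary: f)
  case (Suc n)
  have "(cmod (\<Sum>i<Suc n. f i))\<^sup>2 = (cmod (f 0 + (\<Sum>i<n. f (Suc i))))\<^sup>2"
    by (simp only: sum.lessThan_Suc_shift)
  also have "\<dots> \<le> 2 * (cmod (f 0))\<^sup>2 + 2 * (cmod (\<Sum>i<n. f (Suc i)))\<^sup>2"
    by (rule norm_add_sq_le)
  also have "\<dots> \<le> 2 * (cmod (f 0))\<^sup>2 + 2 * (\<Sum>i<n. 2 ^ Suc i * (cmod (f (Suc i)))\<^sup>2)"
    using Suc.IH[of "\<lambda>i. f (Suc i)"] by simp
  also have "\<dots> = (\<Sum>i<Suc n. 2 ^ Suc i * (cmod (f i))\<^sup>2)"
    unfolding sum.lessThan_Suc_shift by (simp add: sum_distrib_left mult.assoc)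
  finally show ?case .
qed simp

text \<open>The weights \<open>2\<^sup>j\<close> on the squares \<open>|f\<^sub>j|\<^sup>2\<close> replace Minkowski's inequality.\<close>

lemma L2_series_limit:
  assumes f: "\<And>j. L2_fun (f j)" and small: "\<And>j. norm2_sq (f j) \<le> 2 * (1/8) ^ j"
  shows "\<exists>g C. L2_fun g \<and> (\<forall>J. norm2_sq (\<lambda>t. g t - (\<Sum>j<J. f j t)) \<le> C * (1/2) ^ J)"
proof -
  have fm [measurable]: "f j \<in> borel_measurable leb_pi" for j using f by (auto simp: L2_fun_def)
  \<comment> \<open>The weights 2^j are affordable: against \<open>small\<close> they leave
    integrals of order (1/4)^j.\<close>
  define w where "w j t = 2 ^ j * (cmod (f j t))\<^sup>2" for j t
  have w0: "w j t \<ge> 0" for j t by (simp add: w_def)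
  have wi: "integrable leb_pi (w j)" for j using f by (simp add: w_def[abs_def] L2_fun_def)
  have wI: "(LINT t|leb_pi. w j t) \<le> 2 * (1/4) ^ j" for j
  proof -
    have "(LINT t|leb_pi. w j t) = 2 ^ j * norm2_sq (f j)" by (simp add: w_def norm2_sq_def)
    also have "\<dots> \<le> 2 ^ j * (2 * (1/8) ^ j)" by (intro mult_left_mono small) auto
    also have "\<dots> = 2 * (2 * (1/8)) ^ j" by (simp only: power_mult_distrib mult_ac)
    finally show ?thesis by simp
  qed
  have sI: "summable (\<lambda>j. LINT t|leb_pi. norm (w j t))"
  proof (rule summable_comparison_test')
    show "summable (\<lambda>j. 2 * (1/4::real) ^ j)" by (intro summable_mult summable_geometric) simp
    show "norm (LINT t|leb_pi. norm (w j t)) \<le> 2 * (1/4) ^ j" for j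
      using wI[of j] by (simp add: w0)
  qed
  \<comment> \<open>Monotone convergence: the weighted sum is finite almost everywhere. As
    \<open>G\<close> it then dominates both the pointwise convergence and the tails.\<close>
  have "(\<integral>\<^sup>+ t. (\<Sum>j. ennreal (w j t)) \<partial>leb_pi) = (\<Sum>j. \<integral>\<^sup>+ t. ennreal (w j t) \<partial>leb_pi)"
    by (rule nn_integral_suminf) (auto simp: w_def)
  also have "\<dots> = (\<Sum>j. ennreal (LINT t|leb_pi. w j t))"
    using wi w0 by (intro suminf_cong nn_integral_eq_integral) auto
  also have "\<dots> = ennreal (\<Sum>j. LINT t|leb_pi. w j t)"
    using sI w0 by (intro suminf_ennreal2) auto
  finally have "(\<integral>\<^sup>+ t. (\<Sum>j. ennreal (w j t)) \<partial>leb_pi) \<noteq> \<infinity>" by simp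
  then have "AE t in leb_pi. (\<Sum>j. ennreal (w j t)) \<noteq> \<infinity>"
    by (intro nn_integral_noteq_infinite) (auto simp: w_def)
  then have AE: "AE t in leb_pi. summable (\<lambda>j. w j t)"
    by eventually_elim (use w0 in \<open>auto intro: summable_suminf_not_top\<close>)
  define G where "G t = (\<Sum>j. w j t)" for t
  have Gi: "integrable leb_pi G"
    unfolding G_def[abs_def] using AE sI w0 by (intro integrable_suminf wi) auto
  define g where "g t = (\<Sum>j. f j t)" for t
  have [measurable]: "g \<in> borel_measurable leb_pi" unfolding g_def[abs_def] by measurable
  have key: "(cmod (g t - (\<Sum>j<J. f j t)))\<^sup>2 \<le> 2 * (1/2) ^ J * G t" if s: "summable (\<lambda>j. w j t)" for t J
  proof -
    have wG: "w j t \<le> G t" for j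
      unfolding G_def using sum_le_suminf[OF s, of "{j}"] w0 by simp
    have G0: "G t \<ge> 0" using wG[of 0] w0[of 0 t] by linarith
    have "summable (\<lambda>j. f j t)"
    proof (rule summable_comparison_test')
      show "summable (\<lambda>j. sqrt (G t) * (1 / sqrt 2) ^ j)"
        by (intro summable_mult summable_geometric) auto
      fix j
      have "(cmod (f j t))\<^sup>2 \<le> G t * ((1 / sqrt 2) ^ j)\<^sup>2"
      proof -
        have "((1 / sqrt 2) ^ j)\<^sup>2 = ((1 / sqrt 2)\<^sup>2) ^ j" by (simp only: power_mult[symmetric] mult.commute)
        then have "((1 / sqrt 2) ^ j)\<^sup>2 = 1 / 2 ^ j" by (simp add: power_divide)
        then show ?thesis using wG[of j] unfolding w_def
          by (simp only: mult_1_right times_divide_eq_right pos_le_divide_eq zero_less_power zero_less_numeral mult.commute[of "2 ^ j"])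
      qed
      then show "norm (f j t) \<le> sqrt (G t) * (1 / sqrt 2) ^ j"
        using G0 by - (rule power2_le_imp_le, simp_all only: power_mult_distrib real_sqrt_pow2 mult_nonneg_nonneg zero_le_power real_sqrt_ge_zero zero_le_divide_1_iff zero_le_numeral)
    qed
    then have "(\<lambda>n. \<Sum>j<n. f j t) \<longlonglongrightarrow> g t" unfolding g_def by (rule summable_LIMSEQ)
    then have "(\<lambda>n. \<Sum>j<n + J. f j t) \<longlonglongrightarrow> g t" by (rule LIMSEQ_ignore_initial_segment)
    then have lim: "(\<lambda>n. (cmod ((\<Sum>j<n + J. f j t) - (\<Sum>j<J. f j t)))\<^sup>2) \<longlonglongrightarrow> (cmod (g t - (\<Sum>j<J. f j t)))\<^sup>2"
      by (intro tendsto_intros)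
    show ?thesis
    proof (rule tendsto_upperbound[OF lim always_eventually[OF allI]])
      fix n
      have "(\<Sum>j<n + J. f j t) - (\<Sum>j<J. f j t) = (\<Sum>i<n. f (J + i) t)"
        by (induction n) (auto simp: add.commute)
      then have "(cmod ((\<Sum>j<n + J. f j t) - (\<Sum>j<J. f j t)))\<^sup>2 \<le> (\<Sum>i<n. 2 ^ Suc i * (cmod (f (J + i) t))\<^sup>2)"
        using norm_sum_sq_le_weighted[of "\<lambda>i. f (J + i) t" n] by simp
      \<comment> \<open>The weight 2^(i+1) is 2 (1/2)^J times the weight 2^(J+i) inside
        \<open>w\<close>; the decay in J comes from here.\<close>
      also have "\<dots> = 2 * (1/2) ^ J * (\<Sum>i<n. w (J + i) t)"
        unfolding w_def sum_distrib_left by (intro sum.cong) (auto simp: power_add field_simps)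
      also have "(\<Sum>i<n. w (J + i) t) = (\<Sum>i\<in>{J..<J + n}. w i t)"
        using sum.shift_bounds_nat_ivl[of "\<lambda>i. w i t" 0 J n] by (simp add: add.commute lessThan_atLeast0)
      also have "\<dots> \<le> G t"
        unfolding G_def by (intro sum_le_suminf s) (auto simp: w0)
      finally show "(cmod ((\<Sum>j<n + J. f j t) - (\<Sum>j<J. f j t)))\<^sup>2 \<le> 2 * (1/2) ^ J * G t"
        by simp
    qed simp
  qed
  have sqi: "integrable leb_pi (\<lambda>t. (cmod (g t - (\<Sum>j<J. f j t)))\<^sup>2)" for J
  proof (rule Bochner_Integration.integrable_bound)
    show "integrable leb_pi (\<lambda>t. 2 * (1/2) ^ J * G t)" using Gi by simp
    show "AE t in leb_pi. norm ((cmod (g t - (\<Sum>j<J. f j t)))\<^sup>2) \<le> norm (2 * (1/2) ^ J * G t)"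
      using AE
    proof eventually_elim
      case (elim t)
      show ?case using order_trans[OF key[OF elim, of J] abs_ge_self] by (simp del: abs_mult)
    qed
  qed measurable
  have "norm2_sq (\<lambda>t. g t - (\<Sum>j<J. f j t)) \<le> (2 * (LINT t|leb_pi. G t)) * (1/2) ^ J" for J
  proof -
    have "norm2_sq (\<lambda>t. g t - (\<Sum>j<J. f j t)) \<le> (LINT t|leb_pi. 2 * (1/2) ^ J * G t)"
      unfolding norm2_sq_def
      by (rule integral_mono_AE) (use sqi Gi AE key in \<open>auto elim!: eventually_mono\<close>)
    then show ?thesis by (simp add: mult_ac)
  qed
  moreover have "L2_fun g" using sqi[of 0] by (simp add: L2_fun_def)
  ultimately show ?thesis by blast
qed

context
  fixes k :: "nat \<Rightarrow> nat"
  assumes inj: "inj k" and pos: "\<And>n. k n > 0"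
begin

lemma sine_sum_diff:
  "finite S \<Longrightarrow> T \<subseteq> S \<Longrightarrow> sine_sum k a S t - sine_sum k a T t = sine_sum k a (S - T) t"
  unfolding sine_sum_def by (simp add: sum_diff)

text \<open>The partial sums may converge slowly, so they are grouped into blocks beyond whose
  starts \<open>K j\<close> the squared coefficients sum to at most (1/8)^j, and the blocks are
  summed pointwise. Any other partial sum differs from one at a block end by a small tail.\<close>

lemma riesz_fischer_limit:
  assumes a: "summable (\<lambda>n. (cmod (a n))\<^sup>2)"
  shows "\<exists>g. L2_fun g \<and> (\<lambda>K. norm2_sq (\<lambda>t. g t - sine_sum k a {..<K} t)) \<longlonglongrightarrow> 0"
proof -
  have "\<exists>K. \<forall>L. (\<Sum>n\<in>{K..<L}. (cmod (a n))\<^sup>2) < (1/8) ^ j" for j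
  proof -
    obtain K where K: "\<And>m n. m \<ge> K \<Longrightarrow> norm (\<Sum>n\<in>{m..<n}. (cmod (a n))\<^sup>2) < (1/8) ^ j"
      using summable_Cauchy[THEN iffD1, OF a, rule_format, of "(1/8) ^ j"] by auto
    have "(\<Sum>n\<in>{K..<L}. (cmod (a n))\<^sup>2) < (1/8) ^ j" for L
      using K[of K L] by (simp add: sum_nonneg)
    then show ?thesis by blast
  qed
  then obtain K0 where K0: "\<And>j L. (\<Sum>n\<in>{K0 j..<L}. (cmod (a n))\<^sup>2) < (1/8) ^ j" by metis
  \<comment> \<open>Summing the thresholds makes them monotone and keeps them at least
    \<open>K0 j\<close>.\<close>
  define K where "K j = (\<Sum>i\<le>j. K0 i)" for j
  have Kge: "K0 j \<le> K j" for j unfolding K_def by (rule member_le_sum) auto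
  have Kmono: "K j \<le> K (Suc j)" for j by (simp add: K_def)
  have tail: "(\<Sum>n\<in>{K j..<L}. (cmod (a n))\<^sup>2) \<le> (1/8) ^ j" for j L
  proof -
    have "(\<Sum>n\<in>{K j..<L}. (cmod (a n))\<^sup>2) \<le> (\<Sum>n\<in>{K0 j..<L}. (cmod (a n))\<^sup>2)"
      using Kge[of j] by (intro sum_mono2) auto
    then show ?thesis using K0[of j L] by linarith
  qed
  have blk: "norm2_sq (sine_sum k a ({..<L} - {..<K j})) \<le> 2 * (1/8) ^ j" for j L
  proof -
    have "{..<L} - {..<K j} = {K j..<L}" by auto
    then have "norm2_sq (sine_sum k a ({..<L} - {..<K j})) = pi / 2 * (\<Sum>n\<in>{K j..<L}. (cmod (a n))\<^sup>2)"
      using norm2_sq_sine_sum[OF inj pos, of "{K j..<L}" a] by simp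
    also have "\<dots> \<le> 2 * (1/8) ^ j"
      using tail[of j L] pi_less_4 by (intro mult_mono) (auto intro!: sum_nonneg)
    finally show ?thesis .
  qed
  define f where "f j = sine_sum k a ({..<K (Suc j)} - {..<K j})" for j
  obtain g0 C where g0: "L2_fun g0" and C: "\<And>J. norm2_sq (\<lambda>t. g0 t - (\<Sum>j<J. f j t)) \<le> C * (1/2) ^ J"
    using L2_series_limit[of f] blk L2_fun_sine_sum unfolding f_def by blast
  have sumf: "(\<Sum>j<J. f j t) = sine_sum k a {..<K J} t - sine_sum k a {..<K 0} t" for J t
  proof (induction J)
    case (Suc J)
    have "f J t = sine_sum k a {..<K (Suc J)} t - sine_sum k a {..<K J} t"
      unfolding f_def using Kmono[of J] by (intro sine_sum_diff[symmetric]) auto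
    then show ?case using Suc by simp
  qed simp
  \<comment> \<open>The blocks start at \<open>K 0\<close>; the terms before it are added
    back.\<close>
  define g where "g t = g0 t + sine_sum k a {..<K 0} t" for t
  have Lg: "L2_fun g" unfolding g_def by (intro L2_fun_add g0 L2_fun_sine_sum)
  have lim: "norm2_sq (\<lambda>t. g t - sine_sum k a {..<K J} t) \<le> C * (1/2) ^ J" for J
    using C[of J] by (simp add: sumf g_def algebra_simps)
  have bound: "norm2_sq (\<lambda>t. g t - sine_sum k a {..<L} t) \<le> (2 * C + 4) * (1/2) ^ J" if L: "L \<ge> K J" for L J
  proof -
    have "norm2_sq (\<lambda>t. (sine_sum k a {..<K J} t - sine_sum k a {..<L} t)) = norm2_sq (sine_sum k a ({..<L} - {..<K J}))"
      using sine_sum_diff[of "{..<L}" "{..<K J}" a] L by (simp add: norm2_sq_minus[of "sine_sum k a {..<K J}"])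
    then have 1: "norm2_sq (\<lambda>t. (sine_sum k a {..<K J} t - sine_sum k a {..<L} t)) \<le> 2 * (1/2) ^ J"
      using blk[of L J] power_mono[of "1/8::real" "1/2" J] by simp
    have "norm2_sq (\<lambda>t. g t - sine_sum k a {..<L} t)
      = norm2_sq (\<lambda>t. (g t - sine_sum k a {..<K J} t) + (sine_sum k a {..<K J} t - sine_sum k a {..<L} t))" by simp
    also have "\<dots> \<le> 2 * norm2_sq (\<lambda>t. g t - sine_sum k a {..<K J} t)
        + 2 * norm2_sq (\<lambda>t. sine_sum k a {..<K J} t - sine_sum k a {..<L} t)"
      by (intro norm2_sq_add_le L2_fun_diff Lg L2_fun_sine_sum)
    also have "\<dots> \<le> 2 * (C * (1/2) ^ J) + 2 * (2 * (1/2) ^ J)"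
      using lim[of J] 1 by linarith
    finally show ?thesis by (simp add: algebra_simps)
  qed
  have "(\<lambda>L. norm2_sq (\<lambda>t. g t - sine_sum k a {..<L} t)) \<longlonglongrightarrow> 0"
  proof (rule LIMSEQ_I)
    fix r :: real assume r: "r > 0"
    have "(\<lambda>J. (2 * C + 4) * (1/2::real) ^ J) \<longlonglongrightarrow> (2 * C + 4) * 0"
      by (intro tendsto_intros LIMSEQ_power_zero) auto
    then have "\<forall>\<^sub>F J in sequentially. (2 * C + 4) * (1/2::real) ^ J < r"
      using r by (auto dest: order_tendstoD(2))
    then obtain J where "(2 * C + 4) * (1/2::real) ^ J < r" by (auto simp: eventually_sequentially)
    then show "\<exists>no. \<forall>n\<ge>no. norm (norm2_sq (\<lambda>t. g t - sine_sum k a {..<n} t) - 0) < r"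
      using bound norm2_sq_nonneg by (intro exI[of _ "K J"]) (auto intro: le_less_trans)
  qed
  then show ?thesis using Lg by blast
qed

text \<open>The limit is determined only up to null sets. A fixed choice makes the perturbed
  potential a function of its coefficients, and all later facts about it concern norms and
  integrals.\<close>

definition sine_series :: "(nat \<Rightarrow> complex) \<Rightarrow> real \<Rightarrow> complex" where
  "sine_series a = (SOME g. L2_fun g \<and> (\<lambda>K. norm2_sq (\<lambda>t. g t - sine_sum k a {..<K} t)) \<longlonglongrightarrow> 0)"

lemma sine_series:
  assumes "summable (\<lambda>n. (cmod (a n))\<^sup>2)"
  shows "L2_fun (sine_series a)"
    and "(\<lambda>K. norm2_sq (\<lambda>t. sine_series a t - sine_sum k a {..<K} t)) \<longlonglongrightarrow> 0"
  using someI_ex[OF riesz_fischer_limit[OF assms]] unfolding sine_series_def by auto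

text \<open>The coefficient functional is continuous in the norm, and on the partial sums it is
  constant as soon as K > m.\<close>

lemma sine_coeff_sine_series:
  assumes a: "summable (\<lambda>n. (cmod (a n))\<^sup>2)"
  shows "sine_coeff (k m) (sine_series a) = of_real (pi / 2) * a m"
proof -
  note S = sine_series[OF a]
  have "norm (sine_coeff (k m) (sine_series a) - of_real (pi / 2) * a m)
      \<le> sqrt (pi * norm2_sq (\<lambda>t. sine_series a t - sine_sum k a {..<K} t))" if "K > m" for K
  proof -
    have "sine_coeff (k m) (sine_series a) - of_real (pi / 2) * a m
        = sine_coeff (k m) (\<lambda>t. sine_series a t - sine_sum k a {..<K} t)"
      using that sine_coeff_sine_sum[OF inj pos, of "{..<K}" m a] by (simp add: sine_coeff_diff S L2_fun_sine_sum)
    also have "norm \<dots> \<le> L1_norm (\<lambda>t. sine_series a t - sine_sum k a {..<K} t)"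
      by (intro sine_coeff_le_L1 L2_fun_imp_absolutely_integrable L2_fun_diff S L2_fun_sine_sum)
    also have "\<dots> \<le> sqrt (pi * norm2_sq (\<lambda>t. sine_series a t - sine_sum k a {..<K} t))"
      by (intro L1_norm_le_norm2 L2_fun_diff S L2_fun_sine_sum)
    finally show ?thesis .
  qed
  then have ev: "\<forall>\<^sub>F K in sequentially. norm (sine_coeff (k m) (sine_series a) - of_real (pi / 2) * a m)
      \<le> sqrt (pi * norm2_sq (\<lambda>t. sine_series a t - sine_sum k a {..<K} t))"
    by (auto simp: eventually_sequentially intro!: exI[of _ "Suc m"])
  have "(\<lambda>K. sqrt (pi * norm2_sq (\<lambda>t. sine_series a t - sine_sum k a {..<K} t))) \<longlonglongrightarrow> sqrt (pi * 0)"
    by (intro tendsto_intros S)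
  from tendsto_lowerbound[OF this ev] show ?thesis by simp
qed

text \<open>The constant is \<pi> instead of the sharp \<pi>/2 because
  \<open>norm2_sq_add_le\<close> loses a factor 2.\<close>

lemma norm2_sq_sine_series_diff:
  assumes a: "summable (\<lambda>n. (cmod (a n))\<^sup>2)" and b: "summable (\<lambda>n. (cmod (b n))\<^sup>2)"
    and B: "\<And>K. (\<Sum>n<K. (cmod (a n - b n))\<^sup>2) \<le> B"
  shows "norm2_sq (\<lambda>t. sine_series a t - sine_series b t) \<le> pi * B"
proof -
  note A = sine_series[OF a] and S = sine_series[OF b]
  have "norm2_sq (\<lambda>t. sine_series a t - sine_series b t)
     \<le> 2 * (2 * norm2_sq (\<lambda>t. sine_series a t - sine_sum k a {..<K} t)
         + 2 * norm2_sq (\<lambda>t. sine_series b t - sine_sum k b {..<K} t)) + 2 * (pi / 2 * B)" for K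
  proof -
    let ?u = "\<lambda>t. sine_series a t - sine_sum k a {..<K} t" and ?v = "\<lambda>t. sine_sum k b {..<K} t - sine_series b t"
    have uv: "L2_fun ?u" "L2_fun ?v" by (intro L2_fun_diff A S L2_fun_sine_sum)+
    have split: "(\<lambda>t. sine_series a t - sine_series b t) = (\<lambda>t. (?u t + ?v t) + sine_sum k (\<lambda>n. a n - b n) {..<K} t)"
      by (simp add: sine_sum_def sum_subtractf algebra_simps)
    have 1: "norm2_sq (\<lambda>t. sine_series a t - sine_series b t)
        \<le> 2 * norm2_sq (\<lambda>t. ?u t + ?v t) + 2 * norm2_sq (sine_sum k (\<lambda>n. a n - b n) {..<K})"
      unfolding split by (rule norm2_sq_add_le[OF L2_fun_add[OF uv] L2_fun_sine_sum])
    have 2: "norm2_sq (\<lambda>t. ?u t + ?v t) \<le> 2 * norm2_sq ?u + 2 * norm2_sq ?v"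
      by (rule norm2_sq_add_le[OF uv])
    have 3: "norm2_sq ?v = norm2_sq (\<lambda>t. sine_series b t - sine_sum k b {..<K} t)" by (rule norm2_sq_minus)
    have 4: "norm2_sq (sine_sum k (\<lambda>n. a n - b n) {..<K}) \<le> pi / 2 * B"
      unfolding norm2_sq_sine_sum[OF inj pos finite_lessThan] by (intro mult_left_mono B) auto
    have "2 * norm2_sq (sine_sum k (\<lambda>n. a n - b n) {..<K}) \<le> 2 * (pi / 2 * B)"
      using 4 by (rule mult_left_mono) simp
    with 1 have "norm2_sq (\<lambda>t. sine_series a t - sine_series b t) \<le> 2 * norm2_sq (\<lambda>t. ?u t + ?v t) + 2 * (pi / 2 * B)"
      by (meson add_left_mono order_trans)
    also have "2 * norm2_sq (\<lambda>t. ?u t + ?v t) \<le> 2 * (2 * norm2_sq ?u + 2 * norm2_sq ?v)"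
      using 2 by (rule mult_left_mono) simp
    finally show ?thesis unfolding 3 by simp
  qed
  moreover have "(\<lambda>K. 2 * (2 * norm2_sq (\<lambda>t. sine_series a t - sine_sum k a {..<K} t)
         + 2 * norm2_sq (\<lambda>t. sine_series b t - sine_sum k b {..<K} t)) + 2 * (pi / 2 * B)) \<longlonglongrightarrow>
      2 * (2 * 0 + 2 * 0) + 2 * (pi / 2 * B)"
    by (intro tendsto_intros A S)
  ultimately have "norm2_sq (\<lambda>t. sine_series a t - sine_series b t) \<le> 2 * (2 * 0 + 2 * 0) + 2 * (pi / 2 * B)"
    by (intro tendsto_lowerbound[of _ _ sequentially]) auto
  then show ?thesis by simp
qed

end

section \<open>Double zeros as a fixed point\<close>

text \<open>Banach's fixed point theorem on the unit ball of bounded sequences. The iterates of 0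
  stay in the ball since 1/2 + 1/2 = 1. Their convergence is uniform in n, as \<open>lip\<close>
  demands, because each component of \<open>T x\<close> may depend on the whole sequence.\<close>

lemma bounded_sequence_fixpoint:
  fixes T :: "(nat \<Rightarrow> 'a::banach) \<Rightarrow> nat \<Rightarrow> 'a"
  assumes zero: "\<And>n. norm (T (\<lambda>_. 0) n) \<le> 1/2"
    and lip: "\<And>x y D n. \<lbrakk>\<And>m. norm (x m) \<le> 1; \<And>m. norm (y m) \<le> 1; \<And>m. norm (x m - y m) \<le> D\<rbrakk>
      \<Longrightarrow> norm (T x n - T y n) \<le> D / 2"
  shows "\<exists>x. (\<forall>n. norm (x n) \<le> 1) \<and> T x = x"
proof -
  define X where "X j = (T ^^ j) (\<lambda>_. 0)" for j
  have X_Suc: "X (Suc j) = T (X j)" for j by (simp add: X_def)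
  have X1: "norm (X j n) \<le> 1" for j n
  proof (induction j arbitrary: n)
    case (Suc j)
    have "norm (T (X j) n - T (\<lambda>_. 0) n) \<le> 1 / 2" by (rule lip) (use Suc in auto)
    then show ?case
      using zero[of n] norm_triangle_sub[of "T (X j) n" "T (\<lambda>_. 0) n"] unfolding X_Suc by linarith
  qed (simp add: X_def)
  have step: "norm (X (Suc j) n - X j n) \<le> (1/2) ^ j" for j n
  proof (induction j arbitrary: n)
    case 0
    then show ?case using X1[of "Suc 0" n] by (simp add: X_def)
  next
    case (Suc j)
    have "norm (T (X (Suc j)) n - T (X j) n) \<le> (1/2) ^ j / 2" by (rule lip[OF X1 X1 Suc.IH])
    then show ?case by (simp add: X_Suc)
  qed
  have sm: "summable (\<lambda>j. X (Suc j) n - X j n)" for n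
    by (rule summable_comparison_test'[of "\<lambda>j. (1/2::real) ^ j" 0]) (simp_all add: step summable_geometric)
  define x where "x n = (\<Sum>j. X (Suc j) n - X j n)" for n
  have part: "(\<Sum>i<j. X (Suc i) n - X i n) = X j n" for j n
    using sum_lessThan_telescope[of "\<lambda>j. X j n" j] by (simp add: X_def)
  have lim: "(\<lambda>j. X j n) \<longlonglongrightarrow> x n" for n
    using summable_LIMSEQ[OF sm[of n]] unfolding part x_def .
  have x1: "norm (x n) \<le> 1" for n
    by (rule tendsto_upperbound[OF tendsto_norm[OF lim[of n]]]) (auto simp: X1)
  have tail: "norm (x n - X j n) \<le> 2 * (1/2) ^ j" for j n
  proof -
    have "x n = (\<Sum>i. X (Suc (i + j)) n - X (i + j) n) + X j n"
      unfolding x_def using suminf_split_initial_segment[OF sm[of n], of j] part[of n j] by simp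
    moreover have "norm (\<Sum>i. X (Suc (i + j)) n - X (i + j) n) \<le> (\<Sum>i. (1/2) ^ j * (1/2) ^ i)"
    proof (rule norm_suminf_le)
      show "norm (X (Suc (i + j)) n - X (i + j) n) \<le> (1/2) ^ j * (1/2) ^ i" for i
        using step[of "i + j" n] by (simp only: power_add mult.commute)
    qed (intro summable_mult summable_geometric, simp)
    moreover have "(\<Sum>i. (1/2) ^ j * (1/2::real) ^ i) = 2 * (1/2) ^ j"
      by (subst suminf_mult) (auto simp: suminf_geometric)
    ultimately show ?thesis by simp
  qed
  have "T x n = x n" for n
  proof (rule LIMSEQ_unique)
    show "(\<lambda>j. X (Suc j) n) \<longlonglongrightarrow> x n" using lim[of n] by (rule LIMSEQ_Suc)
    have "(\<lambda>j. norm (T x n - T (X j) n)) \<longlonglongrightarrow> 0"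
    proof (rule tendsto_sandwich[OF _ _ tendsto_const])
      show "\<forall>\<^sub>F j in sequentially. norm (T x n - T (X j) n) \<le> 2 * (1/2) ^ j / 2"
        by (intro always_eventually allI lip x1 X1 tail)
      show "(\<lambda>j. 2 * (1/2) ^ j / 2 :: real) \<longlonglongrightarrow> 0"
        by (simp add: LIMSEQ_power_zero)
    qed simp
    then have "(\<lambda>j. T x n - T (X j) n) \<longlonglongrightarrow> 0" by (rule tendsto_norm_zero_cancel)
    from tendsto_diff[OF tendsto_const[of "T x n"] this] show "(\<lambda>j. X (Suc j) n) \<longlonglongrightarrow> T x n"
      by (simp add: X_Suc)
  qed
  then show ?thesis using x1 by blast
qed

section \<open>Cauchy estimates on the unit disc and elementary bounds for sine and cosine\<close>

lemma deriv_bound_ball: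
  assumes "f holomorphic_on ball 0 1" "\<And>z. z \<in> ball 0 1 \<Longrightarrow> norm (f z) \<le> C" "norm w \<le> 1/2"
  shows "norm (deriv f w) \<le> 4 * C"
proof -
  have sub: "cball w (1/4) \<subseteq> ball 0 1"
  proof
    fix z assume "z \<in> cball w (1/4)"
    then show "z \<in> ball 0 1" using assms(3) norm_triangle_ineq[of w "z - w"]
      by (auto simp: dist_norm norm_minus_commute)
  qed
  have "norm ((deriv ^^ 1) f w) \<le> fact 1 * C / (1/4) ^ 1"
  proof (rule Cauchy_inequality)
    show "f holomorphic_on ball w (1/4)" using assms(1) sub by (meson ball_subset_cball holomorphic_on_subset order_trans)
    show "continuous_on (cball w (1/4)) f" using assms(1) sub holomorphic_on_imp_continuous_on holomorphic_on_subset by blast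
    fix z assume "norm (w - z) = 1/4"
    then have "z \<in> cball w (1/4)" by (simp add: dist_norm)
    then show "norm (f z) \<le> C" using sub assms(2) by blast
  qed simp
  then show ?thesis by simp
qed

text \<open>Cauchy's inequality twice, on discs of radius 1/4: from |w| \<le> 1/4 to the derivative
  on |z| \<le> 1/2, and from there to f on |z| \<le> 3/4.\<close>

lemma second_deriv_bound_ball:
  assumes f: "f holomorphic_on ball 0 1" and C: "\<And>z. z \<in> ball 0 1 \<Longrightarrow> norm (f z) \<le> C" and w: "norm w \<le> 1/4"
  shows "norm (deriv (deriv f) w) \<le> 16 * C"
proof -
  have sub: "cball w (1/4) \<subseteq> cball 0 (1/2)"
  proof
    fix z assume "z \<in> cball w (1/4)"
    then show "z \<in> cball 0 (1/2)" using w norm_triangle_ineq[of w "z - w"]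
      by (auto simp: dist_norm norm_minus_commute)
  qed
  have sub1: "cball w (1/4) \<subseteq> ball 0 1" using sub by fastforce
  have hd: "deriv f holomorphic_on ball 0 1" using f by (intro holomorphic_deriv) auto
  have "norm ((deriv ^^ 1) (deriv f) w) \<le> fact 1 * (4 * C) / (1/4) ^ 1"
  proof (rule Cauchy_inequality)
    show "deriv f holomorphic_on ball w (1/4)" using hd sub1 by (meson ball_subset_cball holomorphic_on_subset order_trans)
    show "continuous_on (cball w (1/4)) (deriv f)" using hd sub1 holomorphic_on_imp_continuous_on holomorphic_on_subset by blast
    fix z assume "norm (w - z) = 1/4"
    then have "z \<in> cball w (1/4)" by (simp add: dist_norm)
    then have "norm z \<le> 1/2" using sub by auto
    then show "norm (deriv f z) \<le> 4 * C" by (intro deriv_bound_ball[OF f C])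
  qed simp
  then show ?thesis by simp
qed

lemma holomorphic_lipschitz:
  assumes f: "f holomorphic_on ball 0 1" and r: "r < 1"
    and B: "\<And>z. norm z \<le> r \<Longrightarrow> norm (deriv f z) \<le> B" and xy: "norm x \<le> r" "norm y \<le> r"
  shows "norm (f x - f y) \<le> B * norm (x - y)"
proof (rule field_differentiable_bound[of "cball 0 r" f "deriv f"])
  fix z :: complex assume "z \<in> cball 0 r"
  then have z: "norm z \<le> r" by simp
  then show "norm (deriv f z) \<le> B" by (rule B)
  have "z \<in> ball 0 1" using z r by simp
  then have "(f has_field_derivative deriv f z) (at z)" using f by (auto intro: holomorphic_derivI)
  then show "(f has_field_derivative deriv f z) (at z within cball 0 r)" by (rule has_field_derivative_at_within)
qed (use xy in auto)

lemma trig_lipschitz: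
  fixes x y :: complex
  assumes "norm x \<le> 1" "norm y \<le> 1"
  shows "norm (cos (pi * x) - cos (pi * y)) \<le> pi * exp pi * norm (x - y)"
    and "norm (sin (pi * x) - sin (pi * y)) \<le> pi * exp pi * norm (x - y)"
proof -
  have b: "norm (cos (pi * z)) \<le> exp pi" "norm (sin (pi * z)) \<le> exp pi" if "z \<in> cball 0 1" for z :: complex
  proof -
    have "\<bar>Im z\<bar> \<le> 1" using that abs_Im_le_cmod[of z] by simp
    then have "\<bar>Im (pi * z)\<bar> \<le> pi" by (simp add: abs_mult)
    then have "exp \<bar>Im (pi * z)\<bar> \<le> exp pi" by simp
    then show "norm (cos (pi * z)) \<le> exp pi" "norm (sin (pi * z)) \<le> exp pi"
      using norm_sin_cos_le_exp[of "pi * z"] by linarith+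
  qed
  show "norm (cos (pi * x) - cos (pi * y)) \<le> pi * exp pi * norm (x - y)"
    by (rule field_differentiable_bound[where S = "cball 0 1" and f' = "\<lambda>z. - (of_real pi * sin (of_real pi * z))" and f = "\<lambda>z. cos (of_real pi * z)"])
      (use assms b in \<open>auto intro!: derivative_eq_intros simp: norm_mult\<close>)
  show "norm (sin (pi * x) - sin (pi * y)) \<le> pi * exp pi * norm (x - y)"
    by (rule field_differentiable_bound[where S = "cball 0 1" and f' = "\<lambda>z. of_real pi * cos (of_real pi * z)" and f = "\<lambda>z. sin (of_real pi * z)"])
      (use assms b in \<open>auto intro!: derivative_eq_intros simp: norm_mult\<close>)
qed

lemma trig_small:
  fixes x :: complex
  assumes "norm x \<le> 1"
  shows "norm (cos (pi * x) - 1) \<le> pi * exp pi * norm x" and "norm (sin (pi * x)) \<le> pi * exp pi * norm x"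
    and "norm (cos (pi * x)) \<le> exp pi" "norm (sin (pi * x)) \<le> exp pi"
proof -
  show "norm (cos (pi * x) - 1) \<le> pi * exp pi * norm x" "norm (sin (pi * x)) \<le> pi * exp pi * norm x"
    using trig_lipschitz[OF assms, of 0] by auto
  have "\<bar>Im x\<bar> \<le> 1" using assms abs_Im_le_cmod[of x] by simp
  then have "exp \<bar>Im (pi * x)\<bar> \<le> exp pi" by (simp add: abs_mult)
  then show "norm (cos (pi * x)) \<le> exp pi" "norm (sin (pi * x)) \<le> exp pi"
    using norm_sin_cos_le_exp[of "pi * x"] by linarith+
qed

text \<open>
  Here \<open>1 / \<rho>\<^sup>8 = k\<close>, and \<open>P\<close> is the remainder of \<open>(-1)\<^sup>k \<mu> \<Delta>(\<mu>)\<close> at \<open>\<mu> = k + z\<close>. A double zero at \<open>z\<close>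
  means that \<open>root_deriv\<close> vanishes at \<open>z\<close> and that \<open>root_fun\<close> equals there \<open>\<beta>\<close> times the integral of
  \<open>q(t) sin 2kt\<close>. The unknowns are rescaled: \<open>z = \<rho>\<^sup>7 d\<close>, and the integral is \<open>(\<pi>/2) \<rho>\<^sup>5 b\<close>. Since the
  derivative of \<open>root_deriv\<close> is close to \<open>- \<pi>\<^sup>2 k\<close>, \<open>newton_map\<close> is a simplified Newton step for \<open>d\<close>, while
  \<open>coeff_map\<close> solves for \<open>b\<close>. The exponents 7 and 5 are such that both maps gain a factor \<open>\<rho>\<close> and
  \<open>\<rho>\<^sup>5 = k powr (-5/8)\<close> is still square summable over \<open>k\<close>.
\<close>

definition root_fun :: "real \<Rightarrow> (complex \<Rightarrow> complex) \<Rightarrow> complex \<Rightarrow> complex" where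
  "root_fun \<rho> P z = (of_real (1 / \<rho> ^ 8) + z) * (cos (of_real pi * z) - 1) + P z"

definition root_deriv :: "real \<Rightarrow> (complex \<Rightarrow> complex) \<Rightarrow> complex \<Rightarrow> complex" where
  "root_deriv \<rho> P z = (cos (of_real pi * z) - 1) - of_real pi * (of_real (1 / \<rho> ^ 8) + z) * sin (of_real pi * z) + deriv P z"

definition newton_map :: "real \<Rightarrow> (complex \<Rightarrow> complex) \<Rightarrow> complex \<Rightarrow> complex" where
  "newton_map \<rho> P d = (of_real (\<rho> ^ 7) * d + of_real (\<rho> ^ 8 / pi\<^sup>2) * root_deriv \<rho> P (of_real (\<rho> ^ 7) * d)) / of_real (\<rho> ^ 7)"

definition coeff_map :: "complex \<Rightarrow> real \<Rightarrow> (complex \<Rightarrow> complex) \<Rightarrow> complex \<Rightarrow> complex" where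
  "coeff_map \<beta> \<rho> P d = 2 / (of_real pi * \<beta>) * root_fun \<rho> P (of_real (\<rho> ^ 7) * d) / of_real (\<rho> ^ 5)"

lemma root_fun_has_derivative:
  assumes "P holomorphic_on ball 0 1" "norm z < 1"
  shows "(root_fun \<rho> P has_field_derivative root_deriv \<rho> P z) (at z)"
proof -
  have "(P has_field_derivative deriv P z) (at z)"
    using assms by (intro holomorphic_derivI[of P "ball 0 1"]) auto
  then have "((\<lambda>z. (k + z) * (cos (of_real pi * z) - 1) + P z) has_field_derivative
      (cos (of_real pi * z) - 1) - of_real pi * (k + z) * sin (of_real pi * z) + deriv P z) (at z)" for k
    by (auto intro!: derivative_eq_intros simp: algebra_simps)
  then show ?thesis unfolding root_fun_def[abs_def] root_deriv_def .
qed

lemma pi_bounds: "pi\<^sup>2 \<le> 10.2" "pi\<^sup>2 \<ge> 9" "pi \<ge> 3"  "pi \<le> 3.2"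
proof -
  have "pi \<le> 3.16" "pi \<ge> 3" using pi_approx by simp_all
  then show "pi \<ge> 3"  "pi \<le> 3.2" by auto
  have "pi * pi \<le> 3.16 * 3.16" "3 * 3 \<le> pi * pi"
    using \<open>pi \<le> 3.16\<close> \<open>pi \<ge> 3\<close> by (intro mult_mono; simp)+
  then show "pi\<^sup>2 \<le> 10.2" "pi\<^sup>2 \<ge> 9" by (simp_all add: power2_eq_square)
qed

context
  fixes \<rho> C :: real
  assumes \<rho>: "0 < \<rho>" "\<rho> \<le> 1/2" and C: "C > 0"
begin

lemma rho_powers: "\<rho> ^ 7 \<le> \<rho>" "\<rho> ^ 7 \<le> 1/4" "\<rho> ^ 8 \<le> \<rho> ^ 7" "\<rho> ^ 7 > 0" "1 / \<rho> ^ 8 \<ge> 1" "\<rho> ^ 2 \<le> \<rho>"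
proof -
  have m: "\<rho> ^ n \<le> \<rho> ^ m" if "m \<le> n" for m n
    using \<rho> that by (intro power_decreasing) auto
  show "\<rho> ^ 7 \<le> \<rho>" "\<rho> ^ 8 \<le> \<rho> ^ 7" "\<rho> ^ 2 \<le> \<rho>" using m[of 1 7] m[of 7 8] m[of 1 2] by auto
  have "\<rho> ^ 2 \<le> (1/2) ^ 2" using \<rho> by (intro power_mono) auto
  then show "\<rho> ^ 7 \<le> 1/4" using m[of 2 7] by (simp add: power2_eq_square)
  show "\<rho> ^ 7 > 0" using \<rho> by simp
  show "1 / \<rho> ^ 8 \<ge> 1" using \<rho> m[of 0 8] by simp
qed

text \<open>F is the part of the Newton step, before rescaling, that is free of the remainder. The
  factor \<rho>^8 turns the large term of \<open>root_deriv\<close> into -sin(\<pi>z)/\<pi>, which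
  cancels z to first order, so the derivative of F is O(\<rho>^7) on the disc.\<close>

lemma newton_trig_lipschitz:
  assumes xy: "norm x \<le> \<rho> ^ 7" "norm y \<le> \<rho> ^ 7"
  defines "F \<equiv> (\<lambda>z::complex. z - sin (of_real pi * z) / of_real pi
      + of_real (\<rho> ^ 8 / pi\<^sup>2) * ((cos (of_real pi * z) - 1) - of_real pi * z * sin (of_real pi * z)))"
  shows "norm (F x - F y) \<le> 6 * exp pi * \<rho> ^ 7 * norm (x - y)"
proof (rule field_differentiable_bound[where S = "cball 0 (\<rho> ^ 7)"
      and f' = "\<lambda>z. 1 - cos (of_real pi * z)
        + of_real (\<rho> ^ 8 / pi\<^sup>2) * (- (2 * of_real pi * sin (of_real pi * z)) - of_real pi * of_real pi * z * cos (of_real pi * z))"])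
  fix z :: complex assume "z \<in> cball 0 (\<rho> ^ 7)"
  then have z: "norm z \<le> \<rho> ^ 7" by simp
  then have z1: "norm z \<le> 1" using rho_powers(2) by linarith
  note T = trig_small[OF z1]
  let ?h = "- (2 * of_real pi * sin (of_real pi * z)) - of_real pi * of_real pi * z * cos (of_real pi * z)"
  let ?g = "of_real (\<rho> ^ 8 / pi\<^sup>2) * (?h)"
  show "(F has_field_derivative 1 - cos (of_real pi * z) + ?g)
      (at z within cball 0 (\<rho> ^ 7))"
    unfolding F_def by (rule derivative_eq_intros refl | simp add: field_simps)+
  have "norm (1 - cos (of_real pi * z)) \<le> pi * exp pi * \<rho> ^ 7"
    unfolding norm_minus_commute[of 1] by (rule order_trans[OF T(1)]) (intro mult_left_mono z, simp)
  moreover have "norm (?g)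
     \<le> \<rho> ^ 7 * (2 * exp pi)"
  proof -
    have a: "norm (?h)
       \<le> 2 * pi * exp pi + pi\<^sup>2 * exp pi"
    proof (rule order_trans[OF norm_triangle_ineq4 add_mono])
      show "norm (- (2 * of_real pi * sin (of_real pi * z))) \<le> 2 * pi * exp pi"
        using T(4) by (simp add: norm_mult)
      have "norm z * norm (cos (of_real pi * z)) \<le> 1 * exp pi" using z1 T(3) by (intro mult_mono) auto
      then have "(pi * pi) * (norm z * norm (cos (of_real pi * z))) \<le> (pi * pi) * (1 * exp pi)" by (intro mult_left_mono) auto
      then show "norm (of_real pi * of_real pi * z * cos (of_real pi * z)) \<le> pi\<^sup>2 * exp pi"
        by (simp add: norm_mult power2_eq_square mult.assoc)
    qed
    have b: "(2 * pi * exp pi + pi\<^sup>2 * exp pi) / pi\<^sup>2 \<le> 2 * exp pi"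
    proof -
      have "2 * pi \<le> pi\<^sup>2" using pi_bounds by (simp add: power2_eq_square)
      then have "(2 * pi + pi\<^sup>2) * exp pi \<le> (2 * pi\<^sup>2) * exp pi" by (intro mult_right_mono) auto
      then show ?thesis by (simp add: field_simps)
    qed
    have "norm (?g)
      \<le> \<rho> ^ 8 / pi\<^sup>2 * (2 * pi * exp pi + pi\<^sup>2 * exp pi)"
      unfolding norm_mult norm_of_real using a \<rho> by (intro mult_mono) auto
    also have "\<dots> = \<rho> ^ 8 * ((2 * pi * exp pi + pi\<^sup>2 * exp pi) / pi\<^sup>2)" by simp
    also have "\<dots> \<le> \<rho> ^ 7 * (2 * exp pi)"
      using b rho_powers \<rho> by (intro mult_mono) auto
    finally show ?thesis .
  qed
  ultimately have "norm (1 - cos (of_real pi * z) + ?g)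
     \<le> (pi + 2) * (exp pi * \<rho> ^ 7)"
    by (intro order_trans[OF norm_triangle_ineq]) (simp add: algebra_simps)
  also have "\<dots> \<le> 6 * (exp pi * \<rho> ^ 7)" using pi_bounds \<rho> by (intro mult_right_mono) auto
  finally show "norm (1 - cos (of_real pi * z) + ?g)
     \<le> 6 * exp pi * \<rho> ^ 7" by (simp add: mult.assoc)
qed (use xy in auto)

text \<open>The derivative is dominated by \<pi>k sin \<pi>z with k = 1/\<rho>^8, hence of order k
  \<rho>^7; 24 bounds \<pi> + 2 \<pi>^2.\<close>

lemma coeff_trig_lipschitz:
  assumes xy: "norm x \<le> \<rho> ^ 7" "norm y \<le> \<rho> ^ 7"
  defines "F \<equiv> (\<lambda>z::complex. (of_real (1 / \<rho> ^ 8) + z) * (cos (of_real pi * z) - 1))"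
  shows "norm (F x - F y) \<le> 24 * exp pi * (\<rho> ^ 7 / \<rho> ^ 8) * norm (x - y)"
proof (rule field_differentiable_bound[where S = "cball 0 (\<rho> ^ 7)"
      and f' = "\<lambda>z. (cos (of_real pi * z) - 1) - (of_real (1 / \<rho> ^ 8) + z) * (of_real pi * sin (of_real pi * z))"])
  fix z :: complex assume "z \<in> cball 0 (\<rho> ^ 7)"
  then have z: "norm z \<le> \<rho> ^ 7" by simp
  then have z1: "norm z \<le> 1" using rho_powers(2) by linarith
  note T = trig_small[OF z1]
  define k where "k = 1 / \<rho> ^ 8"
  have k: "k \<ge> 1" using rho_powers by (simp add: k_def)
  show "(F has_field_derivative (cos (of_real pi * z) - 1) - (of_real (1 / \<rho> ^ 8) + z) * (of_real pi * sin (of_real pi * z)))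
      (at z within cball 0 (\<rho> ^ 7))"
    unfolding F_def by (rule derivative_eq_intros refl | simp add: field_simps)+
  have 1: "norm (cos (of_real pi * z) - 1) \<le> pi * exp pi * \<rho> ^ 7"
    by (rule order_trans[OF T(1)]) (intro mult_left_mono z, simp)
  have s: "norm (sin (of_real pi * z)) \<le> pi * exp pi * \<rho> ^ 7"
    by (rule order_trans[OF T(2)]) (intro mult_left_mono z, simp)
  have "norm (of_real k + z) \<le> 2 * k" using norm_triangle_ineq[of "of_real k" z] z1 k by simp
  then have "norm ((of_real k + z) * (of_real pi * sin (of_real pi * z))) \<le> (2 * k) * (pi * (pi * exp pi * \<rho> ^ 7))"
    unfolding norm_mult using s k by (intro mult_mono) auto
  then have "norm ((cos (of_real pi * z) - 1) - (of_real k + z) * (of_real pi * sin (of_real pi * z)))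
    \<le> pi * exp pi * \<rho> ^ 7 + (2 * k) * (pi * (pi * exp pi * \<rho> ^ 7))"
    using 1 by (intro order_trans[OF norm_triangle_ineq4]) linarith
  also have "\<dots> \<le> k * (pi * exp pi * \<rho> ^ 7) + (2 * k) * (pi * (pi * exp pi * \<rho> ^ 7))"
    using k \<rho> mult_right_mono[OF k, of "pi * exp pi * \<rho> ^ 7"] by simp
  also have "\<dots> = (pi + 2 * pi\<^sup>2) * (k * (exp pi * \<rho> ^ 7))" by (simp add: algebra_simps power2_eq_square)
  also have "\<dots> \<le> 24 * (k * (exp pi * \<rho> ^ 7))" using pi_bounds k \<rho> by (intro mult_right_mono) auto
  finally show "norm ((cos (of_real pi * z) - 1) - (of_real (1 / \<rho> ^ 8) + z) * (of_real pi * sin (of_real pi * z)))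
    \<le> 24 * exp pi * (\<rho> ^ 7 / \<rho> ^ 8)" by (simp add: k_def mult_ac)
qed (use xy in auto)

text \<open>The remainder enters through its derivative only, with weight \<rho>^8 / \<rho>^7 =
  \<rho>; the trigonometric part contributes \<rho>^7 after rescaling. The two derivatives differ by
  the change of the point, which costs a second derivative, and by the change of the
  remainder.\<close>

lemma newton_map_lipschitz:
  assumes P: "P holomorphic_on ball 0 1" "\<And>z. z \<in> ball 0 1 \<Longrightarrow> norm (P z) \<le> C"
    and Q: "Q holomorphic_on ball 0 1"
    and PQ: "\<And>z. z \<in> ball 0 1 \<Longrightarrow> norm (P z - Q z) \<le> C * D"
    and d: "norm x \<le> 1" "norm y \<le> 1" "norm (x - y) \<le> D"
  shows "norm (newton_map \<rho> P x - newton_map \<rho> Q y) \<le> \<rho> * D * (6 * exp pi + 3 * C)"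
proof -
  define F where "F = (\<lambda>z::complex. z - sin (of_real pi * z) / of_real pi
      + of_real (\<rho> ^ 8 / pi\<^sup>2) * ((cos (of_real pi * z) - 1) - of_real pi * z * sin (of_real pi * z)))"
  define u v where "u = of_real (\<rho> ^ 7) * x" and "v = of_real (\<rho> ^ 7) * y"
  have D0: "D \<ge> 0" using d(3) norm_ge_zero order_trans by blast
  have nuv: "norm u \<le> \<rho> ^ 7" "norm v \<le> \<rho> ^ 7"
    using d(1,2) rho_powers(4) mult_left_mono[of _ 1 "\<rho> ^ 7"] by (auto simp: u_def v_def norm_mult norm_power)
  have duv: "norm (u - v) \<le> \<rho> ^ 7 * D"
    using d(3) \<rho> by (simp add: u_def v_def norm_mult norm_power flip: right_diff_distrib)
  have eq: "newton_map \<rho> R d = (F (of_real (\<rho> ^ 7) * d) + of_real (\<rho> ^ 8 / pi\<^sup>2) * deriv R (of_real (\<rho> ^ 7) * d)) / of_real (\<rho> ^ 7)" for R d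
    unfolding newton_map_def root_deriv_def F_def using \<rho> by (simp add: field_simps power2_eq_square)
  have dP: "norm (deriv P u - deriv P v) \<le> 16 * C * norm (u - v)"
    by (rule holomorphic_lipschitz[where r = "1/4"])
      (use P nuv rho_powers(2) in \<open>auto intro!: second_deriv_bound_ball holomorphic_deriv\<close>)
  also have "\<dots> \<le> 16 * C * (1/4 * D)"
    using duv rho_powers(2) D0 C mult_right_mono[of "\<rho> ^ 7" "1/4" D] by (intro mult_left_mono) auto
  finally have dP: "norm (deriv P u - deriv P v) \<le> 4 * C * D" by simp
  have hv: "norm v < 1" using nuv rho_powers(2) by linarith
  have "deriv (\<lambda>z. P z - Q z) v = deriv P v - deriv Q v"
    using P Q hv by (intro deriv_diff holomorphic_on_imp_differentiable_at[of _ "ball 0 1"]) auto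
  moreover have "norm (deriv (\<lambda>z. P z - Q z) v) \<le> 4 * (C * D)"
    by (rule deriv_bound_ball) (use P Q PQ nuv rho_powers(2) in \<open>auto intro!: holomorphic_intros\<close>)
  ultimately have dQ: "norm (deriv P v - deriv Q v) \<le> 4 * C * D" by simp
  have dPQ: "norm (deriv P u - deriv Q v) \<le> 8 * C * D"
    using norm_triangle_ineq[of "deriv P u - deriv P v" "deriv P v - deriv Q v"] dP dQ by simp
  have lin: "(a + c * s) / r - (b + c * t) / r = ((a - b) + c * (s - t)) / r" for a b c s t r :: complex
    by (simp add: diff_divide_distrib add_divide_distrib right_diff_distrib)
  have "norm (newton_map \<rho> P x - newton_map \<rho> Q y)
     = norm ((F u - F v) + of_real (\<rho> ^ 8 / pi\<^sup>2) * (deriv P u - deriv Q v)) / \<rho> ^ 7"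
    unfolding eq u_def[symmetric] v_def[symmetric] lin norm_divide norm_of_real using \<rho> by simp
  also have "\<dots> \<le> (6 * exp pi * \<rho> ^ 7 * (\<rho> ^ 7 * D) + \<rho> ^ 8 / pi\<^sup>2 * (8 * C * D)) / \<rho> ^ 7"
  proof (intro divide_right_mono order_trans[OF norm_triangle_ineq add_mono])
    show "norm (F u - F v) \<le> 6 * exp pi * \<rho> ^ 7 * (\<rho> ^ 7 * D)"
    proof (rule order_trans)
      show "norm (F u - F v) \<le> 6 * exp pi * \<rho> ^ 7 * norm (u - v)"
        unfolding F_def by (rule newton_trig_lipschitz[OF nuv])
    qed (use duv \<rho> in \<open>intro mult_left_mono, auto\<close>)
    show "norm (of_real (\<rho> ^ 8 / pi\<^sup>2) * (deriv P u - deriv Q v)) \<le> \<rho> ^ 8 / pi\<^sup>2 * (8 * C * D)"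
      unfolding norm_mult norm_of_real using dPQ \<rho> by (intro mult_mono) auto
  qed (use \<rho> in auto)
  also have "\<dots> = 6 * exp pi * D * \<rho> ^ 7 + (8 / pi\<^sup>2) * (C * D * \<rho>)"
    using \<rho> by (simp add: field_simps eval_nat_numeral)
  also have "\<dots> \<le> 6 * exp pi * D * \<rho> + 3 * (C * D * \<rho>)"
  proof (intro add_mono mult_left_mono mult_right_mono)
    have "8 / pi\<^sup>2 \<le> 1" using pi_bounds by (simp add: field_simps)
    then show "8 / pi\<^sup>2 \<le> 3" by linarith
  qed (use \<rho> C D0 rho_powers in auto)
  finally show ?thesis by (simp add: algebra_simps)
qed

text \<open>Division by \<rho>^5 has to leave a factor \<rho>, so the remainders may differ by
  O(\<rho>^6) only. The bound C D on the disc does not give this; the sharper one at 0 does, carried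
  over to |v| \<le> \<rho>^7 by a Cauchy estimate.\<close>

lemma coeff_map_lipschitz:
  assumes P: "P holomorphic_on ball 0 1" "\<And>z. z \<in> ball 0 1 \<Longrightarrow> norm (P z) \<le> C"
    and Q: "Q holomorphic_on ball 0 1"
    and PQ: "\<And>z. z \<in> ball 0 1 \<Longrightarrow> norm (P z - Q z) \<le> C * D" "norm (P 0 - Q 0) \<le> C * D * \<rho> ^ 8"
    and d: "norm x \<le> 1" "norm y \<le> 1" "norm (x - y) \<le> D" and \<beta>: "\<beta> \<noteq> 0"
  shows "norm (coeff_map \<beta> \<rho> P x - coeff_map \<beta> \<rho> Q y) \<le> \<rho> * D * (1 / norm \<beta> * (24 * exp pi + 9 * C))"
proof -
  define F where "F = (\<lambda>z::complex. (of_real (1 / \<rho> ^ 8) + z) * (cos (of_real pi * z) - 1))"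
  define u v where "u = of_real (\<rho> ^ 7) * x" and "v = of_real (\<rho> ^ 7) * y"
  have D0: "D \<ge> 0" using d(3) norm_ge_zero order_trans by blast
  have nuv: "norm u \<le> \<rho> ^ 7" "norm v \<le> \<rho> ^ 7"
    using d(1,2) rho_powers(4) mult_left_mono[of _ 1 "\<rho> ^ 7"] by (auto simp: u_def v_def norm_mult norm_power)
  have duv: "norm (u - v) \<le> \<rho> ^ 7 * D"
    using d(3) \<rho> by (simp add: u_def v_def norm_mult norm_power flip: right_diff_distrib)
  have dP: "norm (P u - P v) \<le> 4 * C * norm (u - v)"
    by (rule holomorphic_lipschitz[where r = "1/4"])
      (use P nuv rho_powers(2) in \<open>auto intro!: deriv_bound_ball\<close>)
  also have "\<dots> \<le> 4 * C * (\<rho> ^ 7 * D)" using duv C by (intro mult_left_mono) auto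
  finally have dP: "norm (P u - P v) \<le> 4 * C * (\<rho> ^ 7 * D)" .
  have hR: "(\<lambda>z. P z - Q z) holomorphic_on ball 0 1" using P Q by (intro holomorphic_intros)
  have "norm ((P v - Q v) - (P 0 - Q 0)) \<le> (4 * (C * D)) * norm (v - 0)"
  proof (rule holomorphic_lipschitz[OF hR])
    show "norm (deriv (\<lambda>z. P z - Q z) z) \<le> 4 * (C * D)" if "norm z \<le> 1/4" for z
      by (rule deriv_bound_ball[OF hR PQ(1)]) (use that in auto)
  qed (use nuv rho_powers(2) in auto)
  also have "\<dots> \<le> (4 * (C * D)) * \<rho> ^ 7" using nuv C D0 by (intro mult_left_mono) auto
  finally have "norm (P v - Q v) \<le> 4 * (C * D) * \<rho> ^ 7 + C * D * \<rho> ^ 8"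
    using PQ(2) norm_triangle_ineq[of "(P v - Q v) - (P 0 - Q 0)" "P 0 - Q 0"] by simp
  moreover have "C * D * \<rho> ^ 8 \<le> C * D * \<rho> ^ 7" using rho_powers C D0 by (intro mult_left_mono) auto
  ultimately have dQ: "norm (P v - Q v) \<le> 5 * (C * D) * \<rho> ^ 7" by linarith
  have dF: "norm (F u - F v) \<le> 24 * exp pi * (\<rho> ^ 7 / \<rho> ^ 8) * (\<rho> ^ 7 * D)"
    using coeff_trig_lipschitz[OF nuv] mult_left_mono[OF duv, of "24 * exp pi * (\<rho> ^ 7 / \<rho> ^ 8)"] \<rho> unfolding F_def by simp
  have rF: "root_fun \<rho> R z = F z + R z" for R z by (simp add: root_fun_def F_def)
  have "norm (root_fun \<rho> P u - root_fun \<rho> Q v) = norm ((F u - F v) + ((P u - P v) + (P v - Q v)))"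
    by (simp add: rF algebra_simps)
  also have "\<dots> \<le> 24 * exp pi * (\<rho> ^ 7 / \<rho> ^ 8) * (\<rho> ^ 7 * D) + (4 * C * (\<rho> ^ 7 * D) + 5 * (C * D) * \<rho> ^ 7)"
    using dF dP dQ by (meson add_mono norm_triangle_le order_trans)
  also have "\<dots> = \<rho> ^ 6 * D * (24 * exp pi) + \<rho> ^ 7 * D * (9 * C)"
    using \<rho> by (simp add: field_simps eval_nat_numeral)
  also have "\<dots> \<le> \<rho> ^ 6 * D * (24 * exp pi) + \<rho> ^ 6 * D * (9 * C)"
    using \<rho> D0 C by (intro add_left_mono mult_right_mono power_decreasing) auto
  finally have R: "norm (root_fun \<rho> P u - root_fun \<rho> Q v) \<le> \<rho> ^ 6 * D * (24 * exp pi + 9 * C)"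
    by (simp add: algebra_simps)
  have "coeff_map \<beta> \<rho> P x - coeff_map \<beta> \<rho> Q y
      = 2 / (of_real pi * \<beta>) * (root_fun \<rho> P u - root_fun \<rho> Q v) / of_real (\<rho> ^ 5)"
    by (simp add: coeff_map_def u_def v_def right_diff_distrib diff_divide_distrib)
  then have "norm (coeff_map \<beta> \<rho> P x - coeff_map \<beta> \<rho> Q y)
      = norm (2 / (of_real pi * \<beta>)) * norm (root_fun \<rho> P u - root_fun \<rho> Q v) / norm (complex_of_real (\<rho> ^ 5))"
    by (simp only: norm_mult norm_divide)
  also have "\<dots> = 2 / pi * (1 / norm \<beta>) * norm (root_fun \<rho> P u - root_fun \<rho> Q v) / \<rho> ^ 5"
    unfolding norm_of_real using \<rho> by (simp add: norm_mult norm_divide)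
  also have "\<dots> \<le> 1 * (1 / norm \<beta>) * (\<rho> ^ 6 * D * (24 * exp pi + 9 * C)) / \<rho> ^ 5"
    using R pi_bounds \<rho> C D0 by (intro divide_right_mono mult_mono) auto
  also have "\<dots> = (\<rho> ^ 6 / \<rho> ^ 5) * D * (1 / norm \<beta> * (24 * exp pi + 9 * C))" by simp
  also have "\<rho> ^ 6 / \<rho> ^ 5 = \<rho>" using \<rho> by (simp add: eval_nat_numeral)
  finally show ?thesis .
qed

text \<open>Comparison with the zero remainder at D = 1, for which both maps send 0 to 0.\<close>

lemma maps_at_zero:
  assumes P: "P holomorphic_on ball 0 1" "\<And>z. z \<in> ball 0 1 \<Longrightarrow> norm (P z) \<le> C"
    "norm (P 0) \<le> C * \<rho> ^ 8" and \<beta>: "\<beta> \<noteq> 0"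
  shows "norm (newton_map \<rho> P 0) \<le> \<rho> * (6 * exp pi + 3 * C)"
    and "norm (coeff_map \<beta> \<rho> P 0) \<le> \<rho> * (1 / norm \<beta> * (24 * exp pi + 9 * C))"
proof -
  have n0: "newton_map \<rho> (\<lambda>_. 0) 0 = 0" and c0: "coeff_map \<beta> \<rho> (\<lambda>_. 0) 0 = 0"
    by (simp_all add: newton_map_def root_deriv_def coeff_map_def root_fun_def)
  show "norm (newton_map \<rho> P 0) \<le> \<rho> * (6 * exp pi + 3 * C)"
    using newton_map_lipschitz[OF P(1,2), of "\<lambda>_. 0" 1 0 0] P(2) n0 by simp
  show "norm (coeff_map \<beta> \<rho> P 0) \<le> \<rho> * (1 / norm \<beta> * (24 * exp pi + 9 * C))"
    using coeff_map_lipschitz[OF P(1,2), of "\<lambda>_. 0" 1 0 0 \<beta>] P(2,3) \<beta> c0 by simp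
qed

end

text \<open>The unknowns are the pairs (d n, b n). A fixed point of \<open>newton_map\<close> is a
  zero of \<open>root_deriv\<close>, and the equation for \<open>coeff_map\<close> prescribes
  \<open>root_fun\<close>. As \<open>P n\<close> takes all of b, the equations are coupled;
  \<open>small\<close> concerns the sum of the two Lipschitz constants, since the norm of a pair is
  at most the sum of the norms.\<close>

lemma double_root_sequence:
  fixes \<rho> :: "nat \<Rightarrow> real" and P :: "nat \<Rightarrow> (nat \<Rightarrow> complex) \<Rightarrow> complex \<Rightarrow> complex"
  assumes \<beta>: "\<beta> \<noteq> 0" and C: "C > 0" and \<rho>: "\<And>n. 0 < \<rho> n" "\<And>n. \<rho> n \<le> 1/2"
    and small: "\<And>n. \<rho> n * ((6 * exp pi + 3 * C) + 1 / norm \<beta> * (24 * exp pi + 9 * C)) \<le> 1/2"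
    and hol: "\<And>n b. (\<And>m. norm (b m) \<le> 1) \<Longrightarrow> P n b holomorphic_on ball 0 1"
    and bd: "\<And>n b z. (\<And>m. norm (b m) \<le> 1) \<Longrightarrow> z \<in> ball 0 1 \<Longrightarrow> norm (P n b z) \<le> C"
    and bd0: "\<And>n b. (\<And>m. norm (b m) \<le> 1) \<Longrightarrow> norm (P n b 0) \<le> C * \<rho> n ^ 8"
    and lip: "\<And>n b b' z D. \<lbrakk>\<And>m. norm (b m) \<le> 1; \<And>m. norm (b' m) \<le> 1; \<And>m. norm (b m - b' m) \<le> D; z \<in> ball 0 1\<rbrakk>
      \<Longrightarrow> norm (P n b z - P n b' z) \<le> C * D"
    and lip0: "\<And>n b b' D. \<lbrakk>\<And>m. norm (b m) \<le> 1; \<And>m. norm (b' m) \<le> 1; \<And>m. norm (b m - b' m) \<le> D\<rbrakk>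
      \<Longrightarrow> norm (P n b 0 - P n b' 0) \<le> C * D * \<rho> n ^ 8"
  shows "\<exists>b w. (\<forall>n. norm (b n) \<le> 1 \<and> norm (w n) \<le> \<rho> n ^ 7
    \<and> root_fun (\<rho> n) (P n b) (w n) = of_real (pi / 2) * \<beta> * of_real (\<rho> n ^ 5) * b n
    \<and> root_deriv (\<rho> n) (P n b) (w n) = 0)"
proof -
  define \<Lambda> where "\<Lambda> = (6 * exp pi + 3 * C) + 1 / norm \<beta> * (24 * exp pi + 9 * C)"
  define T where "T x n = (newton_map (\<rho> n) (P n (\<lambda>m. snd (x m))) (fst (x n)),
      coeff_map \<beta> (\<rho> n) (P n (\<lambda>m. snd (x m))) (fst (x n)))" for x :: "nat \<Rightarrow> complex \<times> complex" and n
  have pr: "norm (fst z) \<le> norm z" "norm (snd z) \<le> norm z" for z :: "complex \<times> complex"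
    by (cases z; simp add: norm_fst_le norm_snd_le)+
  have s1: "norm (snd (x m)) \<le> 1" "norm (fst (x m)) \<le> 1" if "\<And>m. norm (x m) \<le> 1" for x :: "nat \<Rightarrow> complex \<times> complex" and m
    using that[of m] pr[of "x m"] by auto
  have np: "norm z \<le> norm (fst z) + norm (snd z)" for z :: "complex \<times> complex"
    using norm_Pair_le[of "fst z" "snd z"] by simp
  have "\<exists>x. (\<forall>n. norm (x n) \<le> 1) \<and> T x = x"
  proof (rule bounded_sequence_fixpoint)
    fix n
    have z: "norm (snd ((\<lambda>_. 0 :: complex \<times> complex) m)) \<le> 1" for m :: nat by simp
    note H = hol[OF z, of n] bd[OF z, of _ n] bd0[OF z, of n]
    have "norm (T (\<lambda>_. 0) n) \<le> \<rho> n * (6 * exp pi + 3 * C) + \<rho> n * (1 / norm \<beta> * (24 * exp pi + 9 * C))"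
      unfolding T_def using maps_at_zero[OF \<rho> C H(1,2,3) \<beta>]
      by (intro order_trans[OF np add_mono]) auto
    also have "\<dots> = \<rho> n * \<Lambda>" by (simp add: \<Lambda>_def algebra_simps)
    also have "\<dots> \<le> 1/2" unfolding \<Lambda>_def by (rule small)
    finally show "norm (T (\<lambda>_. 0) n) \<le> 1/2" .
  next
    fix x y :: "nat \<Rightarrow> complex \<times> complex" and D n
    assume x: "\<And>m. norm (x m) \<le> 1" and y: "\<And>m. norm (y m) \<le> 1" and D: "\<And>m. norm (x m - y m) \<le> D"
    have D0: "D \<ge> 0" using D[of 0] norm_ge_zero order_trans by blast
    have Df: "norm (fst (x m) - fst (y m)) \<le> D" and Ds: "norm (snd (x m) - snd (y m)) \<le> D" for m
      using D[of m] pr[of "x m - y m"] unfolding fst_diff snd_diff by linarith+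
    note X = s1[of x, OF x] and Y = s1[of y, OF y]
    have "norm (T x n - T y n) \<le> \<rho> n * D * (6 * exp pi + 3 * C) + \<rho> n * D * (1 / norm \<beta> * (24 * exp pi + 9 * C))"
    proof (intro order_trans[OF np add_mono])
      show "norm (fst (T x n - T y n)) \<le> \<rho> n * D * (6 * exp pi + 3 * C)"
        unfolding T_def fst_diff fst_conv
        by (intro newton_map_lipschitz \<rho> C hol bd lip X Y Df Ds)
      show "norm (snd (T x n - T y n)) \<le> \<rho> n * D * (1 / norm \<beta> * (24 * exp pi + 9 * C))"
        unfolding T_def snd_diff snd_conv
        by (intro coeff_map_lipschitz \<rho> C hol bd lip lip0 X Y Df Ds \<beta>)
    qed
    also have "\<dots> = (\<rho> n * \<Lambda>) * D" by (simp add: \<Lambda>_def algebra_simps)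
    also have "\<dots> \<le> 1/2 * D" unfolding \<Lambda>_def by (intro mult_right_mono small D0)
    finally show "norm (T x n - T y n) \<le> D / 2" by simp
  qed
  then obtain x where x: "\<And>n. norm (x n) \<le> 1" and fx: "\<And>n. T x n = x n" by metis
  define b w where "b n = snd (x n)" and "w n = of_real (\<rho> n ^ 7) * fst (x n)" for n
  have "norm (b n) \<le> 1 \<and> norm (w n) \<le> \<rho> n ^ 7
    \<and> root_fun (\<rho> n) (P n b) (w n) = of_real (pi / 2) * \<beta> * of_real (\<rho> n ^ 5) * b n
    \<and> root_deriv (\<rho> n) (P n b) (w n) = 0" for n
  proof -
    have \<rho>0: "complex_of_real (\<rho> n) \<noteq> 0" using \<rho>(1)[of n] by simp
    have N: "newton_map (\<rho> n) (P n b) (fst (x n)) = fst (x n)" and B: "coeff_map \<beta> (\<rho> n) (P n b) (fst (x n)) = b n"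
      using fx[of n] unfolding T_def b_def by (metis fst_conv, metis snd_conv)
    have 1: "root_deriv (\<rho> n) (P n b) (w n) = 0"
      using N \<rho>0 unfolding newton_map_def w_def[symmetric] by (simp add: w_def field_simps)
    have 2: "root_fun (\<rho> n) (P n b) (w n) = of_real (pi / 2) * \<beta> * of_real (\<rho> n ^ 5) * b n"
      using B \<rho>0 \<beta> unfolding coeff_map_def w_def[symmetric] by (simp add: field_simps)
    have "norm (w n) \<le> \<rho> n ^ 7 * 1"
      unfolding w_def norm_mult using s1(2)[of x n, OF x] \<rho>(1)[of n] by (intro mult_mono) (auto simp: norm_power)
    then show ?thesis using 1 2 s1(1)[of x n, OF x] by (simp add: b_def)
  qed
  then show ?thesis by blast
qed

section \<open>Localization of the zeros\<close>

text \<open>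
  Subtracting \<open>- (\<pi>\<^sup>2/2) (z - w)\<^sup>2\<close> from \<open>F\<close> leaves a function with small second derivative, and with
  value and first derivative zero at \<open>w\<close>.
\<close>

lemma double_zero_unique:
  assumes F: "F holomorphic_on ball 0 1" and near: "\<And>z. z \<in> ball 0 1 \<Longrightarrow> norm (F z - (cos (of_real pi * z) - 1)) \<le> 1/32"
    and w: "norm w \<le> 1 / (100 * exp pi)" and z: "norm z \<le> 1 / (100 * exp pi)"
    and zeros: "F w = 0" "deriv F w = 0" "F z = 0"
  shows "z = w"
proof -
  \<comment> \<open>For |u| \<le> r this keeps \<pi>^2 |cos \<pi>u - 1| below 1/2; with 16/32 = 1/2
    from the perturbation, the second derivative of \<open>f\<close> is at most 1.\<close>
  define r where "r = 1 / (100 * exp pi)"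
  have e1: "exp pi \<ge> 1" using pi_gt_zero by simp
  have "4 \<le> 100 * exp pi" using e1 by linarith
  from divide_left_mono[OF this, of 1] have r: "r > 0" "r \<le> 1/4"
    unfolding r_def by simp_all
  define G where "G u = F u - (cos (of_real pi * u) - 1)" for u
  have hG: "G holomorphic_on ball 0 1" unfolding G_def[abs_def] by (intro holomorphic_intros F)
  have hG': "deriv G holomorphic_on ball 0 1" using hG by (intro holomorphic_deriv) auto
  have dG: "(G has_field_derivative deriv G u) (at u)" "(deriv G has_field_derivative deriv (deriv G) u) (at u)"
    if "norm u \<le> r" for u
    using that r hG hG' by (auto intro!: holomorphic_derivI[of _ "ball 0 1"])
  define f f' where "f u = G u + (cos (of_real pi * u) - 1) + of_real (pi\<^sup>2 / 2) * (u - w)\<^sup>2"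
    and "f' u = deriv G u - of_real pi * sin (of_real pi * u) + of_real (pi\<^sup>2) * (u - w)" for u
  have df: "(f has_field_derivative f' u) (at u)" if "norm u \<le> r" for u
    unfolding f_def[abs_def] f'_def using dG(1)[OF that]
    by (auto intro!: derivative_eq_intros simp: algebra_simps power2_eq_square)
  have df': "(f' has_field_derivative deriv (deriv G) u - of_real (pi\<^sup>2) * (cos (of_real pi * u) - 1)) (at u)" if "norm u \<le> r" for u
    unfolding f'_def[abs_def] using dG(2)[OF that]
    by (auto intro!: derivative_eq_intros simp: algebra_simps power2_eq_square)
  have f''_bd: "norm (deriv (deriv G) u - of_real (pi\<^sup>2) * (cos (of_real pi * u) - 1)) \<le> 1" if u: "norm u \<le> r" for u
  proof -
    have 1: "norm (deriv (deriv G) u) \<le> 16 * (1/32)"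
      by (rule second_deriv_bound_ball[OF hG]) (use near u r in \<open>auto simp: G_def\<close>)
    have "norm (cos (of_real pi * u) - 1) \<le> pi * exp pi * norm u" using u r by (intro trig_small) auto
    also have "\<dots> \<le> pi * exp pi * r" using u by (intro mult_left_mono) auto
    also have "\<dots> = pi / 100" by (simp add: r_def)
    finally have "pi\<^sup>2 * norm (cos (of_real pi * u) - 1) \<le> 10.2 * (3.2 / 100)"
      using pi_bounds by (intro mult_mono) auto
    then have 2: "norm (of_real (pi\<^sup>2) * (cos (of_real pi * u) - 1)) \<le> 1/2" by (simp add: norm_mult norm_power)
    show ?thesis using norm_triangle_ineq4[of "deriv (deriv G) u" "of_real (pi\<^sup>2) * (cos (of_real pi * u) - 1)"] 1 2 by linarith
  qed
  have w': "norm w \<le> r" and z': "norm z \<le> r" using w z by (auto simp: r_def)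
  have fw: "f w = 0" using zeros by (simp add: f_def G_def)
  have f'w: "f' w = 0"
  proof -
    have "norm w < 1" using w' r by linarith
    then have dF: "(F has_field_derivative deriv F w) (at w)" using F by (auto intro!: holomorphic_derivI[of _ "ball 0 1"])
    have "(G has_field_derivative deriv F w + of_real pi * sin (of_real pi * w)) (at w)"
      unfolding G_def[abs_def] using dF by (auto intro!: derivative_eq_intros)
    then have "deriv G w = deriv F w + of_real pi * sin (of_real pi * w)" by (rule DERIV_imp_deriv)
    then show ?thesis using zeros by (simp add: f'_def)
  qed
  have f'_bd: "norm (f' u) \<le> norm (u - w)" if u: "norm u \<le> r" for u
  proof -
    have "norm (f' u - f' w) \<le> 1 * norm (u - w)"
      by (rule field_differentiable_bound[where S = "cball 0 r" and f = f',
            OF _ has_field_derivative_at_within[OF df'] f''_bd]) (use u w' in auto)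
    then show ?thesis using f'w by simp
  qed
  have seg: "norm u \<le> r \<and> norm (u - w) \<le> norm (z - w)" if "u \<in> closed_segment w z" for u
  proof -
    have "closed_segment w z \<subseteq> cball 0 r" using w' z' by (intro closed_segment_subset) auto
    moreover have "norm (u - w) \<le> norm (z - w)" using segment_bound1[OF that] by simp
    ultimately show ?thesis using that by auto
  qed
  have "norm (f z - f w) \<le> norm (z - w) * norm (z - w)"
  proof (rule field_differentiable_bound[where S = "closed_segment w z" and f = f and f' = f'])
    fix u assume "u \<in> closed_segment w z"
    then have u: "norm u \<le> r" "norm (u - w) \<le> norm (z - w)" using seg by auto
    show "(f has_field_derivative f' u) (at u within closed_segment w z)"
      by (rule has_field_derivative_at_within[OF df[OF u(1)]])
    show "norm (f' u) \<le> norm (z - w)" using f'_bd[OF u(1)] u(2) by linarith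
  qed auto
  \<comment> \<open>A second derivative of at most 1 allowed |f z| \<le> |z - w|^2 only, which
    contradicts the coefficient \<pi>^2/2 > 1 unless z = w.\<close>
  moreover have "f z = of_real (pi\<^sup>2 / 2) * (z - w)\<^sup>2" using zeros by (simp add: f_def G_def)
  ultimately have "pi\<^sup>2 / 2 * (norm (z - w))\<^sup>2 \<le> 1 * (norm (z - w))\<^sup>2"
    using fw by (simp add: norm_mult norm_power norm_divide power2_eq_square)
  moreover have "pi\<^sup>2 / 2 > 1" using pi_bounds by simp
  ultimately have "(norm (z - w))\<^sup>2 \<le> 0" by (metis mult_le_cancel_right not_le zero_le_power2 le_less)
  then show ?thesis by simp
qed

text \<open>The zeros of cos \<pi>z - 1 are the even integers, and 0 is the only one with |z| \<le>
  3/2; the rest is compactness of the annulus.\<close>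

lemma cos_minus_one_lower_bound:
  fixes r :: real
  assumes "r > 0"
  shows "\<exists>c>0. \<forall>z::complex. norm z \<le> 3/2 \<longrightarrow> r \<le> norm z \<longrightarrow> c \<le> norm (cos (of_real pi * z) - 1)"
proof -
  define K where "K = cball (0::complex) (3/2) - ball 0 r"
  have cK: "compact K" unfolding K_def by (intro compact_diff compact_cball open_ball)
  have nz: "cos (of_real pi * z) - 1 \<noteq> 0" if z: "z \<in> K" for z
  proof
    assume "cos (of_real pi * z) - 1 = 0"
    then obtain n :: int where n: "of_real pi * z = of_real (2 * of_int n * pi)"
      using cos_eq_1[of "of_real pi * z"] by (auto simp: mult_ac)
    then have "of_real pi * z = of_real pi * (2 * of_int n)" by (simp add: mult_ac)
    then have zn: "z = 2 * of_int n" by simp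
    then have "norm z = 2 * \<bar>real_of_int n\<bar>" by (simp add: norm_mult)
    moreover have "norm z \<le> 3/2" "z \<noteq> 0" using z assms by (auto simp: K_def)
    ultimately have "\<bar>n\<bar> < 1" "n \<noteq> 0" using zn by auto
    then show False by simp
  qed
  show ?thesis
  proof (cases "K = {}")
    case True
    then show ?thesis by (intro exI[of _ 1]) (auto simp: K_def subset_iff not_le[symmetric])
  next
    case False
    have "continuous_on K (\<lambda>z. norm (cos (of_real pi * z) - 1))" by (intro continuous_intros)
    then obtain z0 where z0: "z0 \<in> K" "\<And>z. z \<in> K \<Longrightarrow> norm (cos (of_real pi * z0) - 1) \<le> norm (cos (of_real pi * z) - 1)"
      using continuous_attains_inf[OF cK False] by blast
    show ?thesis
      by (rule exI[of _ "norm (cos (of_real pi * z0) - 1)"]) (use z0 nz[of z0] in \<open>auto simp: K_def\<close>)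
  qed
qed

lemma norm_cos_lower_bound:
  fixes z :: complex
  assumes "\<bar>Im z\<bar> \<ge> pi"
  shows "norm (cos z) - 1 \<ge> exp \<bar>Im z\<bar> / 4"
proof -
  have e: "norm (exp (\<i> * z)) = exp (- Im z)" "norm (exp (- (\<i> * z))) = exp (Im z)"
    by (auto simp: norm_exp_eq_Re)
  have "norm (exp (\<i> * z) + exp (- (\<i> * z))) \<ge> exp \<bar>Im z\<bar> - exp (- \<bar>Im z\<bar>)"
    using norm_diff_ineq[of "exp (\<i> * z)" "exp (- (\<i> * z))"] norm_diff_ineq[of "exp (- (\<i> * z))" "exp (\<i> * z)"] e
    by (cases "Im z \<ge> 0") (auto simp: add.commute)
  then have "2 * norm (cos z) \<ge> exp \<bar>Im z\<bar> - exp (- \<bar>Im z\<bar>)"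
    unfolding cos_exp_eq by (simp add: norm_divide)
  moreover have "exp (- \<bar>Im z\<bar>) \<le> 1" by simp
  \<comment> \<open>With E = exp |Im z|, the inequality (E - 1)/2 - 1 \<ge> E/4 holds from E = 6
    on.\<close>
  moreover have "exp \<bar>Im z\<bar> \<ge> 6"
  proof -
    have "1 + pi + pi\<^sup>2 / 2 \<le> exp pi" using exp_lower_Taylor_quadratic[of pi] by simp
    moreover have "exp pi \<le> exp \<bar>Im z\<bar>" using assms by simp
    ultimately show ?thesis using pi_bounds by linarith
  qed
  ultimately show ?thesis by linarith
qed

text \<open>The point w rules out the zero function. Order 1 then means a factorization g(u) (u - z)
  near z with g(z) nonzero, and the derivative at z is g(z).\<close>

lemma zorder_eq_1_imp:
  assumes f: "f holomorphic_on UNIV" and nz: "f w \<noteq> 0" and z: "zorder f z = 1"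
  shows "f z = 0" and "deriv f z \<noteq> 0"
proof -
  have ex: "(if f z = 0 then zorder f z > 0 else zorder f z = 0) \<and> (\<exists>r. r > 0 \<and> cball z r \<subseteq> UNIV \<and> zor_poly f z holomorphic_on cball z r
    \<and> (\<forall>w\<in>cball z r. f w = zor_poly f z w * (w - z) ^ nat (zorder f z) \<and> zor_poly f z w \<noteq> 0))"
    by (rule zorder_exist_zero[OF f]) (use nz in auto)
  then show "f z = 0" using z by (auto split: if_splits)
  obtain r where r: "r > 0" "zor_poly f z holomorphic_on cball z r"
    "\<And>w. w \<in> cball z r \<Longrightarrow> f w = zor_poly f z w * (w - z)" "zor_poly f z z \<noteq> 0"
    using ex z by auto
  have "(zor_poly f z has_field_derivative deriv (zor_poly f z) z) (at z)"
    using r by (intro holomorphic_derivI[of _ "ball z r"]) (auto intro: holomorphic_on_subset)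
  then have "((\<lambda>w. zor_poly f z w * (w - z)) has_field_derivative zor_poly f z z) (at z)"
    by (auto intro!: derivative_eq_intros)
  then have "(f has_field_derivative zor_poly f z z) (at z)"
    by (rule has_field_derivative_transform_within_open[where S = "ball z r"]) (use r in auto)
  then show "deriv f z \<noteq> 0" using r(4) DERIV_imp_deriv by metis
qed

lemma cos_shift_nat:
  assumes "even (k + t)"
  shows "(-1) ^ k * ((-1) ^ (t + 1) + cos ((of_nat k + z) * of_real pi)) = cos (of_real pi * z) - (1::complex)"
proof -
  have "cos ((of_nat k + z) * of_real pi) = cos (of_nat k * of_real pi + of_real pi * z)"
    by (simp add: algebra_simps)
  also have "\<dots> = (-1) ^ k * cos (of_real pi * z)" unfolding cos_add sin_cos_nat_pi by simp
  finally have c: "cos ((of_nat k + z) * of_real pi) = \<dots>" .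
  have "(-1::complex) ^ k * (-1) ^ (t + 1) = -1" "(-1::complex) ^ k * (-1) ^ k = 1"
    using assms by (simp_all flip: power_add)
  then show ?thesis unfolding c distrib_left by (simp flip: mult.assoc)
qed

text \<open>Every zero outside a large disc is shown to have vanishing derivative. The simple zeros
  are thus confined to the disc, where an entire function that is not identically zero has finitely
  many zeros.\<close>

lemma finite_simple_zeros:
  fixes A :: "complex^4^2" and w :: "nat \<Rightarrow> complex" and N :: nat
  defines "k \<equiv> \<lambda>n. 2 * n + bc_theta A"
  assumes q: "L1_fun q"
    and zero: "\<And>n. n \<ge> N \<Longrightarrow> char_det A q ((of_nat (k n) + w n)\<^sup>2) = 0"
    and dzero: "\<And>n. n \<ge> N \<Longrightarrow> deriv (char_det A q) ((of_nat (k n) + w n)\<^sup>2) = 0"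
    and w: "w \<longlonglongrightarrow> 0"
  shows "finite {lam. zorder (char_det A q) lam = 1}"
proof -
  let ?D = "char_det A q" and ?t = "bc_theta A"
  have hD: "?D holomorphic_on UNIV" by (rule char_det_holomorphic[OF q])
  define M where "M = L1_norm q + 1"
  have M: "L1_norm q \<le> M" "M > 0" using L1_norm_nonneg[of q] by (auto simp: M_def)
  define C where "C = bc_const A * (4 * M + 1)"
  have C0: "C \<ge> 0" using M bc_const_nonneg by (simp add: C_def)
  have asy: "norm \<mu> * norm (?D (\<mu>\<^sup>2) - (-1) ^ (?t + 1) - cos (\<mu> * pi)) \<le> C * exp (\<bar>Im \<mu>\<bar> * pi)"
    if "norm \<mu> \<ge> 2 * M" "norm \<mu> \<ge> 1" for \<mu>
    using char_det_asymptotics[OF q M that, of A] by (simp add: C_def norm_mult)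
  define r where "r = 1 / (100 * exp pi)"
  have r0: "r > 0" by (simp add: r_def)
  obtain c where c: "c > 0" "\<And>z::complex. norm z \<le> 3/2 \<Longrightarrow> r \<le> norm z \<Longrightarrow> c \<le> norm (cos (of_real pi * z) - 1)"
    using cos_minus_one_lower_bound[OF r0] by blast
  obtain n0 where n0: "\<And>n. n \<ge> n0 \<Longrightarrow> norm (w n) \<le> r"
  proof -
    have "\<forall>\<^sub>F n in sequentially. norm (w n) < r"
      using tendsto_norm[OF w] r0 by (auto dest: order_tendstoD(2))
    then show ?thesis using that by (auto simp: eventually_sequentially intro: less_imp_le)
  qed
  \<comment> \<open>Each summand pays for one use: the asymptotic formula, \<open>far\<close>, the
    closeness 1/32 in \<open>double_zero_unique\<close>, the lower bound c on the annulus, and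
    indices beyond N and n0.\<close>
  define L where "L = 2 * M + 1 + 4 * C + 32 * (C * exp pi) + C * exp pi / c + real (k (max N n0))"
  have L: "L \<ge> 2 * M" "L \<ge> 1" "L \<ge> 4 * C + 1" "L \<ge> 32 * (C * exp pi)" "L \<ge> C * exp pi / c" "L \<ge> real (k (max N n0))" "L > 0"
    using M C0 c by (simp_all add: L_def add_nonneg_nonneg add_increasing add_increasing2 add_pos_nonneg add_nonneg_pos)
  \<comment> \<open>Off the strip |Im \<mu>| < 1 the main term, at least exp (|Im \<mu>| \<pi>) / 4,
    beats the error C exp (|Im \<mu>| \<pi>) / |\<mu>|.\<close>
  have far: "?D (\<mu>\<^sup>2) \<noteq> 0" if \<mu>: "norm \<mu> \<ge> L" "\<bar>Im \<mu>\<bar> \<ge> 1" for \<mu>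
  proof
    assume z: "?D (\<mu>\<^sup>2) = 0"
    have im: "\<bar>Im (\<mu> * of_real pi)\<bar> = \<bar>Im \<mu>\<bar> * pi" by (simp add: abs_mult)
    have "exp (\<bar>Im \<mu>\<bar> * pi) / 4 \<le> norm (cos (\<mu> * pi)) - 1"
      using norm_cos_lower_bound[of "\<mu> * pi"] \<mu>(2) unfolding im by simp
    also have "\<dots> \<le> norm (?D (\<mu>\<^sup>2) - (-1) ^ (?t + 1) - cos (\<mu> * pi))"
    proof -
      have "norm (0 - s - c) \<ge> norm c - norm s" for s c :: complex
      proof -
        have "0 - s - c = - (c + s)" by simp
        then have "norm (0 - s - c) = norm (c + s)" by (simp only: norm_minus_cancel)
        then show ?thesis using norm_diff_ineq[of c s] by simp
      qed
      from this[of "cos (\<mu> * pi)" "(-1) ^ (?t + 1)"] show ?thesis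
        unfolding z by (simp only: norm_power norm_minus_cancel norm_one power_one)
    qed
    finally have "norm \<mu> * (exp (\<bar>Im \<mu>\<bar> * pi) / 4) \<le> norm \<mu> * norm (?D (\<mu>\<^sup>2) - (-1) ^ (?t + 1) - cos (\<mu> * pi))"
      by (intro mult_left_mono) auto
    also have "\<dots> \<le> C * exp (\<bar>Im \<mu>\<bar> * pi)" using \<mu> L by (intro asy) linarith+
    finally have "norm \<mu> \<le> 4 * C" by simp
    then show False using \<mu> L by linarith
  qed
  \<comment> \<open>A large zero has its square root within \<open>3/2\<close> of some \<open>k n\<close>, hence within \<open>r\<close>, where \<open>w n\<close> is the only zero.\<close>
  have bounded: "norm lam \<le> (L + 4)\<^sup>2" if z: "?D lam = 0" and d: "deriv ?D lam \<noteq> 0" for lam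
  proof (rule ccontr)
    assume "\<not> norm lam \<le> (L + 4)\<^sup>2"
    \<comment> \<open>The principal root has nonnegative real part, hence lies near some
      \<open>k n\<close> and not near its negative.\<close>
    define \<mu> where "\<mu> = csqrt lam"
    have sq: "\<mu>\<^sup>2 = lam" by (simp add: \<mu>_def)
    have "(L + 4)\<^sup>2 \<le> (norm \<mu>)\<^sup>2"
      using \<open>\<not> norm lam \<le> (L + 4)\<^sup>2\<close> unfolding norm_power[symmetric] sq by simp
    \<comment> \<open>The margin 4 is spent in steps of one: Re \<mu> \<ge> L + 3, then k n \<ge> L
      + 2, then |k n + z| \<ge> L + 1 for |z| \<le> 1.\<close>
    then have n\<mu>: "norm \<mu> \<ge> L + 4" by (rule power2_le_imp_le) simp
    have im: "\<bar>Im \<mu>\<bar> < 1" using far[of \<mu>] z n\<mu> sq by fastforce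
    have re: "Re \<mu> \<ge> 0" unfolding \<mu>_def using csqrt_principal[of lam] by auto
    then have re: "Re \<mu> \<ge> L + 3" using cmod_le[of \<mu>] n\<mu> im by linarith
    \<comment> \<open>Consecutive \<open>k n\<close> differ by 2, so rounding brings the real part
      within 1; with |Im \<mu>| < 1 the distance is at most sqrt 2 < 3/2.\<close>
    define n where "n = nat \<lfloor>(Re \<mu> - real ?t + 1) / 2\<rfloor>"
    have t1: "real ?t \<le> 1" by (simp add: bc_theta_def)
    have "real n = of_int \<lfloor>(Re \<mu> - real ?t + 1) / 2\<rfloor>"
      unfolding n_def using re t1 L by (intro of_nat_nat) simp
    then have n: "real n \<le> (Re \<mu> - real ?t + 1) / 2" "(Re \<mu> - real ?t + 1) / 2 < real n + 1"
      by linarith+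
    have kn: "real (k n) = 2 * real n + real ?t" by (simp add: k_def)
    have kR: "\<bar>Re \<mu> - real (k n)\<bar> \<le> 1" using n unfolding kn abs_le_iff by (simp add: field_simps)
    have "real (k (max N n0)) \<le> real (k n)" using kR re L by linarith
    then have nN: "n \<ge> N" "n \<ge> n0" by (auto simp: k_def)
    have kL: "real (k n) \<ge> L + 2" using kR re by linarith
    have ev: "even (k n + ?t)" by (simp add: k_def)
    define F where "F z = (-1) ^ (k n) * ?D ((of_nat (k n) + z)\<^sup>2)" for z
    have hF: "F holomorphic_on UNIV"
    proof -
      have "(?D \<circ> (\<lambda>z. (of_nat (k n) + z)\<^sup>2)) holomorphic_on UNIV"
        by (intro holomorphic_on_compose holomorphic_intros holomorphic_on_subset[OF hD]) auto
      then show ?thesis unfolding F_def[abs_def] o_def by (intro holomorphic_intros)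
    qed
    have F_bd: "norm (F z - (cos (of_real pi * z) - 1)) \<le> C * exp pi / (L + 1)" if z: "\<bar>Im z\<bar> \<le> 1" "norm (of_nat (k n) + z) \<ge> L + 1" for z
    proof -
      let ?m = "of_nat (k n) + z"
      have "F z - (cos (of_real pi * z) - 1) = (-1) ^ (k n) * (?D (?m\<^sup>2) - (-1) ^ (?t + 1) - cos (?m * pi))"
        unfolding cos_shift_nat[OF ev, symmetric] F_def by (simp add: algebra_simps)
      then have e: "norm (F z - (cos (of_real pi * z) - 1)) = norm (?D (?m\<^sup>2) - (-1) ^ (?t + 1) - cos (?m * pi))"
        by simp
      have "(L + 1) * norm (F z - (cos (of_real pi * z) - 1)) \<le> norm ?m * norm (F z - (cos (of_real pi * z) - 1))"
        using z by (intro mult_right_mono) auto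
      also have "\<dots> \<le> C * exp (\<bar>Im ?m\<bar> * pi)" unfolding e using z L by (intro asy) linarith+
      also have "\<dots> \<le> C * exp (1 * pi)" using z C0 by (intro mult_left_mono) auto
      finally show ?thesis using L by (simp add: field_simps)
    qed
    define \<delta> where "\<delta> = \<mu> - of_nat (k n)"
    have \<mu>\<delta>: "\<mu> = of_nat (k n) + \<delta>" by (simp add: \<delta>_def)
    have \<delta>im: "\<bar>Im \<delta>\<bar> \<le> 1" using im by (simp add: \<delta>_def)
    have "(norm \<delta>)\<^sup>2 \<le> 1\<^sup>2 + 1\<^sup>2"
      unfolding cmod_power2 using kR \<delta>im by (intro add_mono abs_le_square_iff[THEN iffD1]) (auto simp: \<delta>_def)
    then have "(norm \<delta>)\<^sup>2 \<le> (3/2)\<^sup>2" by (simp add: power2_eq_square)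
    then have \<delta>1: "norm \<delta> \<le> 3/2" by (rule power2_le_imp_le) simp
    have F\<delta>: "F \<delta> = 0" unfolding F_def using z sq by (simp flip: \<mu>\<delta>)
    have "norm (cos (of_real pi * \<delta>) - 1) \<le> C * exp pi / (L + 1)"
      using F_bd[OF \<delta>im] n\<mu> F\<delta> norm_minus_cancel[of "cos (of_real pi * \<delta>) - 1"] by (simp flip: \<mu>\<delta>)
    also have "\<dots> < c"
    proof -
      have "C * exp pi \<le> L * c" using L(5) c(1) by (simp add: field_simps)
      then have "C * exp pi < (L + 1) * c" using c(1) by (simp add: distrib_right)
      then show ?thesis using L by (simp add: field_simps)
    qed
    finally have \<delta>r: "norm \<delta> \<le> r" using c(2)[OF \<delta>1] by linarith
    have "\<delta> = w n"
    proof (rule double_zero_unique[of F])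
      show "F holomorphic_on ball 0 1" using hF by (rule holomorphic_on_subset) simp
      show "norm (F z - (cos (of_real pi * z) - 1)) \<le> 1/32" if "z \<in> ball 0 1" for z
      proof -
        have nz: "norm z \<le> 1" using that by simp
        have "real (k n) - norm z \<le> norm (of_nat (k n) + z)"
          using norm_diff_ineq[of "of_nat (k n)" z] by simp
        then have "norm (F z - (cos (of_real pi * z) - 1)) \<le> C * exp pi / (L + 1)"
          using nz kL abs_Im_le_cmod[of z] by (intro F_bd) linarith+
        also have "\<dots> \<le> 1/32" using L by (simp add: field_simps)
        finally show ?thesis .
      qed
      show "norm (w n) \<le> 1 / (100 * exp pi)" using n0[OF nN(2)] by (simp add: r_def)
      show "norm \<delta> \<le> 1 / (100 * exp pi)" using \<delta>r by (simp add: r_def)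
      show "F (w n) = 0" using zero[OF nN(1)] by (simp add: F_def)
      have "(?D has_field_derivative 0) (at ((of_nat (k n) + w n)\<^sup>2))"
        using holomorphic_derivI[OF hD open_UNIV UNIV_I, of "(of_nat (k n) + w n)\<^sup>2"] dzero[OF nN(1)] by simp
      then have "((\<lambda>z. ?D ((of_nat (k n) + z)\<^sup>2)) has_field_derivative 0 * (2 * (of_nat (k n) + w n))) (at (w n))"
        by (rule DERIV_chain2[where f = ?D and g = "\<lambda>z. (of_nat (k n) + z)\<^sup>2"]) (auto intro!: derivative_eq_intros)
      then have "(F has_field_derivative (-1) ^ (k n) * (0 * (2 * (of_nat (k n) + w n)))) (at (w n))"
        unfolding F_def[abs_def] by (rule DERIV_cmult)
      then show "deriv F (w n) = 0" using DERIV_imp_deriv by fastforce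
    qed (rule F\<delta>)
    then have "deriv ?D lam = 0" using dzero[OF nN(1)] sq \<mu>\<delta> by simp
    then show False using d by simp
  qed
  \<comment> \<open>A point of the region \<open>far\<close>, where the determinant is nonzero: it
    excludes the zero function both for \<open>zorder\<close> and for the finiteness of
    zeros.\<close>
  define \<mu>1 where "\<mu>1 = \<i> * of_real L"
  have nz: "?D (\<mu>1\<^sup>2) \<noteq> 0" by (rule far) (use L in \<open>auto simp: \<mu>1_def norm_mult\<close>)
  have "finite {lam \<in> cball 0 ((L + 4)\<^sup>2). ?D lam = 0}"
  proof (cases "?D constant_on UNIV")
    case True
    then have "?D lam \<noteq> 0" for lam using nz by (metis UNIV_I constant_on_def)
    then show ?thesis by simp
  next
    case False
    then show ?thesis by (intro holomorphic_compact_finite_zeros[OF hD]) auto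
  qed
  moreover have "{lam. zorder ?D lam = 1} \<subseteq> {lam \<in> cball 0 ((L + 4)\<^sup>2). ?D lam = 0}"
    using zorder_eq_1_imp[OF hD nz] bounded by auto
  ultimately show ?thesis by (rule rev_finite_subset)
qed

section \<open>The perturbed potential\<close>

text \<open>The series with zero coefficients was chosen as an L2 limit and is known to vanish only
  in norm. It enters as a comparison series, at the cost of a further factor 2.\<close>

lemma norm2_sq_sine_series:
  assumes k: "inj k" "\<And>n. k n > 0" and a: "summable (\<lambda>n. (cmod (a n))\<^sup>2)"
    and B: "\<And>K. (\<Sum>n<K. (cmod (a n))\<^sup>2) \<le> B"
  shows "norm2_sq (sine_series k a) \<le> 2 * pi * B"
proof -
  have z: "summable (\<lambda>n. (cmod ((\<lambda>_. 0) n))\<^sup>2)" by simp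
  note S0 = sine_series[OF k z] and Sa = sine_series[OF k a]
  have "norm2_sq (sine_series k (\<lambda>_. 0)) = 0"
    using S0(2) by (intro LIMSEQ_unique[of "\<lambda>_::nat. norm2_sq (sine_series k (\<lambda>_. 0))"]) (auto simp: sine_sum_def)
  moreover have "norm2_sq (\<lambda>t. sine_series k a t - sine_series k (\<lambda>_. 0) t) \<le> pi * B"
    by (rule norm2_sq_sine_series_diff[OF k a z]) (use B in simp)
  ultimately show ?thesis
    using norm2_sq_add_le[OF L2_fun_diff[OF Sa(1) S0(1)] S0(1)] by simp
qed

text \<open>Cauchy-Schwarz costs a factor \<pi>, so 2 \<pi>^2 \<eta> \<le> 1 is what is required,
  and 2 \<pi>^2 < 21.\<close>

lemma L1_norm_le_of_norm2_sq_le: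
  assumes f: "L2_fun f" and B: "norm2_sq f \<le> 2 * pi * (\<eta> * D\<^sup>2)" and \<eta>: "\<eta> \<le> 1/21" and D: "D \<ge> 0"
  shows "L1_norm f \<le> D"
proof -
  have "pi * norm2_sq f \<le> pi * (2 * pi * (\<eta> * D\<^sup>2))" using B by (intro mult_left_mono) auto
  also have "\<dots> = (2 * pi\<^sup>2) * (\<eta> * D\<^sup>2)" by (simp add: power2_eq_square)
  also have "\<dots> \<le> (2 * pi\<^sup>2) * (1/21 * D\<^sup>2)" using \<eta> by (intro mult_left_mono mult_right_mono) auto
  also have "\<dots> = (2 * pi\<^sup>2 / 21) * D\<^sup>2" by simp
  also have "\<dots> \<le> 1 * D\<^sup>2" using pi_bounds by (intro mult_right_mono) auto
  finally have "sqrt (pi * norm2_sq f) \<le> D" using D by (intro real_le_lsqrt) auto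
  then show ?thesis using L1_norm_le_norm2[OF f] by linarith
qed

text \<open>
  \<open>char_remainder A k q z\<close> is what is left of \<open>(-1)\<^sup>k \<mu> \<Delta>(\<mu>)\<close> at \<open>\<mu> = k + z\<close> after removing the
  principal part \<open>\<mu> (cos \<pi>z - 1)\<close> and the term \<open>- (\<alpha> - 1/2) \<integral> q(t) sin 2kt dt\<close>, through which the
  perturbation of \<open>q\<close> acts to first order.
\<close>

definition char_remainder :: "complex^4^2 \<Rightarrow> nat \<Rightarrow> (real \<Rightarrow> complex) \<Rightarrow> complex \<Rightarrow> complex" where
  "char_remainder A k q z = (-1) ^ k * ((of_nat k + z) * char_det A q ((of_nat k + z)\<^sup>2))
     - (of_nat k + z) * (cos (of_real pi * z) - 1) + (bc_alpha A - 1/2) * sine_coeff k q"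

lemma char_remainder_eq:
  assumes "even (k + bc_theta A)"
  shows "char_remainder A k q z = (-1) ^ k * ((of_nat k + z) * (char_det A q ((of_nat k + z)\<^sup>2)
      - (-1) ^ (bc_theta A + 1) - cos ((of_nat k + z) * of_real pi))) + (bc_alpha A - 1/2) * sine_coeff k q"
  unfolding char_remainder_def cos_shift_nat[OF assms, symmetric] by (simp add: algebra_simps)

text \<open>At the centre of the disc \<mu> is an integer, so the estimates with the gain 1/k apply
  there.\<close>

lemma char_remainder_0:
  assumes "even (k + bc_theta A)"
  shows "char_remainder A k q 0 = nat_remainder A k q"
  unfolding char_remainder_eq[OF assms] nat_remainder_def using sin_cos_nat_pi(2)[of k] by simp

text \<open>One constant for four estimates, size and Lipschitz bound on the disc and at its centre:
  the sum of their constants, with 1 added for positivity.\<close>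

definition remainder_const :: "complex^4^2 \<Rightarrow> real \<Rightarrow> real" where
  "remainder_const A M = 1 + bc_const A * (4 * M + 1) * exp pi + norm (bc_alpha A - 1/2) * M
     + bc_const A * 4 * exp pi + norm (bc_alpha A - 1/2)
     + bc_const A * (6 * M + 4) * M + bc_const A * (6 * M + 4)"

context
  fixes A :: "complex^4^2" and M :: real and k :: nat
  assumes M: "M > 0" and k: "real k \<ge> 2 * M + 2" and ev: "even (k + bc_theta A)"
begin

lemma near_k:
  assumes z: "z \<in> ball 0 1"
  shows "norm (of_nat k + z) \<ge> 2 * M" "norm (of_nat k + z) \<ge> 1" "exp (\<bar>Im (of_nat k + z)\<bar> * pi) \<le> exp pi"
proof -
  have nz: "norm z \<le> 1" using z by simp
  have "real k - norm z \<le> norm (of_nat k + z)" using norm_diff_ineq[of "of_nat k" z] by simp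
  then show "norm (of_nat k + z) \<ge> 2 * M" "norm (of_nat k + z) \<ge> 1" using k nz M by linarith+
  have "\<bar>Im (of_nat k + z)\<bar> \<le> 1" using abs_Im_le_cmod[of z] nz by simp
  then show "exp (\<bar>Im (of_nat k + z)\<bar> * pi) \<le> exp pi" by simp
qed

lemma remainder_const_ge:
  "bc_const A * (4 * M + 1) * exp pi + norm (bc_alpha A - 1/2) * M \<le> remainder_const A M"
  "bc_const A * 4 * exp pi + norm (bc_alpha A - 1/2) \<le> remainder_const A M"
  "bc_const A * (6 * M + 4) * M \<le> remainder_const A M" "bc_const A * (6 * M + 4) \<le> remainder_const A M"
  "remainder_const A M > 0"
proof -
  have "bc_const A * (4 * M + 1) * exp pi \<ge> 0" "norm (bc_alpha A - 1/2) * M \<ge> 0" "bc_const A * 4 * exp pi \<ge> 0"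
    "norm (bc_alpha A - 1/2) \<ge> 0" "bc_const A * (6 * M + 4) * M \<ge> 0" "bc_const A * (6 * M + 4) \<ge> 0"
    using M bc_const_nonneg[of A] by auto
  then show "bc_const A * (4 * M + 1) * exp pi + norm (bc_alpha A - 1/2) * M \<le> remainder_const A M"
    "bc_const A * 4 * exp pi + norm (bc_alpha A - 1/2) \<le> remainder_const A M"
    "bc_const A * (6 * M + 4) * M \<le> remainder_const A M" "bc_const A * (6 * M + 4) \<le> remainder_const A M"
    "remainder_const A M > 0"
    unfolding remainder_const_def by linarith+
qed

lemma char_remainder_holomorphic:
  assumes "L1_fun q"
  shows "char_remainder A k q holomorphic_on S"
proof -
  have "(\<lambda>z. char_det A q ((of_nat k + z)\<^sup>2)) holomorphic_on S"
  proof -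
    have "(char_det A q \<circ> (\<lambda>z. (of_nat k + z)\<^sup>2)) holomorphic_on S"
      by (intro holomorphic_on_compose holomorphic_intros holomorphic_on_subset[OF char_det_holomorphic[OF assms]]) auto
    then show ?thesis by (simp add: o_def)
  qed
  then show ?thesis unfolding char_remainder_def[abs_def] by (intro holomorphic_intros)
qed

lemma char_remainder_bound:
  assumes q: "L1_fun q" "L1_norm q \<le> M"
  shows "z \<in> ball 0 1 \<Longrightarrow> norm (char_remainder A k q z) \<le> remainder_const A M"
    and "norm (char_remainder A k q 0) \<le> remainder_const A M * (1 / real k)"
proof -
  show "norm (char_remainder A k q z) \<le> remainder_const A M" if z: "z \<in> ball 0 1"
  proof -
    note nk = near_k[OF z]
    have "norm ((of_nat k + z) * (char_det A q ((of_nat k + z)\<^sup>2) - (-1) ^ (bc_theta A + 1) - cos ((of_nat k + z) * of_real pi)))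
      \<le> bc_const A * (4 * M + 1) * exp (\<bar>Im (of_nat k + z)\<bar> * pi)"
      by (rule char_det_asymptotics[OF q M nk(1,2)])
    also have "\<dots> \<le> bc_const A * (4 * M + 1) * exp pi"
      using M bc_const_nonneg[of A] by (intro mult_left_mono nk) auto
    finally have 1: "norm ((-1) ^ k * ((of_nat k + z) * (char_det A q ((of_nat k + z)\<^sup>2) - (-1) ^ (bc_theta A + 1) - cos ((of_nat k + z) * of_real pi))))
      \<le> bc_const A * (4 * M + 1) * exp pi" unfolding norm_minus_one_power_mult .
    have 2: "norm ((bc_alpha A - 1/2) * sine_coeff k q) \<le> norm (bc_alpha A - 1/2) * M"
      unfolding norm_mult using sine_coeff_le_L1[OF q(1), of k] q(2) by (intro mult_left_mono) auto
    show ?thesis unfolding char_remainder_eq[OF ev]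
      by (rule order_trans[OF norm_triangle_ineq order_trans[OF add_mono[OF 1 2] remainder_const_ge(1)]])
  qed
  have "norm (char_remainder A k q 0) \<le> bc_const A * (6 * M + 4) * M / real k"
    unfolding char_remainder_0[OF ev] using k M by (intro nat_remainder_bound q) auto
  also have "\<dots> \<le> remainder_const A M / real k" using remainder_const_ge by (intro divide_right_mono) auto
  finally show "norm (char_remainder A k q 0) \<le> remainder_const A M * (1 / real k)" by simp
qed

lemma char_remainder_lipschitz:
  assumes q: "L2_fun q1" "L2_fun q2" and Mq: "L1_norm q1 \<le> M" "L1_norm q2 \<le> M"
    and D: "L1_norm (\<lambda>t. q1 t - q2 t) \<le> D"
  shows "z \<in> ball 0 1 \<Longrightarrow> norm (char_remainder A k q1 z - char_remainder A k q2 z) \<le> remainder_const A M * D"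
    and "norm (char_remainder A k q1 0 - char_remainder A k q2 0) \<le> remainder_const A M * D * (1 / real k)"
proof -
  note ai = q[THEN L2_fun_imp_absolutely_integrable]
  define E where "E = L1_norm (\<lambda>t. q1 t - q2 t)"
  have E: "E \<ge> 0" "E \<le> D" using L1_norm_nonneg D by (auto simp: E_def)
  have RE: "remainder_const A M * E \<le> remainder_const A M * D"
    using E remainder_const_ge(5) by (intro mult_left_mono) auto
  show "norm (char_remainder A k q1 z - char_remainder A k q2 z) \<le> remainder_const A M * D" if z: "z \<in> ball 0 1"
  proof -
    note nk = near_k[OF z]
    have "norm ((of_nat k + z) * (char_det A q1 ((of_nat k + z)\<^sup>2) - char_det A q2 ((of_nat k + z)\<^sup>2)))
      \<le> bc_const A * 4 * E * exp (\<bar>Im (of_nat k + z)\<bar> * pi)"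
      unfolding E_def by (rule char_det_lipschitz[OF ai Mq M nk(1,2)])
    also have "\<dots> \<le> bc_const A * 4 * E * exp pi"
      using E bc_const_nonneg[of A] by (intro mult_left_mono nk) auto
    finally have 1: "norm ((-1) ^ k * ((of_nat k + z) * (char_det A q1 ((of_nat k + z)\<^sup>2) - char_det A q2 ((of_nat k + z)\<^sup>2))))
      \<le> bc_const A * 4 * E * exp pi" unfolding norm_minus_one_power_mult .
    have "norm (sine_coeff k q1 - sine_coeff k q2) \<le> E"
      using sine_coeff_le_L1[OF L2_fun_imp_absolutely_integrable[OF L2_fun_diff[OF q]], of k]
      unfolding sine_coeff_diff[OF q] E_def .
    then have 2: "norm ((bc_alpha A - 1/2) * (sine_coeff k q1 - sine_coeff k q2)) \<le> norm (bc_alpha A - 1/2) * E"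
      unfolding norm_mult by (intro mult_left_mono) auto
    have "char_remainder A k q1 z - char_remainder A k q2 z
      = (-1) ^ k * ((of_nat k + z) * (char_det A q1 ((of_nat k + z)\<^sup>2) - char_det A q2 ((of_nat k + z)\<^sup>2)))
        + (bc_alpha A - 1/2) * (sine_coeff k q1 - sine_coeff k q2)"
      unfolding char_remainder_def by (simp only: right_diff_distrib) simp
    then have "norm (char_remainder A k q1 z - char_remainder A k q2 z)
      \<le> bc_const A * 4 * E * exp pi + norm (bc_alpha A - 1/2) * E"
      using order_trans[OF norm_triangle_ineq add_mono[OF 1 2]] by simp
    also have "\<dots> = (bc_const A * 4 * exp pi + norm (bc_alpha A - 1/2)) * E" by (simp add: algebra_simps)
    also have "\<dots> \<le> remainder_const A M * E" using E remainder_const_ge by (intro mult_right_mono) auto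
    finally show ?thesis using RE by linarith
  qed
  have "norm (char_remainder A k q1 0 - char_remainder A k q2 0) \<le> bc_const A * (6 * M + 4) * E / real k"
    unfolding char_remainder_0[OF ev] E_def using k M by (intro nat_remainder_lipschitz ai Mq) auto
  also have "\<dots> \<le> remainder_const A M * E / real k"
    using E remainder_const_ge by (intro divide_right_mono mult_right_mono) auto
  also have "\<dots> \<le> remainder_const A M * D / real k" using RE by (intro divide_right_mono) auto
  finally show "norm (char_remainder A k q1 0 - char_remainder A k q2 0) \<le> remainder_const A M * D * (1 / real k)"
    by simp
qed

text \<open>\<open>root_fun\<close> minus the sine coefficient term is (-1)^k \<mu> \<Delta>, as a
  function of z = \<mu> - k. It vanishes at w with its derivative, and since \<mu> is nonzero, the
  factor \<mu> and the factor 2 \<mu> of the chain rule can be divided out: a double zero in z is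
  one in lam.\<close>

lemma double_root_of_char_det:
  assumes q: "L1_fun q" and \<rho>: "1 / \<rho> ^ 8 = real k" and w: "norm w < 1"
    and zero: "root_fun \<rho> (char_remainder A k q) w = (bc_alpha A - 1/2) * sine_coeff k q"
    and dzero: "root_deriv \<rho> (char_remainder A k q) w = 0"
  shows "char_det A q ((of_nat k + w)\<^sup>2) = 0" and "deriv (char_det A q) ((of_nat k + w)\<^sup>2) = 0"
proof -
  let ?D = "char_det A q" and ?m = "of_nat k + w"
  have m0: "?m \<noteq> 0" using near_k(2)[of w] w by auto
  have rf: "root_fun \<rho> (char_remainder A k q) z
      = (-1) ^ k * ((of_nat k + z) * ?D ((of_nat k + z)\<^sup>2)) + (bc_alpha A - 1/2) * sine_coeff k q" for z
    unfolding root_fun_def \<rho> char_remainder_def by simp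
  have "(-1) ^ k * (?m * ?D (?m\<^sup>2)) = 0" using zero unfolding rf by simp
  then show z: "?D (?m\<^sup>2) = 0" using m0 by simp
  have dD: "(?D has_field_derivative deriv ?D (?m\<^sup>2)) (at (?m\<^sup>2))"
    by (rule holomorphic_derivI[OF char_det_holomorphic[OF q]]) auto
  have "((\<lambda>z. ?D ((of_nat k + z)\<^sup>2)) has_field_derivative deriv ?D (?m\<^sup>2) * (2 * ?m)) (at w)"
    by (rule DERIV_chain2[where f = ?D and g = "\<lambda>z. (of_nat k + z)\<^sup>2", OF dD]) (auto intro!: derivative_eq_intros)
  then have "(root_fun \<rho> (char_remainder A k q) has_field_derivative
      (-1) ^ k * (1 * ?D (?m\<^sup>2) + deriv ?D (?m\<^sup>2) * (2 * ?m) * ?m)) (at w)"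
    unfolding rf[abs_def] by (auto intro!: derivative_eq_intros)
  moreover have "(root_fun \<rho> (char_remainder A k q) has_field_derivative 0) (at w)"
    using root_fun_has_derivative[OF char_remainder_holomorphic[OF q] w, of \<rho>] dzero by simp
  ultimately have "(-1) ^ k * (1 * ?D (?m\<^sup>2) + deriv ?D (?m\<^sup>2) * (2 * ?m) * ?m) = 0" by (rule DERIV_unique)
  moreover define m where "m = ?m"
  ultimately show "deriv ?D (?m\<^sup>2) = 0" using z m0 unfolding m_def[symmetric] by simp
qed

end


section \<open>Choice of the tail of the sine series, and conclusion\<close>

lemma summable_shifted_sums_le:
  fixes f :: "nat \<Rightarrow> real"
  assumes f: "summable f" "\<And>n. f n \<ge> 0" and \<eta>: "\<eta> > 0"
  shows "\<exists>N0. \<forall>N\<ge>N0. \<forall>K. (\<Sum>n<K. f (N + n)) \<le> \<eta>"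
proof -
  obtain N0 where N0: "\<And>m n. m \<ge> N0 \<Longrightarrow> norm (\<Sum>i\<in>{m..<n}. f i) < \<eta>"
    using summable_Cauchy[THEN iffD1, OF f(1), rule_format, OF \<eta>] by blast
  have "(\<Sum>n<K. f (N + n)) \<le> \<eta>" if "N \<ge> N0" for N K
  proof -
    have "(\<Sum>n<K. f (N + n)) = (\<Sum>i\<in>{N..<N + K}. f i)"
      using sum.shift_bounds_nat_ivl[of f 0 N K] by (simp add: add.commute lessThan_atLeast0)
    then show ?thesis using N0[OF that, of "N + K"] by simp
  qed
  then show ?thesis by blast
qed

theorem theorem3:
  fixes A :: "complex^4^2" and q :: "real \<Rightarrow> complex" and \<epsilon> :: real
  assumes "L2_fun q"
    and "bforms_independent A"
    and "regular_not_strongly_regular A"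
    and "bc_alpha A \<noteq> 1 / 2"
    and "\<epsilon> > 0"
  shows "\<exists>q'. L2_fun q' \<and> L2_norm (\<lambda>x. q x - q' x) < \<epsilon> \<and> asymptotically_multiple A q'"
proof -
  define \<beta> where "\<beta> = bc_alpha A - 1/2"
  have \<beta>: "\<beta> \<noteq> 0" using assms(4) by (simp add: \<beta>_def)
  \<comment> \<open>The added 1 is room for the perturbation, whose L1 norm is kept at most
    1.\<close>
  define M where "M = L1_norm q + 1"
  have M: "M > 0" using L1_norm_nonneg[of q] by (simp add: M_def)
  define C where "C = remainder_const A M"
  have C: "C > 0" unfolding C_def remainder_const_def using M bc_const_nonneg[of A]
    by (intro add_pos_nonneg mult_nonneg_nonneg) auto
  define \<Lambda> where "\<Lambda> = (6 * exp pi + 3 * C) + 1 / norm \<beta> * (24 * exp pi + 9 * C)"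
  have \<Lambda>: "\<Lambda> \<ge> 0" using C by (simp add: \<Lambda>_def add_nonneg_nonneg)
  define kk where "kk n = 2 * n + bc_theta A" for n
  define \<rho> where "\<rho> n = real (kk n) powr (- 1/8)" for n
  \<comment> \<open>The bound 1/21 makes the L1 norm of the perturbation, and its Lipschitz constant
    in b, at most 1; \<epsilon>^2/7 yields the L2 distance, since 2 \<pi> < 7.\<close>
  define \<eta> where "\<eta> = min (1/21) (\<epsilon>\<^sup>2 / 7)"
  have \<eta>: "\<eta> > 0" "\<eta> \<le> 1/21" "\<eta> \<le> \<epsilon>\<^sup>2 / 7" using assms(5) by (auto simp: \<eta>_def)
  \<comment> \<open>A majorant, common to all b in the unit ball, of the squared coefficients of the
    perturbation; its last term alone majorizes their changes with b.\<close>
  define \<sigma> where "\<sigma> n = 2 * (cmod (of_real (2 / pi) * sine_coeff (kk n) q))\<^sup>2 + 2 * \<rho> n ^ 10" for n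
  have \<rho>_power: "\<rho> n ^ m = real (kk n) powr (- real m / 8)" if "m > 0" for n m
    unfolding \<rho>_def using that by (simp add: powr_powr flip: powr_realpow')
  have "summable \<sigma>"
    unfolding \<sigma>_def[abs_def]
  proof (intro summable_add summable_mult)
    \<comment> \<open>Shifted by one because \<open>kk 0\<close> may be 0, whereas Bessel's
      inequality is stated for positive frequencies.\<close>
    have "summable (\<lambda>n. (cmod (sine_coeff (kk (n + 1)) q))\<^sup>2)"
      by (rule bessel[OF _ _ assms(1)]) (auto simp: inj_def kk_def)
    then have "summable (\<lambda>n. (cmod (sine_coeff (kk n) q))\<^sup>2)" by (subst (asm) summable_iff_shift)
    then show "summable (\<lambda>n. (cmod (of_real (2 / pi) * sine_coeff (kk n) q))\<^sup>2)"
      unfolding norm_mult power_mult_distrib by (intro summable_mult)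
    show "summable (\<lambda>n. \<rho> n ^ 10)"
    proof (rule summable_comparison_test')
      show "summable (\<lambda>n. real n powr (- 10/8))" by (subst summable_real_powr_iff) simp
      fix n :: nat assume n: "n \<ge> 1"
      have "real (kk n) powr (- 10/8) \<le> real n powr (- 10/8)"
        using n by (intro powr_mono2') (auto simp: kk_def)
      then show "norm (\<rho> n ^ 10) \<le> real n powr (- 10/8)" using \<rho>_power[of 10 n] by simp
    qed
  qed
  then obtain N1 where N1: "\<And>N K. N \<ge> N1 \<Longrightarrow> (\<Sum>n<K. \<sigma> (N + n)) \<le> \<eta>"
    using summable_shifted_sums_le[of \<sigma> \<eta>] \<eta> by (auto simp: \<sigma>_def)
  \<comment> \<open>The eighth power gives \<tau> n \<le> 1 / (2 \<Lambda> + 2), hence both \<tau> n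
    \<le> 1/2 and \<tau> n \<Lambda> \<le> 1/2; 2 M + 2 is what the remainder estimates ask of
    k.\<close>
  obtain N2 where N2: "real N2 \<ge> (2 * \<Lambda> + 2) ^ 8 + 2 * M + 2" using real_arch_simple by blast
  define N where "N = N1 + N2"
  have kN: "real (kk (N + n)) \<ge> (2 * \<Lambda> + 2) ^ 8" "real (kk (N + n)) \<ge> 2 * M + 2" "kk (N + n) > 0" for n
  proof -
    have "real (kk (N + n)) \<ge> real N2" by (simp add: kk_def N_def)
    moreover have "(2 * \<Lambda> + 2) ^ 8 \<ge> 0" using \<Lambda> by simp
    ultimately show a: "real (kk (N + n)) \<ge> (2 * \<Lambda> + 2) ^ 8" "real (kk (N + n)) \<ge> 2 * M + 2"
      using N2 M by linarith+
    show "kk (N + n) > 0" using a(2) M by (cases "kk (N + n)") auto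
  qed
  define k where "k n = kk (N + n)" for n
  define \<tau> where "\<tau> n = \<rho> (N + n)" for n
  have kinj: "inj k" and kpos: "\<And>n. k n > 0" using kN(3) by (auto simp: inj_def k_def kk_def)
  have ev: "even (k n + bc_theta A)" for n by (simp add: k_def kk_def)
  have \<tau>8: "\<tau> n ^ 8 = 1 / real (k n)" for n
    using \<rho>_power[of 8 "N + n"] kpos[of n] by (simp add: \<tau>_def k_def powr_minus_divide)
  have \<tau>0: "\<tau> n > 0" for n using kN(3)[of n] by (simp add: \<tau>_def \<rho>_def)
  have \<tau>\<Lambda>: "\<tau> n \<le> 1 / (2 * \<Lambda> + 2)" for n
  proof (rule power_le_imp_le_base)
    have "(2 * \<Lambda> + 2) ^ 8 > 0" using \<Lambda> by simp
    then have "1 / real (k n) \<le> 1 / (2 * \<Lambda> + 2) ^ 8"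
      using kN(1)[of n] kpos[of n] by (intro divide_left_mono) (auto simp: k_def)
    then show "\<tau> n ^ Suc 7 \<le> (1 / (2 * \<Lambda> + 2)) ^ Suc 7"
      using \<tau>8[of n] by (simp add: power_one_over)
  qed (use \<Lambda> in auto)
  have \<tau>half: "\<tau> n \<le> 1/2" for n
  proof -
    have "1 / (2 * \<Lambda> + 2) \<le> 1 / 2" using \<Lambda> by (intro divide_left_mono) auto
    then show ?thesis using \<tau>\<Lambda>[of n] by linarith
  qed
  have \<tau>small: "\<tau> n * \<Lambda> \<le> 1/2" for n
  proof -
    have "1 / (2 * \<Lambda> + 2) * \<Lambda> \<le> 1/2" using \<Lambda> by (simp add: field_simps)
    then show ?thesis using mult_right_mono[OF \<tau>\<Lambda> \<Lambda>, of n] by linarith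
  qed
  \<comment> \<open>The first term removes the high sine coefficients of \<open>q\<close> itself, so that \<open>b\<close> alone prescribes those of \<open>Q b\<close>.\<close>
  define a where "a b n = - (of_real (2 / pi) * sine_coeff (k n) q) + b n * of_real (\<tau> n ^ 5)"
    for b :: "nat \<Rightarrow> complex" and n
  define Q where "Q b = (\<lambda>t. q t + sine_series k (a b) t)" for b
  have \<sigma>N: "(\<Sum>n<K. \<sigma> (N + n)) \<le> \<eta>" for K by (rule N1) (simp add: N_def)
  have a_le: "(cmod (a b n))\<^sup>2 \<le> \<sigma> (N + n)" if b: "\<And>m. norm (b m) \<le> 1" for b n
  proof -
    have "(cmod (b n * of_real (\<tau> n ^ 5)))\<^sup>2 = (cmod (b n))\<^sup>2 * \<tau> n ^ 10"
      using \<tau>0[of n] by (simp add: norm_mult power_mult_distrib norm_power flip: power_mult)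
    also have "\<dots> \<le> 1\<^sup>2 * \<tau> n ^ 10" using b[of n] \<tau>0[of n] by (intro mult_right_mono power_mono) auto
    finally have "(cmod (b n * of_real (\<tau> n ^ 5)))\<^sup>2 \<le> \<tau> n ^ 10" by simp
    then show ?thesis unfolding a_def \<sigma>_def
      using norm_add_sq_le[of "- (of_real (2 / pi) * sine_coeff (k n) q)" "b n * of_real (\<tau> n ^ 5)"]
      by (simp add: k_def \<tau>_def norm_mult)
  qed
  have a_sum: "(\<Sum>n<K. (cmod (a b n))\<^sup>2) \<le> \<eta>" if "\<And>m. norm (b m) \<le> 1" for b K
    by (rule order_trans[OF sum_mono \<sigma>N]) (rule a_le[OF that])
  have a_summable: "summable (\<lambda>n. (cmod (a b n))\<^sup>2)" if "\<And>m. norm (b m) \<le> 1" for b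
    by (rule summableI_nonneg_bounded[OF _ a_sum[OF that]]) auto
  note series = sine_series(1)[OF kinj kpos a_summable]
  have QL2: "L2_fun (Q b)" if "\<And>m. norm (b m) \<le> 1" for b
    unfolding Q_def by (intro L2_fun_add assms(1) series that)
  have Q1: "L1_norm (Q b) \<le> M" if b: "\<And>m. norm (b m) \<le> 1" for b
  proof -
    have sb: "L2_fun (sine_series k (a b))" by (rule series[OF b])
    have "norm2_sq (sine_series k (a b)) \<le> 2 * pi * \<eta>"
      by (rule norm2_sq_sine_series[OF kinj kpos a_summable[OF b] a_sum[OF b]])
    then have "L1_norm (sine_series k (a b)) \<le> 1"
      using \<eta> by (intro L1_norm_le_of_norm2_sq_le[where \<eta> = \<eta>] sb) auto
    then show ?thesis
      unfolding Q_def M_def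
      using L1_norm_triangle[OF L2_fun_imp_absolutely_integrable[OF assms(1)] L2_fun_imp_absolutely_integrable[OF sb]]
      by linarith
  qed
  \<comment> \<open>The coefficients of q cancel in the difference, and the factors
    \<open>\<tau> n ^ 5\<close> have a small square sum, so the supremum of |b - b'| controls the L1
    norm with constant 1.\<close>
  have Qlip: "L1_norm (\<lambda>t. Q b t - Q b' t) \<le> D"
    if b: "\<And>m. norm (b m) \<le> 1" and b': "\<And>m. norm (b' m) \<le> 1" and D: "\<And>m. norm (b m - b' m) \<le> D" for b b' D
  proof -
    have D0: "D \<ge> 0" using D[of 0] norm_ge_zero order_trans by blast
    have "(\<Sum>n<K. (cmod (a b n - a b' n))\<^sup>2) \<le> \<eta> * D\<^sup>2" for K
    proof -
      have "(cmod (a b n - a b' n))\<^sup>2 \<le> \<sigma> (N + n) * D\<^sup>2" for n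
      proof -
        have "a b n - a b' n = (b n - b' n) * of_real (\<tau> n ^ 5)" by (simp add: a_def algebra_simps)
        then have "(cmod (a b n - a b' n))\<^sup>2 = (cmod (b n - b' n))\<^sup>2 * \<tau> n ^ 10"
          using \<tau>0[of n] by (simp add: norm_mult power_mult_distrib norm_power flip: power_mult)
        also have "\<dots> \<le> D\<^sup>2 * \<sigma> (N + n)"
        proof (intro mult_mono power_mono D)
          show "\<tau> n ^ 10 \<le> \<sigma> (N + n)" using \<tau>0[of n] by (simp add: \<sigma>_def \<tau>_def add_increasing)
        qed (use \<tau>0[of n] in auto)
        finally show ?thesis by (simp add: mult.commute)
      qed
      then have "(\<Sum>n<K. (cmod (a b n - a b' n))\<^sup>2) \<le> (\<Sum>n<K. \<sigma> (N + n)) * D\<^sup>2"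
        unfolding sum_distrib_right by (intro sum_mono)
      also have "\<dots> \<le> \<eta> * D\<^sup>2" by (intro mult_right_mono \<sigma>N) auto
      finally show ?thesis .
    qed
    from norm2_sq_sine_series_diff[OF kinj kpos a_summable[OF b] a_summable[OF b'] this]
    have "norm2_sq (\<lambda>t. sine_series k (a b) t - sine_series k (a b') t) \<le> pi * (\<eta> * D\<^sup>2)" .
    also have "\<dots> \<le> 2 * pi * (\<eta> * D\<^sup>2)" using \<eta> by simp
    finally have "L1_norm (\<lambda>t. sine_series k (a b) t - sine_series k (a b') t) \<le> D"
      by (intro L1_norm_le_of_norm2_sq_le[where \<eta> = \<eta>] L2_fun_diff series b b' \<eta> D0)
    then show ?thesis by (simp add: Q_def)
  qed
  have Qcoeff: "sine_coeff (k n) (Q b) = of_real (pi / 2) * of_real (\<tau> n ^ 5) * b n"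
    if b: "\<And>m. norm (b m) \<le> 1" for b n
    unfolding Q_def sine_coeff_add[OF assms(1) series[OF b]] sine_coeff_sine_series[OF kinj kpos a_summable[OF b]]
    by (simp add: a_def field_simps)
  note Qai = L2_fun_imp_absolutely_integrable[OF QL2]
  have k2: "real (k n) \<ge> 2 * M + 2" for n using kN(2) by (simp add: k_def)
  have "\<exists>b w. \<forall>n. norm (b n) \<le> 1 \<and> norm (w n) \<le> \<tau> n ^ 7
    \<and> root_fun (\<tau> n) (char_remainder A (k n) (Q b)) (w n) = of_real (pi / 2) * \<beta> * of_real (\<tau> n ^ 5) * b n
    \<and> root_deriv (\<tau> n) (char_remainder A (k n) (Q b)) (w n) = 0"
  proof (rule double_root_sequence[OF \<beta> C \<tau>0 \<tau>half])
    show "\<tau> n * ((6 * exp pi + 3 * C) + 1 / norm \<beta> * (24 * exp pi + 9 * C)) \<le> 1/2" for n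
      using \<tau>small[of n] by (simp add: \<Lambda>_def)
    show "char_remainder A (k n) (Q b) holomorphic_on ball 0 1" if "\<And>m. norm (b m) \<le> 1" for n b
      by (rule char_remainder_holomorphic[OF M k2 ev Qai[OF that]])
    show "norm (char_remainder A (k n) (Q b) z) \<le> C" if "\<And>m. norm (b m) \<le> 1" "z \<in> ball 0 1" for n b z
      unfolding C_def by (rule char_remainder_bound(1)[OF M k2 ev Qai[OF that(1)] Q1[OF that(1)] that(2)])
    show "norm (char_remainder A (k n) (Q b) 0) \<le> C * \<tau> n ^ 8" if "\<And>m. norm (b m) \<le> 1" for n b
      unfolding C_def \<tau>8 by (rule char_remainder_bound(2)[OF M k2 ev Qai[OF that(1)] Q1[OF that(1)]])
    show "norm (char_remainder A (k n) (Q b) z - char_remainder A (k n) (Q b') z) \<le> C * D"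
      if "\<And>m. norm (b m) \<le> 1" "\<And>m. norm (b' m) \<le> 1" "\<And>m. norm (b m - b' m) \<le> D" "z \<in> ball 0 1" for n b b' z D
      unfolding C_def
      by (rule char_remainder_lipschitz(1)[OF M k2 ev QL2[OF that(1)] QL2[OF that(2)] Q1[OF that(1)] Q1[OF that(2)]
          Qlip[OF that(1,2,3)] that(4)])
    show "norm (char_remainder A (k n) (Q b) 0 - char_remainder A (k n) (Q b') 0) \<le> C * D * \<tau> n ^ 8"
      if "\<And>m. norm (b m) \<le> 1" "\<And>m. norm (b' m) \<le> 1" "\<And>m. norm (b m - b' m) \<le> D" for n b b' D
      unfolding C_def \<tau>8
      by (rule char_remainder_lipschitz(2)[OF M k2 ev QL2[OF that(1)] QL2[OF that(2)] Q1[OF that(1)] Q1[OF that(2)]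
          Qlip[OF that(1,2,3)]])
  qed
  then obtain b w where b: "\<And>n. norm (b n) \<le> 1" and w: "\<And>n. norm (w n) \<le> \<tau> n ^ 7"
    and zero: "\<And>n. root_fun (\<tau> n) (char_remainder A (k n) (Q b)) (w n) = of_real (pi / 2) * \<beta> * of_real (\<tau> n ^ 5) * b n"
    and dzero: "\<And>n. root_deriv (\<tau> n) (char_remainder A (k n) (Q b)) (w n) = 0"
    by metis
  have w1: "norm (w n) < 1" for n
    using w[of n] power_decreasing[of 1 7 "\<tau> n"] \<tau>0[of n] \<tau>half[of n] by simp
  have zero': "root_fun (\<tau> n) (char_remainder A (k n) (Q b)) (w n) = (bc_alpha A - 1/2) * sine_coeff (k n) (Q b)" for n
    unfolding zero Qcoeff[OF b] \<beta>_def by (simp add: mult_ac)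
  have \<tau>inv: "1 / \<tau> n ^ 8 = real (k n)" for n by (simp add: \<tau>8)
  note roots = double_root_of_char_det[OF M k2 ev Qai[OF b] \<tau>inv w1 zero' dzero]
  \<comment> \<open>The double zeros are numbered from N on. For n < N the truncated difference n -
    N yields \<open>w 0\<close>, about which \<open>finite_simple_zeros\<close> asks
    nothing.\<close>
  have "finite {lam. zorder (char_det A (Q b)) lam = 1}"
  proof (rule finite_simple_zeros[where N = N and w = "\<lambda>n. w (n - N)", OF Qai[OF b]])
    fix n assume n: "n \<ge> N"
    then have "2 * n + bc_theta A = k (n - N)" by (simp add: k_def kk_def)
    then show "char_det A (Q b) ((of_nat (2 * n + bc_theta A) + w (n - N))\<^sup>2) = 0"
      "deriv (char_det A (Q b)) ((of_nat (2 * n + bc_theta A) + w (n - N))\<^sup>2) = 0"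
      using roots[of "n - N"] by simp_all
  next
    have "w \<longlonglongrightarrow> 0"
    proof (rule Lim_null_comparison)
      show "\<forall>\<^sub>F n in sequentially. norm (w n) \<le> real (n + 1) powr (- 1/8)"
      proof (intro always_eventually allI)
        fix n
        have "norm (w n) \<le> \<tau> n ^ 1"
          using w[of n] power_decreasing[of 1 7 "\<tau> n"] \<tau>0[of n] \<tau>half[of n] by simp
        also have "\<dots> \<le> real (n + 1) powr (- 1/8)"
        proof -
          have "(2 * \<Lambda> + 2) ^ 8 \<ge> 0" using \<Lambda> by simp
          then have "real N2 > 0" using N2 M by linarith
          then have "real (n + 1) \<le> real (k n)" by (simp add: k_def kk_def N_def)
          then show ?thesis unfolding \<tau>_def \<rho>_def k_def[symmetric] by (simp add: powr_mono2')
        qed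
        finally show "norm (w n) \<le> real (n + 1) powr (- 1/8)" .
      qed
      have "(\<lambda>n. real n powr (- 1/8)) \<longlonglongrightarrow> 0"
        by (rule tendsto_neg_powr) (auto simp: filterlim_real_sequentially)
      then show "(\<lambda>n. real (n + 1) powr (- 1/8)) \<longlonglongrightarrow> 0" by (rule LIMSEQ_ignore_initial_segment)
    qed
    then show "(\<lambda>n. w (n - N)) \<longlonglongrightarrow> 0"
      by - (rule LIMSEQ_offset[where k = N], simp)
  qed
  then have "asymptotically_multiple A (Q b)"
    unfolding asymptotically_multiple_def
    by (rule rev_finite_subset) (auto simp: simple_eigenvalue_def alg_mult_def)
  moreover have "L2_norm (\<lambda>x. q x - Q b x) < \<epsilon>"
  proof -
    have "norm2_sq (\<lambda>x. q x - Q b x) = norm2_sq (sine_series k (a b))"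
      by (simp add: Q_def norm2_sq_def)
    also have "\<dots> \<le> 2 * pi * \<eta>" by (rule norm2_sq_sine_series[OF kinj kpos a_summable[OF b] a_sum[OF b]])
    also have "\<dots> \<le> 6.4 * (\<epsilon>\<^sup>2 / 7)" using pi_bounds \<eta> by (intro mult_mono) auto
    also have "\<dots> < \<epsilon>\<^sup>2" using assms(5) by simp
    finally have "sqrt (norm2_sq (\<lambda>x. q x - Q b x)) < sqrt (\<epsilon>\<^sup>2)" by (rule real_sqrt_less_mono)
    then show ?thesis using assms(5) by (simp add: L2_norm_eq)
  qed
  moreover have "L2_fun (Q b)" by (rule QL2[OF b])
  ultimately show ?thesis by (intro exI[of _ "Q b"] conjI)
qed

end
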